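(* Let $N\in\mathbb N$ and let $\omega$ be an admissible radial measure on $\overline{\mathbb B_d}$. If $\varphi,\psi\in \mathrm{Mult}(B^N_\omega)$ with $\varphi/\psi\in H^\infty(\mathbb B_d)$, then $\varphi^{N+1}/\psi\in\mathrm{Mult}(B^N_\omega)$.
   Context: $\mathbb N=\{1,2,\dots\}$, $d\in\mathbb N$, $\mathbb B_d$ is the open unit ball of $\mathbb C^d$, $\sigma$ is the normalized rotationally invariant measure on $\partial\mathbb B_d$, $\mathrm{Hol}(\mathbb B_d)$ is the set of analytic functions on $\mathbb B_d$, and $H^\infty(\mathbb B_d)$ is the set of bounded ones. An admissible radial measure $\omega$ on $\overline{\mathbb B_d}$ is one of the form $d\omega(z)=d\mu(r)\,d\sigma(w)$, $z=rw$ (i.e. the image of $\mu\times\sigma$ under $(r,w)\mapsto rw$), where $\mu$ is a finite Borel measure on $[0,1]$ with $\mu((r,1])>0$ for all $0<r<1$. For analytic $f$ put $\|f\|^2_{L^2(\omega)}=\int_{\mathbb B_d}|f|^2d\omega+\mu(\{1\})\|f\|^2_{H^2(\partial\mathbb B_d)}$, where $\|f\|^2_{H^2(\partial\mathbb B_d)}=\sup_{0<r<1}\int_{\partial\mathbb B_d}|f(rw)|^2d\sigma(w)$ and the second term is omitted if $\mu(\{1\})=0$. Let $R=\sum_{j=1}^d z_j\frac{\partial}{\partial z_j}$. The radially weighted Besov space is $B^N_\omega=\{f\in\mathrm{Hol}(\mathbb B_d):\|R^Nf\|_{L^2(\omega)}<\infty\}$ with $\|f\|^2_{B^N_\omega}=\mu([0,1])|f(0)|^2+\|R^Nf\|^2_{L^2(\omega)}$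 for $N\ge1$. $\mathrm{Mult}(B^N_\omega)=\{\varphi:\varphi f\in B^N_\omega\text{ for all }f\in B^N_\omega\}$. The notation $\varphi/\psi\in H^\infty(\mathbb B_d)$ means that $\psi$ is not identically zero and $\varphi=h\psi$ for some $h\in H^\infty(\mathbb B_d)$; similarly $\varphi^{N+1}/\psi$ denotes the analytic function $h$ with $\varphi^{N+1}=h\psi$. *)

theory Defs
  imports "HOL-Probability.Probability"
begin

section \<open>Analytic functions on the unit ball\<close>

text \<open>
  The space of \<open>d\<close>-tuples of complex numbers is \<^typ>\<open>complex ^ 'd\<close> with \<open>d = CARD('d)\<close>.
  Functions on the unit ball are total functions, of which only the values on
  \<open>ball 0 1\<close> matter; all notions below depend on these values only.
\<close>

text \<open>Complex (Frechet) differentiability at every point of \<open>S\<close>.\<close>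

definition Hol :: "(complex ^ 'd) set \<Rightarrow> (complex ^ 'd \<Rightarrow> complex) set" where
  "Hol S = {f. \<forall>z\<in>S. \<exists>L. (f has_derivative L) (at z) \<and> (\<forall>c v. L (c *s v) = c * L v)}"

definition Hinf :: "(complex ^ 'd \<Rightarrow> complex) set" where
  "Hinf = {f \<in> Hol (ball 0 1). bounded (f ` ball 0 1)}"

definition partial_deriv :: "'d \<Rightarrow> (complex ^ 'd \<Rightarrow> complex) \<Rightarrow> complex ^ 'd \<Rightarrow> complex" where
  "partial_deriv j f z = deriv (\<lambda>t. f (\<chi> i. if i = j then t else z $ i)) (z $ j)"

definition radial_deriv :: "(complex ^ 'd \<Rightarrow> complex) \<Rightarrow> complex ^ 'd \<Rightarrow> complex" where
  "radial_deriv f z = (\<Sum>j\<in>UNIV. z $ j * partial_deriv j f z)"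

section \<open>The rotation invariant probability measure on the unit sphere\<close>

text \<open>
  The normalized Lebesgue measure of the ball is pushed forward along \<open>x \<mapsto> x / norm x\<close>.
  The result is a Borel probability measure on the whole space that is concentrated on
  \<open>sphere 0 1\<close> and invariant under all linear isometries, as shown below.
\<close>

definition sphere_measure :: "'a::euclidean_space measure" where
  "sphere_measure = distr (uniform_measure lborel (ball 0 1)) borel sgn"

lemma borel_measurable_sgn_euclidean [measurable]:
  "(sgn :: 'a::euclidean_space \<Rightarrow> 'a) \<in> borel_measurable borel"
  unfolding sgn_div_norm by measurable

lemma emeasure_unit_ball:
  "emeasure lborel (ball (0::'a::euclidean_space) 1) \<noteq> 0"
  "emeasure lborel (ball (0::'a::euclidean_space) 1) \<noteq> \<infinity>"
  by (simp_all add: emeasure_ball less_imp_neq[OF unit_ball_vol_pos, symmetric])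

lemma space_sphere_measure [simp]: "space sphere_measure = UNIV"
  by (simp add: sphere_measure_def)

lemma sets_sphere_measure [simp, measurable_cong]: "sets sphere_measure = sets borel"
  by (simp add: sphere_measure_def)

lemma prob_space_sphere_measure: "prob_space (sphere_measure :: 'a::euclidean_space measure)"
proof -
  interpret prob_space "uniform_measure lborel (ball (0::'a) 1)"
    using emeasure_unit_ball by (intro prob_space_uniform_measure) auto
  show ?thesis
    unfolding sphere_measure_def by (rule prob_space_distr) simp
qed

lemma AE_sphere_measure: "AE w in sphere_measure. w \<in> sphere (0::'a::euclidean_space) 1"
proof -
  have "AE x in (lborel::'a measure). x \<noteq> 0"
    by (rule AE_lborel_singleton)
  then have "AE x in uniform_measure lborel (ball (0::'a) 1). sgn x \<in> sphere 0 1"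
    by (intro AE_uniform_measureI) (auto simp: norm_sgn)
  then show ?thesis
    unfolding sphere_measure_def by (subst AE_distr_iff) auto
qed

lemma lborel_orthogonal_transformation:
  fixes f :: "'a::euclidean_space \<Rightarrow> 'a"
  assumes f: "orthogonal_transformation f"
  shows "distr lborel borel f = lborel"
proof -
  have lin: "linear f" and nrm: "\<And>x. norm (f x) = norm x"
    using f by (auto simp: orthogonal_transformation)
  have [measurable]: "f \<in> borel_measurable borel"
    using lin by (intro borel_measurable_continuous_onI linear_continuous_on)
      (simp add: linear_conv_bounded_linear)
  define M where "M = distr lborel borel f"
  have [simp]: "space M = UNIV" and sM [simp, measurable_cong]: "sets M = sets borel"
    by (auto simp: M_def)
  define B where "B = ball (0::'a) 1"
  have [measurable]: "B \<in> sets borel" by (simp add: B_def)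
  have "surj f" using f by (rule orthogonal_transformation_surj)
  have trans: "distr M borel ((+) c) = M" for c
  proof -
    obtain b where b: "c = f b" using \<open>surj f\<close> by (metis surjD)
    have "distr M borel ((+) c) = distr lborel borel (\<lambda>x. f (b + x))"
      unfolding M_def
      by (subst distr_distr) (auto simp: b comp_def linear_add[OF lin])
    also have "\<dots> = distr (distr lborel borel ((+) b)) borel f"
      by (subst distr_distr) (auto simp: comp_def)
    finally show ?thesis by (simp add: lborel_distr_plus M_def)
  qed
  have nnM: "(\<integral>\<^sup>+x. g (y + x) \<partial>M) = (\<integral>\<^sup>+x. g x \<partial>M)"
    if [measurable]: "g \<in> borel_measurable borel" for g :: "'a \<Rightarrow> ennreal" and y
  proof -
    have "(\<integral>\<^sup>+x. g x \<partial>M) = (\<integral>\<^sup>+x. g x \<partial>distr M borel ((+) y))" by (simp add: trans)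
    also have "\<dots> = (\<integral>\<^sup>+x. g (y + x) \<partial>M)" by (rule nn_integral_distr) auto
    finally show ?thesis ..
  qed
  have nnL: "(\<integral>\<^sup>+x. g (y + x) \<partial>lborel) = (\<integral>\<^sup>+x. g x \<partial>lborel)"
    if [measurable]: "g \<in> borel_measurable borel" for g :: "'a \<Rightarrow> ennreal" and y
  proof -
    have "(\<integral>\<^sup>+x. g x \<partial>lborel) = (\<integral>\<^sup>+x. g x \<partial>distr lborel borel ((+) y))"
      by (simp add: lborel_distr_plus)
    also have "\<dots> = (\<integral>\<^sup>+x. g (y + x) \<partial>lborel)" by (rule nn_integral_distr) auto
    finally show ?thesis ..
  qed
  have finM: "emeasure M (ball 0 r) < \<infinity>" for r
  proof -
    have "f -` ball 0 r = ball 0 r" by (auto simp: nrm)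
    then show ?thesis using emeasure_lborel_ball_finite[of "0::'a" r]
      by (simp add: M_def emeasure_distr)
  qed
  have MB: "emeasure M B = emeasure lborel B"
  proof -
    have "f -` B = B" by (auto simp: nrm B_def)
    then show ?thesis by (simp add: M_def emeasure_distr)
  qed
  have "sigma_finite_measure M"
  proof
    have "x \<in> (\<Union>n::nat. ball 0 (real n))" for x :: 'a
      using reals_Archimedean2[of "norm x"] by auto
    then show "\<exists>A. countable A \<and> A \<subseteq> sets M \<and> \<Union>A = space M \<and> (\<forall>a\<in>A. emeasure M a \<noteq> \<infinity>)"
      using finM by (intro exI[of _ "range (\<lambda>n::nat. ball 0 (real n))"]) (auto simp: less_top)
  qed
  then interpret P: pair_sigma_finite M "lborel :: 'a measure"
    by (simp add: pair_sigma_finite_def lborel.sigma_finite_measure_axioms)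
  have "emeasure M A = emeasure lborel A" if "A \<in> sets M" for A
  proof -
    have [measurable]: "A \<in> sets borel" using that by simp
    have "emeasure M A * emeasure lborel B
        = (\<integral>\<^sup>+x. indicator A x * (\<integral>\<^sup>+y. indicator B y \<partial>lborel) \<partial>M)"
      by (simp add: nn_integral_multc)
    also have "\<dots> = (\<integral>\<^sup>+x. indicator A x * (\<integral>\<^sup>+y. indicator B (- x + y) \<partial>lborel) \<partial>M)"
      by (subst nnL) simp_all
    also have "\<dots> = (\<integral>\<^sup>+x. (\<integral>\<^sup>+y. indicator A x * indicator B (- x + y) \<partial>lborel) \<partial>M)"
      by (intro nn_integral_cong nn_integral_cmult[symmetric]) measurable
    also have "\<dots> = (\<integral>\<^sup>+y. (\<integral>\<^sup>+x. indicator A x * indicator B (- x + y) \<partial>M) \<partial>lborel)"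
      by (rule P.Fubini'[symmetric]) measurable
    also have "\<dots> = (\<integral>\<^sup>+y. (\<integral>\<^sup>+x. indicator A (y + x) * indicator B (- (y + x) + y) \<partial>M) \<partial>lborel)"
      by (intro nn_integral_cong nnM[symmetric]) measurable
    also have "\<dots> = (\<integral>\<^sup>+y. (\<integral>\<^sup>+x. indicator B x * indicator A (x + y) \<partial>M) \<partial>lborel)"
      by (intro nn_integral_cong) (auto simp: B_def indicator_def add.commute)
    also have "\<dots> = (\<integral>\<^sup>+x. (\<integral>\<^sup>+y. indicator B x * indicator A (x + y) \<partial>lborel) \<partial>M)"
      by (rule P.Fubini') measurable
    also have "\<dots> = (\<integral>\<^sup>+x. indicator B x * (\<integral>\<^sup>+y. indicator A (x + y) \<partial>lborel) \<partial>M)"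
      by (intro nn_integral_cong nn_integral_cmult) measurable
    also have "\<dots> = emeasure lborel B * emeasure lborel A"
      by (subst nnL) (simp_all add: nn_integral_multc MB)
    finally show ?thesis
      using emeasure_unit_ball[where 'a='a] unfolding B_def
      by (metis ennreal_mult_cancel_left mult.commute infinity_ennreal_def)
  qed
  then show ?thesis
    unfolding M_def[symmetric] by (intro measure_eqI) auto
qed

lemma sphere_measure_rotation_invariant:
  fixes f :: "'a::euclidean_space \<Rightarrow> 'a"
  assumes f: "orthogonal_transformation f"
  shows "distr sphere_measure borel f = sphere_measure"
proof -
  have lin: "linear f" and nrm: "\<And>x. norm (f x) = norm x"
    using f by (auto simp: orthogonal_transformation)
  have [measurable]: "f \<in> borel_measurable borel"
    using lin by (intro borel_measurable_continuous_onI linear_continuous_on)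
      (simp add: linear_conv_bounded_linear)
  let ?U = "uniform_measure lborel (ball (0::'a) 1)"
  have "distr ?U borel f = ?U"
  proof (rule measure_eqI)
    fix A assume "A \<in> sets (distr ?U borel f)"
    then have [measurable]: "A \<in> sets borel" by simp
    have "emeasure lborel (ball 0 1 \<inter> f -` A) = emeasure (distr lborel borel f) (ball 0 1 \<inter> A)"
      by (subst emeasure_distr) (auto intro!: arg_cong2[where f=emeasure] simp: nrm)
    then show "emeasure (distr ?U borel f) A = emeasure ?U A"
      using measurable_sets[of f borel borel A]
      by (simp add: emeasure_distr lborel_orthogonal_transformation[OF f])
  qed simp
  moreover have "distr sphere_measure borel f = distr (distr ?U borel f) borel sgn"
    unfolding sphere_measure_def
    by (simp add: distr_distr comp_def sgn_div_norm nrm linear_cmul[OF lin])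
  ultimately show ?thesis
    by (simp add: sphere_measure_def)
qed

section \<open>Radially weighted Besov spaces\<close>

text \<open>
  An admissible radial measure is represented by its radial part \<open>\<mu>\<close>, a measure on \<open>{0..1}\<close>.
\<close>

definition admissible :: "real measure \<Rightarrow> bool" where
  "admissible \<mu> \<longleftrightarrow> finite_measure \<mu> \<and> sets \<mu> = sets (restrict_space borel {0..1}) \<and>
     (\<forall>r. 0 < r \<and> r < 1 \<longrightarrow> emeasure \<mu> {r<..1} > 0)"

definition radial_measure :: "real measure \<Rightarrow> (complex ^ 'd) measure" where
  "radial_measure \<mu> = distr (\<mu> \<Otimes>\<^sub>M sphere_measure) borel (\<lambda>(r, w). r *\<^sub>R w)"

lemma measurable_radial_product:
  assumes "admissible \<mu>"
  shows "(\<lambda>(r, w). r *\<^sub>R w) \<in> \<mu> \<Otimes>\<^sub>M sphere_measure \<rightarrow>\<^sub>M (borel :: (complex ^ 'd) measure)"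
proof -
  have "(\<lambda>r. r) \<in> restrict_space borel {0..1::real} \<rightarrow>\<^sub>M borel"
    by (intro measurable_restrict_space1) simp
  then have [measurable]: "(\<lambda>r. r) \<in> \<mu> \<rightarrow>\<^sub>M borel"
    using assms measurable_cong_sets[of \<mu> "restrict_space borel {0..1}" borel borel]
    by (auto simp: admissible_def)
  show ?thesis
    by measurable
qed

definition hardy_norm_sq :: "(complex ^ 'd \<Rightarrow> complex) \<Rightarrow> ennreal" where
  "hardy_norm_sq f =
     (SUP r\<in>{0<..<1::real}. \<integral>\<^sup>+w\<in>sphere 0 1. ennreal ((cmod (f (r *\<^sub>R w)))\<^sup>2) \<partial>sphere_measure)"

text \<open>In \<^typ>\<open>ennreal\<close> we have \<open>0 * \<infinity> = 0\<close>, so the second term vanishes if \<open>\<mu> {1} = 0\<close>.\<close>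

definition L2_norm_sq :: "real measure \<Rightarrow> (complex ^ 'd \<Rightarrow> complex) \<Rightarrow> ennreal" where
  "L2_norm_sq \<mu> f =
     (\<integral>\<^sup>+z\<in>ball 0 1. ennreal ((cmod (f z))\<^sup>2) \<partial>radial_measure \<mu>)
     + emeasure \<mu> {1} * hardy_norm_sq f"

definition Besov :: "nat \<Rightarrow> real measure \<Rightarrow> (complex ^ 'd \<Rightarrow> complex) set" where
  "Besov N \<mu> = {f \<in> Hol (ball 0 1). L2_norm_sq \<mu> ((radial_deriv ^^ N) f) < \<infinity>}"

definition Mult :: "nat \<Rightarrow> real measure \<Rightarrow> (complex ^ 'd \<Rightarrow> complex) set" where
  "Mult N \<mu> = {\<phi>. \<forall>f\<in>Besov N \<mu>. (\<lambda>z. \<phi> z * f z) \<in> Besov N \<mu>}"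

text \<open>
  \<open>quotient_in \<phi> \<psi> A\<close> says that \<open>\<phi>/\<psi>\<close> is (defined and equal to) an analytic function that
  belongs to \<open>A\<close>. By the identity theorem, \<open>h\<close> is unique as a function on the ball.
\<close>

definition quotient_in ::
    "(complex ^ 'd \<Rightarrow> complex) \<Rightarrow> (complex ^ 'd \<Rightarrow> complex) \<Rightarrow> (complex ^ 'd \<Rightarrow> complex) set \<Rightarrow> bool"
  where
  "quotient_in \<phi> \<psi> A \<longleftrightarrow> (\<exists>z\<in>ball 0 1. \<psi> z \<noteq> 0) \<and>
     (\<exists>h\<in>Hol (ball 0 1) \<inter> A. \<forall>z\<in>ball 0 1. \<phi> z = h z * \<psi> z)"

end

theory Submission
  imports Defs "HOL-Complex_Analysis.Complex_Analysis"
begin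

text \<open>
  Write \<open>h = \<phi>/\<psi>\<close>, so that \<open>\<phi>^(N+1)/\<psi> = h^(N+1) \<psi>^N\<close>. Applying \<open>R^N\<close> to
  \<open>h^(N+1) \<psi>^N f\<close> differentiates \<open>h\<close> at most \<open>N\<close> times, and by \<open>\<psi> R h = R \<phi> - h R \<psi>\<close> each
  derivative of \<open>h\<close> can be traded against one of the \<open>N\<close> factors \<open>\<psi>\<close>. What remains is a
  bounded function (powers of \<open>h\<close>) times derivatives of \<open>\<phi>\<close>, \<open>\<psi>\<close> and \<open>f\<close> of total
  order \<open>N\<close>, and such a product lies in \<open>L\<^sup>2(\<omega>)\<close> as soon as \<open>\<phi>\<close> and \<open>\<psi>\<close> multiply not only
  the space of order \<open>N\<close> but all spaces of order \<open>m \<le> N\<close>: then \<open>R \<phi>\<close> maps order \<open>m+1\<close> to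
  order \<open>m\<close>, because \<open>(R \<phi>) u = R (\<phi> u) - \<phi> R u\<close>. This is organised as an induction on the
  order in \<open>Besov_quotient_power\<close>.

  The heart of the matter is therefore the inclusion of the multipliers of order \<open>N\<close> in those
  of order \<open>m \<le> N\<close> (\<open>Mult_antimono\<close>). Expand functions into homogeneous polynomials,
  \<open>f = \<Sum>n. f\<^sub>n\<close>. Since \<open>\<omega>\<close> is invariant under \<open>z \<mapsto> c z\<close> with \<open>|c| = 1\<close>, the components are
  orthogonal, and the norm of order \<open>N\<close> is, up to equivalence, the weighted sum
  \<open>\<Sum>n. (n+1)^(2N) m\<^sub>n \<parallel>f\<^sub>n\<parallel>\<^sup>2\<close>, where \<open>m\<^sub>n\<close> are moments of \<open>\<mu>\<close> and the norm of \<open>f\<^sub>n\<close> is that of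
  \<open>L\<^sup>2\<close> of the sphere (\<open>Besov_iff_energy\<close>). Conversely every graded sequence of finite norm comes
  from a function on the ball (\<open>graded_sum_Besov\<close>).

  A multiplier of order \<open>N\<close> is a bounded operator (\<open>conv_bounded\<close>). To pass from \<open>N+1\<close> to
  \<open>N\<close> one has to multiply the matrix entry from degree \<open>l\<close> to degree \<open>k\<close> by \<open>(l+1)/(k+1)\<close>,
  and the matrix is lower triangular: only \<open>k \<ge> l\<close> matters. On these entries the factor agrees
  with \<open>min/max\<close> of \<open>k+1\<close> and \<open>l+1\<close>, a positive definite kernel with diagonal \<open>1\<close>, and Schur
  multiplication by such a kernel does not increase the operator norm. Explicitly, with
  \<open>P\<^sub>j = \<Sum>n\<ge>j. p\<^sub>n/(n+1)\<^sup>2\<close> one has \<open>p = \<Sum>j. (2j+1) P\<^sub>j\<close>, and \<open>\<phi> P\<^sub>j\<close> still has only components of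
  degree at least \<open>j\<close>; the Cauchy-Schwarz inequality with weights \<open>2j+1\<close> then gives the
  bound with the same constant (\<open>conv_bounded_lower_order\<close>).
\<close>

section \<open>Holomorphic functions of several variables\<close>

lemma norm_vector_smult_complex: "norm (c *s v) = cmod c * norm v" for v :: "complex ^ 'd"
  by (simp add: norm_vec_def norm_mult L2_set_right_distrib)

lemma scaleR_eq_vector_smult: "r *\<^sub>R v = complex_of_real r *s v" for v :: "complex ^ 'd"
  unfolding vec_eq_iff by (simp add: scaleR_conv_of_real[where 'a=complex])

lemma bounded_linear_vector_smult_left: "bounded_linear (\<lambda>t. t *s v)" for v :: "complex ^ 'd"
  by (rule bounded_linear_intro[where K="norm v"])
     (auto simp: vec_eq_iff algebra_simps norm_vector_smult_complex)

lemma bounded_linear_vector_smult_right: "bounded_linear (\<lambda>v. c *s v)" for c :: complex and v :: "complex ^ 'd"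
  by (rule bounded_linear_intro[where K="cmod c"])
     (auto simp: vec_eq_iff algebra_simps norm_vector_smult_complex)

lemma continuous_on_vector_smult_right [continuous_intros]:
  "continuous_on A f \<Longrightarrow> continuous_on A (\<lambda>x. c *s (f x :: complex ^ 'd))"
  by (rule bounded_linear.continuous_on[OF bounded_linear_vector_smult_right])

lemma orthogonal_transformation_vector_smult:
  "cmod c = 1 \<Longrightarrow> orthogonal_transformation (\<lambda>v :: complex ^ 'd. c *s v)"
  using bounded_linear_vector_smult_right[of c, THEN bounded_linear.linear]
  by (simp add: orthogonal_transformation norm_vector_smult_complex)

lemma HolI:
  assumes "\<And>z. z \<in> S \<Longrightarrow> (f has_derivative L z) (at z)"
    and "\<And>z c v. z \<in> S \<Longrightarrow> L z (c *s v) = c * L z v"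
  shows "f \<in> Hol S"
  using assms unfolding Hol_def by blast

lemma HolE:
  assumes "f \<in> Hol S"
  obtains L where "\<And>z. z \<in> S \<Longrightarrow> (f has_derivative L z) (at z)"
    and "\<And>z c v. z \<in> S \<Longrightarrow> L z (c *s v) = c * L z v"
  using assms unfolding Hol_def by simp metis

lemma Hol_subset: "f \<in> Hol S \<Longrightarrow> T \<subseteq> S \<Longrightarrow> f \<in> Hol T"
  by (auto simp: Hol_def)

lemma Hol_cong:
  assumes "open S" "\<And>z. z \<in> S \<Longrightarrow> f z = g z"
  shows "f \<in> Hol S \<longleftrightarrow> g \<in> Hol S"
proof -
  have "(f has_derivative L) (at z) = (g has_derivative L) (at z)" if "z \<in> S" for z L
    using has_derivative_transform_within_open[OF _ assms(1) that, of f L UNIV g]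
      has_derivative_transform_within_open[OF _ assms(1) that, of g L UNIV f] assms(2) by auto
  then show ?thesis
    by (simp add: Hol_def)
qed

lemma Hol_const [intro, simp]: "(\<lambda>z. c) \<in> Hol S"
  by (rule HolI[of _ _ "\<lambda>_ _. 0"]) auto

lemma Hol_add [intro]:
  assumes "f \<in> Hol S" "g \<in> Hol S" shows "(\<lambda>z. f z + g z) \<in> Hol S"
proof -
  from HolE[OF assms(1)] HolE[OF assms(2)] obtain L L' where
    "\<And>z. z \<in> S \<Longrightarrow> (f has_derivative L z) (at z)" "\<And>z. z \<in> S \<Longrightarrow> (g has_derivative L' z) (at z)"
    "\<And>z c v. z \<in> S \<Longrightarrow> L z (c *s v) = c * L z v" "\<And>z c v. z \<in> S \<Longrightarrow> L' z (c *s v) = c * L' z v"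
    by metis
  then show ?thesis
    by (intro HolI[of _ _ "\<lambda>z v. L z v + L' z v"] has_derivative_add) (simp_all add: distrib_left)
qed

lemma Hol_mult [intro]:
  assumes "f \<in> Hol S" "g \<in> Hol S" shows "(\<lambda>z. f z * g z) \<in> Hol S"
proof -
  from HolE[OF assms(1)] HolE[OF assms(2)] obtain L L' where
    "\<And>z. z \<in> S \<Longrightarrow> (f has_derivative L z) (at z)" "\<And>z. z \<in> S \<Longrightarrow> (g has_derivative L' z) (at z)"
    "\<And>z c v. z \<in> S \<Longrightarrow> L z (c *s v) = c * L z v" "\<And>z c v. z \<in> S \<Longrightarrow> L' z (c *s v) = c * L' z v"
    by metis
  then show ?thesis
    by (intro HolI[of _ _ "\<lambda>z v. f z * L' z v + L z v * g z"] has_derivative_mult)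
       (simp_all add: algebra_simps)
qed

lemma Hol_cmult [intro]: "f \<in> Hol S \<Longrightarrow> (\<lambda>z. c * f z) \<in> Hol S"
  by (rule Hol_mult) auto

lemma Hol_diff [intro]: "f \<in> Hol S \<Longrightarrow> g \<in> Hol S \<Longrightarrow> (\<lambda>z. f z - g z) \<in> Hol S"
  using Hol_add[OF _ Hol_cmult[of g S "-1"], of f] by simp

lemma Hol_sum [intro]: "(\<And>i. i \<in> I \<Longrightarrow> f i \<in> Hol S) \<Longrightarrow> (\<lambda>z. \<Sum>i\<in>I. f i z) \<in> Hol S"
  by (induction I rule: infinite_finite_induct) auto

lemma Hol_power [intro]: "f \<in> Hol S \<Longrightarrow> (\<lambda>z. f z ^ n) \<in> Hol S"
  by (induction n) auto

lemma Hol_scale: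
  assumes "f \<in> Hol S" "\<And>z. z \<in> T \<Longrightarrow> c *s z \<in> S" shows "(\<lambda>z. f (c *s z)) \<in> Hol T"
proof -
  from HolE[OF assms(1)] obtain L where
    L: "\<And>z. z \<in> S \<Longrightarrow> (f has_derivative L z) (at z)" "\<And>z c v. z \<in> S \<Longrightarrow> L z (c *s v) = c * L z v"
    by metis
  show ?thesis
  proof (rule HolI)
    fix z assume z: "z \<in> T"
    have "((\<lambda>z. c *s z) has_derivative (\<lambda>z. c *s z)) (at z)"
      by (rule bounded_linear_imp_has_derivative[OF bounded_linear_vector_smult_right])
    from has_derivative_compose[OF this L(1)] assms(2)[OF z]
    show "((\<lambda>z. f (c *s z)) has_derivative (\<lambda>v. L (c *s z) (c *s v))) (at z)" by simp
    show "L (c *s z) (c *s (a *s v)) = a * L (c *s z) (c *s v)" for a v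
      using L(2)[OF assms(2)[OF z], of "a" "c *s v"]
      by (simp add: mult.commute)
  qed
qed

lemma Hol_translate:
  assumes "f \<in> Hol S" "\<And>z. z \<in> T \<Longrightarrow> a + z \<in> S" shows "(\<lambda>z. f (a + z)) \<in> Hol T"
proof -
  from HolE[OF assms(1)] obtain L where
    L: "\<And>z. z \<in> S \<Longrightarrow> (f has_derivative L z) (at z)" "\<And>z c v. z \<in> S \<Longrightarrow> L z (c *s v) = c * L z v"
    by metis
  show ?thesis
  proof (rule HolI)
    fix z assume z: "z \<in> T"
    have "((\<lambda>z. a + z) has_derivative (\<lambda>z. z)) (at z)"
      by (auto intro!: derivative_eq_intros)
    from has_derivative_compose[OF this L(1)] assms(2)[OF z]
    show "((\<lambda>z. f (a + z)) has_derivative (\<lambda>v. L (a + z) v)) (at z)" by simp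
  qed (use L assms in auto)
qed

lemma Hol_continuous_on: "f \<in> Hol S \<Longrightarrow> continuous_on S f"
  unfolding Hol_def
  by (auto intro!: continuous_at_imp_continuous_on dest!: has_derivative_continuous)

lemma has_derivative_slice:
  fixes f :: "complex ^ 'd \<Rightarrow> complex"
  assumes "(f has_derivative L) (at (x + t *s v))" "\<And>c v. L (c *s v) = c * L v"
  shows "((\<lambda>t. f (x + t *s v)) has_field_derivative L v) (at t)"
proof -
  have "((\<lambda>t. x + t *s v) has_derivative (\<lambda>t. 0 + t *s v)) (at t)"
    by (intro has_derivative_add has_derivative_const bounded_linear_imp_has_derivative
        bounded_linear_vector_smult_left)
  from has_derivative_compose[OF this assms(1)]
  show ?thesis
    by (simp add: has_field_derivative_def assms(2) mult.commute[of _ "L v"])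
qed

lemma Hol_slice:
  assumes "f \<in> Hol S" "\<And>t. t \<in> T \<Longrightarrow> x + t *s v \<in> S"
  shows "(\<lambda>t. f (x + t *s v)) holomorphic_on T"
  unfolding holomorphic_on_def field_differentiable_def
  using assms HolE[OF assms(1)] by (metis has_derivative_slice has_field_derivative_at_within)

text \<open>
  The Weierstrass convergence theorem. On one-dimensional slices the limit is holomorphic and the
  Cauchy inequality bounds the directional derivatives of \<open>f n - g\<close> by \<open>sup |f n - g|\<close>, uniformly in
  the base point and the direction; hence the derivatives converge uniformly and the limit is
  Frechet differentiable.
\<close>

lemma Hol_uniform_limit:
  assumes f: "\<And>n. f n \<in> Hol S"
    and lim: "\<And>z. z \<in> S \<Longrightarrow> \<exists>\<rho>>0. cball z \<rho> \<subseteq> S \<and> uniform_limit (cball z \<rho>) f g sequentially"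
  shows "g \<in> Hol S"
proof -
  have "\<exists>L. (g has_derivative L) (at z) \<and> (\<forall>c v. L (c *s v) = c * L v)" if z: "z \<in> S" for z
  proof -
    obtain r where r: "r > 0" "cball z r \<subseteq> S" "uniform_limit (cball z r) f g sequentially"
      using lim[OF z] by blast
    define \<rho> where "\<rho> = r / 2"
    have \<rho>: "\<rho> > 0" "2 * \<rho> = r" using r by (auto simp: \<rho>_def)
    have "\<forall>n. \<exists>L. \<forall>z\<in>S. (f n has_derivative L z) (at z) \<and> (\<forall>c v. L z (c *s v) = c * L z v)"
      using f HolE by metis
    then obtain L where L: "\<And>n z. z \<in> S \<Longrightarrow> (f n has_derivative L n z) (at z)"
       "\<And>n z c v. z \<in> S \<Longrightarrow> L n z (c *s v) = c * L n z v" by metis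
    define G where "G x v = deriv (\<lambda>t. g (x + t *s v)) 0" for x v
    have inS: "x + t *s v \<in> cball z r" if "x \<in> ball z \<rho>" "cmod t * norm v \<le> \<rho>" for x t v
    proof -
      have "dist z (x + t *s v) \<le> dist z x + norm (t *s v)"
        using dist_triangle[of z "x + t *s v" x] by (simp add: dist_norm)
      then show ?thesis using that \<rho>(2) by (simp add: norm_vector_smult_complex)
    qed
    have bound: "cmod (L n x v - G x v) \<le> e / \<rho> * norm v"
      if n: "\<And>y. y \<in> cball z r \<Longrightarrow> dist (f n y) (g y) \<le> e" and x: "x \<in> ball z \<rho>" for n e x v
    proof (cases "v = 0")
      case True
      have "L n x 0 = 0"
        using L(2)[of x n 0 0] x r(2) \<rho> by (auto simp: subset_iff)
      then show ?thesis using True by (simp add: G_def)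
    next
      case False
      define s where "s = \<rho> / norm v"
      have s: "s > 0" using False \<rho> by (simp add: s_def)
      have ts: "cmod t * norm v \<le> \<rho>" if "cmod t \<le> s" for t
        using that False by (simp add: s_def pos_le_divide_eq)
      have ul: "uniform_limit (cball 0 s) (\<lambda>n t. f n (x + t *s v)) (\<lambda>t. g (x + t *s v)) sequentially"
        by (rule uniform_limit_compose'[OF r(3)]) (use inS x ts in auto)
      have hf: "(\<lambda>t. f n (x + t *s v)) holomorphic_on cball 0 s" for n
        by (rule Hol_slice[OF f]) (use inS x ts r(2) in auto)
      have "\<forall>\<^sub>F n in sequentially. continuous_on (cball 0 s) (\<lambda>t. f n (x + t *s v)) \<and>
          (\<lambda>t. f n (x + t *s v)) holomorphic_on ball 0 s"
        by (auto intro!: always_eventually holomorphic_on_imp_continuous_on hf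
                 intro: holomorphic_on_subset[OF hf])
      from holomorphic_uniform_limit[OF this ul]
      have cg: "continuous_on (cball 0 s) (\<lambda>t. g (x + t *s v))"
        and hg: "(\<lambda>t. g (x + t *s v)) holomorphic_on ball 0 s" by auto
      have der_f: "((\<lambda>t. f n (x + t *s v)) has_field_derivative L n x v) (at 0)"
        by (rule has_derivative_slice) (use L[of x n] x r(2) \<rho> in \<open>auto simp: subset_iff\<close>)
      have "((\<lambda>t. g (x + t *s v)) has_field_derivative G x v) (at 0)"
        unfolding G_def using hg s by (intro holomorphic_derivI[of _ "ball 0 s"]) auto
      from DERIV_imp_deriv[OF DERIV_diff[OF der_f this]]
      have "L n x v - G x v = (deriv ^^ 1) (\<lambda>t. f n (x + t *s v) - g (x + t *s v)) 0" by simp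
      also have "cmod \<dots> \<le> fact 1 * e / s ^ 1"
      proof (rule Cauchy_inequality)
        show "(\<lambda>t. f n (x + t *s v) - g (x + t *s v)) holomorphic_on ball 0 s"
          using hg hf by (intro holomorphic_intros) (auto intro: holomorphic_on_subset[OF hf])
        show "continuous_on (cball 0 s) (\<lambda>t. f n (x + t *s v) - g (x + t *s v))"
          using cg hf by (intro continuous_intros) (auto intro: holomorphic_on_imp_continuous_on)
        show "cmod (f n (x + t *s v) - g (x + t *s v)) \<le> e" if "cmod (0 - t) = s" for t
          using n[OF inS[OF x ts]] that by (simp add: dist_norm)
      qed fact
      finally show ?thesis by (simp add: s_def mult.commute)
    qed
    have "\<exists>g'. \<forall>x\<in>ball z \<rho>. (\<lambda>n. f n x) \<longlonglongrightarrow> g' x \<and> (g' has_derivative G x) (at x within ball z \<rho>)"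
    proof (rule has_derivative_sequence)
      show "convex (ball z \<rho>)" by simp
      show "(f n has_derivative L n x) (at x within ball z \<rho>)" if "x \<in> ball z \<rho>" for n x
        by (rule has_derivative_at_withinI, rule L) (use that r(2) \<rho> in \<open>auto simp: subset_iff\<close>)
      show "z \<in> ball z \<rho>" using \<rho> by simp
      show "(\<lambda>n. f n z) \<longlonglongrightarrow> g z"
        using tendsto_uniform_limitI[OF r(3)] r(1) by simp
      show "\<forall>\<^sub>F n in sequentially. \<forall>x\<in>ball z \<rho>. \<forall>h. norm (L n x h - G x h) \<le> e * norm h" if "e > 0" for e
      proof -
        have "\<forall>\<^sub>F n in sequentially. \<forall>y\<in>cball z r. dist (f n y) (g y) < e * \<rho>"
          using r(3) that \<rho> unfolding uniform_limit_iff by simp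
        then show ?thesis
        proof eventually_elim
          case (elim n)
          then show ?case using bound[of n "e * \<rho>"] \<rho> by force
        qed
      qed
    qed
    then obtain g' where g': "\<And>x. x \<in> ball z \<rho> \<Longrightarrow> (\<lambda>n. f n x) \<longlonglongrightarrow> g' x"
       "\<And>x. x \<in> ball z \<rho> \<Longrightarrow> (g' has_derivative G x) (at x within ball z \<rho>)" by blast
    have gg': "g' x = g x" if "x \<in> ball z \<rho>" for x
      using that \<rho> r(1) by (intro LIMSEQ_unique[OF g'(1)[OF that]] tendsto_uniform_limitI[OF r(3)]) auto
    have "(g' has_derivative G z) (at z)"
      using g'(2)[of z] \<rho> by (simp add: at_within_open[of z "ball z \<rho>"])
    then have "(g has_derivative G z) (at z)"
      by (rule has_derivative_transform_within_open[of _ _ _ _ "ball z \<rho>"]) (use gg' \<rho> in auto)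
    moreover have "G z (c *s v) = c * G z v" for c v
    proof -
      have conv: "(\<lambda>n. L n z w) \<longlonglongrightarrow> G z w" for w
      proof (rule tendstoI)
        fix e :: real assume e: "e > 0"
        have "0 < e * \<rho> / (norm w + 1)" using e \<rho> by (simp add: add_nonneg_pos)
        then have "\<forall>\<^sub>F n in sequentially. \<forall>y\<in>cball z r. dist (f n y) (g y) < e * \<rho> / (norm w + 1)"
          using r(3) unfolding uniform_limit_iff by simp
        then show "\<forall>\<^sub>F n in sequentially. dist (L n z w) (G z w) < e"
        proof eventually_elim
          case (elim n)
          then have "cmod (L n z w - G z w) \<le> e * \<rho> / (norm w + 1) / \<rho> * norm w"
            using \<rho> by (intro bound) force+
          also have "\<dots> = e * (norm w / (norm w + 1))" using \<rho> by simp
          also have "\<dots> < e * 1"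
            using e by (intro mult_strict_left_mono) (auto simp: divide_less_eq_1 add_nonneg_pos)
          finally show ?case by (simp add: dist_norm)
        qed
      qed
      have "(\<lambda>n. L n z (c *s v)) \<longlonglongrightarrow> c * G z v"
        unfolding L(2)[OF z] by (intro tendsto_intros conv)
      then show ?thesis using conv LIMSEQ_unique by blast
    qed
    ultimately show ?thesis by blast
  qed
  then show ?thesis by (simp add: Hol_def)
qed

section \<open>Homogeneous components\<close>

text \<open>
  The component of degree \<open>n\<close> of the expansion into homogeneous polynomials, read off as the
  Taylor coefficient at \<open>0\<close> of the slice \<open>t \<mapsto> f (t z)\<close>.
\<close>

definition hcomp :: "nat \<Rightarrow> (complex ^ 'd \<Rightarrow> complex) \<Rightarrow> complex ^ 'd \<Rightarrow> complex" where
  "hcomp n f z = (deriv ^^ n) (\<lambda>t. f (t *s z)) 0 / fact n"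

lemma norm_vector_smult_less_1:
  fixes z :: "complex ^ 'd"
  assumes "norm t < 1 / (norm z + 1)" shows "norm t * norm z < 1"
proof -
  have "norm t * norm z \<le> norm t * (norm z + 1)" by (intro mult_left_mono) auto
  also have "\<dots> < 1" using assms by (simp add: less_divide_eq add_nonneg_pos split: if_splits)
  finally show ?thesis .
qed

lemma holomorphic_on_slice:
  assumes "f \<in> Hol (ball 0 1)" "\<And>t. t \<in> T \<Longrightarrow> cmod t * norm z < 1"
  shows "(\<lambda>t. f (t *s z)) holomorphic_on T"
  using Hol_slice[OF assms(1), of T 0 z] assms(2) by (simp add: norm_vector_smult_complex)

lemma slice_disc:
  fixes z :: "complex ^ 'd" and t :: complex
  assumes "cmod t * norm z < 1"
  obtains R where "cmod t < R" "\<And>u. cmod u < R \<Longrightarrow> cmod u * norm z < 1"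
proof (cases "z = 0")
  case True
  then show ?thesis using that[of "cmod t + 1"] by simp
next
  case False
  then show ?thesis using that[of "1 / norm z"] assms by (simp add: less_divide_eq)
qed

lemma hcomp_power_sums:
  assumes f: "f \<in> Hol (ball 0 1)" and t: "cmod t * norm z < 1"
  shows "(\<lambda>n. hcomp n f z * t ^ n) sums f (t *s z)"
proof -
  obtain R where R: "cmod t < R" "\<And>u. cmod u < R \<Longrightarrow> cmod u * norm z < 1"
    using slice_disc[OF t] by blast
  have "(\<lambda>t. f (t *s z)) holomorphic_on ball 0 R"
    by (rule holomorphic_on_slice[OF f]) (use R in auto)
  from holomorphic_power_series[OF this, of t] R(1) show ?thesis
    by (simp add: hcomp_def)
qed

lemma slice_has_fps_expansion:
  assumes f: "f \<in> Hol (ball 0 1)"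
  shows "(\<lambda>t. f (t *s z)) has_fps_expansion Abs_fps (\<lambda>n. hcomp n f z)"
proof (rule has_fps_expansionI)
  have "0 < 1 / (norm z + 1)" by (simp add: add_nonneg_pos)
  then have "\<forall>\<^sub>F t in nhds 0. t \<in> ball 0 (1 / (norm z + 1))"
    by (intro eventually_nhds_in_open) auto
  then show "\<forall>\<^sub>F u in nhds 0. (\<lambda>n. fps_nth (Abs_fps (\<lambda>n. hcomp n f z)) n * u ^ n) sums f (u *s z)"
    by eventually_elim (use hcomp_power_sums[OF f] norm_vector_smult_less_1 in auto)
qed

lemma hcomp_eqI_fps:
  assumes "(\<lambda>t. f (t *s z)) has_fps_expansion F"
  shows "hcomp n f z = fps_nth F n"
  using fps_nth_fps_expansion[OF assms] by (simp add: hcomp_def)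

lemma hcomp_eqI:
  assumes "e > 0" "\<And>t. cmod t < e \<Longrightarrow> (\<lambda>n. c n * t ^ n) sums f (t *s z)"
  shows "hcomp n f z = c n"
proof -
  have "(\<lambda>t. f (t *s z)) has_fps_expansion Abs_fps c"
  proof (rule has_fps_expansionI)
    have "\<forall>\<^sub>F t in nhds 0. t \<in> ball 0 e" using assms(1) by (intro eventually_nhds_in_open) auto
    then show "\<forall>\<^sub>F u in nhds 0. (\<lambda>n. fps_nth (Abs_fps c) n * u ^ n) sums f (u *s z)"
      by eventually_elim (use assms(2) in auto)
  qed
  from hcomp_eqI_fps[OF this] show ?thesis by simp
qed

lemma hcomp_sums:
  assumes "f \<in> Hol (ball 0 1)" "norm z < 1"
  shows "(\<lambda>n. hcomp n f z) sums f z"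
  using hcomp_power_sums[OF assms(1), of 1 z] assms(2) by simp

lemma hcomp_0 [simp]: "hcomp 0 f z = f 0"
  by (simp add: hcomp_def)

lemma hcomp_smult:
  assumes f: "f \<in> Hol (ball 0 1)"
  shows "hcomp n f (c *s z) = c ^ n * hcomp n f z"
proof (rule hcomp_eqI)
  show "0 < 1 / (norm (c *s z) + 1)" by (simp add: add_nonneg_pos)
  fix t assume "cmod t < 1 / (norm (c *s z) + 1)"
  then have "cmod t * norm (c *s z) < 1" by (rule norm_vector_smult_less_1)
  then have "cmod (t * c) * norm z < 1" by (simp add: norm_vector_smult_complex norm_mult mult_ac)
  from hcomp_power_sums[OF f this]
  show "(\<lambda>n. c ^ n * hcomp n f z * t ^ n) sums f (t *s (c *s z))"
    by (simp add: power_mult_distrib mult_ac)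
qed

lemma hcomp_add:
  assumes "f \<in> Hol (ball 0 1)" "g \<in> Hol (ball 0 1)"
  shows "hcomp n (\<lambda>z. f z + g z) z = hcomp n f z + hcomp n g z"
  using hcomp_eqI_fps[OF has_fps_expansion_add[OF assms[THEN slice_has_fps_expansion]]] by simp

lemma hcomp_cmult:
  assumes "f \<in> Hol (ball 0 1)"
  shows "hcomp n (\<lambda>z. c * f z) z = c * hcomp n f z"
  using hcomp_eqI_fps[OF has_fps_expansion_cmult_left[OF slice_has_fps_expansion[OF assms]]] by simp

lemma hcomp_one: "hcomp n (\<lambda>z. 1) = (if n = 0 then (\<lambda>z. 1) else (\<lambda>z. 0))"
  by (auto simp: fun_eq_iff hcomp_def)

lemma hcomp_cong:
  assumes f: "f \<in> Hol (ball 0 1)" and eq: "\<And>z. z \<in> ball 0 1 \<Longrightarrow> f z = g z"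
  shows "hcomp n f = hcomp n g"
proof
  fix z
  show "hcomp n f z = hcomp n g z"
  proof (rule hcomp_eqI[symmetric])
    show "0 < 1 / (norm z + 1)" by (simp add: add_nonneg_pos)
    fix t assume "cmod t < 1 / (norm z + 1)"
    then have t: "cmod t * norm z < 1" by (rule norm_vector_smult_less_1)
    then have "f (t *s z) = g (t *s z)" by (intro eq) (simp add: norm_vector_smult_complex)
    then show "(\<lambda>n. hcomp n f z * t ^ n) sums g (t *s z)"
      using hcomp_power_sums[OF f t] by simp
  qed
qed

lemma hcomp_mult:
  assumes "f \<in> Hol (ball 0 1)" "g \<in> Hol (ball 0 1)"
  shows "hcomp n (\<lambda>z. f z * g z) z = (\<Sum>i\<le>n. hcomp i f z * hcomp (n - i) g z)"
  using hcomp_eqI_fps[OF has_fps_expansion_mult[OF assms[THEN slice_has_fps_expansion]]]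
  by (simp add: fps_mult_nth atLeast0AtMost)

lemma Hol_bounded_cball:
  assumes "f \<in> Hol (ball 0 1)" "s < 1"
  obtains M where "M > 0" "\<And>x. norm x \<le> s \<Longrightarrow> cmod (f x) \<le> M"
proof -
  have "continuous_on (cball 0 s) f"
    using assms by (intro continuous_on_subset[OF Hol_continuous_on[OF assms(1)]]) auto
  from compact_imp_bounded[OF compact_continuous_image[OF this compact_cball]]
  obtain M where "M > 0" "\<forall>x\<in>cball 0 s. cmod (f x) \<le> M"
    unfolding bounded_pos by auto
  then show ?thesis using that[of M] by simp
qed

lemma hcomp_bound:
  assumes f: "f \<in> Hol (ball 0 1)" and s: "0 < s" "s < 1"
    and M: "\<And>x. norm x \<le> s \<Longrightarrow> cmod (f x) \<le> M"
  shows "cmod (hcomp n f z) \<le> M * (norm z / s) ^ n"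
proof (cases "z = 0")
  case True
  have M0: "0 \<le> M" using M[of 0] s norm_ge_zero[of "f 0"] by (simp del: norm_ge_zero)
  have "cmod (hcomp n f z) = 0 ^ n * cmod (hcomp n f z)"
  proof -
    have "0 *s z = z" using True by simp
    then show ?thesis using hcomp_smult[OF f, of n 0 z] by (metis norm_mult norm_power norm_zero)
  qed
  also have "\<dots> \<le> M * (norm z / s) ^ n"
  proof (cases n)
    case 0
    then show ?thesis using M[of 0] s by simp
  next
    case (Suc k)
    then show ?thesis using M0 s by simp
  qed
  finally show ?thesis .
next
  case False
  then have nz: "norm z > 0" by simp
  have le: "cmod t * norm z \<le> s" if "cmod t \<le> s / norm z" for t
    using that nz by (simp add: le_divide_eq)
  have hol: "(\<lambda>t. f (t *s z)) holomorphic_on cball 0 (s / norm z)"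
    by (rule holomorphic_on_slice[OF f]) (use le s in force)
  have "cmod ((deriv ^^ n) (\<lambda>t. f (t *s z)) 0) \<le> fact n * M / (s / norm z) ^ n"
  proof (rule Cauchy_inequality)
    show "(\<lambda>t. f (t *s z)) holomorphic_on ball 0 (s / norm z)"
      using hol by (rule holomorphic_on_subset) auto
    show "continuous_on (cball 0 (s / norm z)) (\<lambda>t. f (t *s z))"
      using hol by (rule holomorphic_on_imp_continuous_on)
    show "cmod (f (t *s z)) \<le> M" if "cmod (0 - t) = s / norm z" for t
      using M[of "t *s z"] le[of t] that by (simp add: norm_vector_smult_complex)
  qed (use s nz in auto)
  then show ?thesis using s nz
    by (simp add: hcomp_def norm_divide divide_simps power_divide mult_ac)
qed

text \<open>
  An entire function with this property is a homogeneous polynomial of degree \<open>n\<close>; holomorphy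
  and the scaling law are all that is used.
\<close>

definition homogeneous :: "nat \<Rightarrow> (complex ^ 'd \<Rightarrow> complex) set" where
  "homogeneous n = {p \<in> Hol UNIV. \<forall>c z. p (c *s z) = c ^ n * p z}"

lemma homogeneousD:
  assumes "p \<in> homogeneous n"
  shows "p \<in> Hol UNIV" "p (c *s z) = c ^ n * p z" "p \<in> Hol (ball 0 1)" "continuous_on A p"
  using assms Hol_subset[of p UNIV] continuous_on_subset[OF Hol_continuous_on[of p UNIV], of A]
  by (auto simp: homogeneous_def)

lemma homogeneous_add: "p \<in> homogeneous n \<Longrightarrow> q \<in> homogeneous n \<Longrightarrow> (\<lambda>z. p z + q z) \<in> homogeneous n"
  by (auto simp: homogeneous_def algebra_simps)

lemma homogeneous_zero: "(\<lambda>z. 0) \<in> homogeneous n"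
  by (auto simp: homogeneous_def)

lemma homogeneous_cmult: "p \<in> homogeneous n \<Longrightarrow> (\<lambda>z. c * p z) \<in> homogeneous n"
  by (auto simp: homogeneous_def)

lemma homogeneous_mult: "p \<in> homogeneous m \<Longrightarrow> q \<in> homogeneous n \<Longrightarrow> (\<lambda>z. p z * q z) \<in> homogeneous (m + n)"
  by (auto simp: homogeneous_def power_add)

lemma homogeneous_sum: "(\<And>i. i \<in> I \<Longrightarrow> p i \<in> homogeneous n) \<Longrightarrow> (\<lambda>z. \<Sum>i\<in>I. p i z) \<in> homogeneous n"
  by (auto simp: homogeneous_def sum_distrib_left)

text \<open>
  Holomorphy in \<open>z\<close> is obtained by peeling off one degree at a time: as \<open>t\<close> tends to \<open>0\<close>,
  \<open>(f (t z) - \<Sum>k<n. t^k f\<^sub>k z) / t^n\<close> tends to \<open>f\<^sub>n z\<close> uniformly on the unit ball, with an error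
  of order \<open>t\<close>. Homogeneity carries the result from the ball to the whole space.
\<close>

lemma hcomp_Hol_UNIV:
  fixes f :: "complex ^ 'd \<Rightarrow> complex"
  assumes f: "f \<in> Hol (ball 0 1)"
  shows "hcomp n f \<in> Hol UNIV"
proof (induction n rule: less_induct)
  case (less n)
  define t :: "nat \<Rightarrow> real" where "t m = 1 / (of_nat m + 4)" for m
  have t: "t m > 0" "t m \<le> 1/4" for m by (auto simp: t_def field_simps)
  define g where "g m z = (1 / of_real (t m) ^ n) * (f (of_real (t m) *s z) - (\<Sum>k<n. of_real (t m) ^ k * hcomp k f z))" for m z
  obtain M where M: "M > 0" "\<And>x. norm x \<le> 1/2 \<Longrightarrow> cmod (f x) \<le> M"
    using Hol_bounded_cball[OF f, of "1/2"] by auto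
  have gH: "g m \<in> Hol (ball 0 1)" for m
    unfolding g_def
  proof (intro Hol_cmult Hol_diff Hol_sum Hol_scale[OF f])
    fix z :: "complex ^ 'd" assume "z \<in> ball 0 1"
    then have "t m * norm z \<le> 1/4 * 1" using t[of m] by (intro mult_mono) auto
    then show "of_real (t m) *s z \<in> ball 0 1" using t[of m] by (simp add: norm_vector_smult_complex)
  qed (use less in \<open>auto intro: Hol_subset\<close>)
  have err: "cmod (g m z - hcomp n f z) \<le> 4 * M * 2 ^ n * t m" if z: "norm z < 1" for m z
  proof -
    let ?t = "complex_of_real (t m)"
    have "cmod ?t * norm z \<le> 1/4 * 1" using t[of m] z by (intro mult_mono) auto
    then have "(\<lambda>k. hcomp k f z * ?t ^ k) sums f (?t *s z)" by (intro hcomp_power_sums f) simp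
    from sums_split_initial_segment[OF this, of n]
    have "(\<lambda>k. hcomp (k + n) f z * ?t ^ (k + n)) sums (f (?t *s z) - (\<Sum>k<n. ?t ^ k * hcomp k f z))"
      by (simp add: mult.commute)
    from sums_mult[OF this, of "1 / ?t ^ n"]
    have "(\<lambda>k. hcomp (k + n) f z * ?t ^ k) sums g m z"
      using t[of m] by (simp add: g_def power_add mult_ac)
    from sums_split_initial_segment[OF this, of 1]
    have S: "(\<lambda>k. hcomp (k + 1 + n) f z * ?t ^ (k + 1)) sums (g m z - hcomp n f z)" by simp
    have le: "cmod (hcomp (k + 1 + n) f z * ?t ^ (k + 1)) \<le> 2 * M * 2 ^ n * t m * (1/2) ^ k" for k
    proof -
      have "cmod (hcomp (k + 1 + n) f z) \<le> M * (norm z / (1/2)) ^ (k + 1 + n)"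
        by (rule hcomp_bound[OF f]) (use M in auto)
      also have "\<dots> \<le> M * 2 ^ (k + 1 + n)"
        using M z by (intro mult_left_mono power_mono) auto
      finally have "cmod (hcomp (k + 1 + n) f z * ?t ^ (k + 1)) \<le> (M * 2 ^ (k + 1 + n)) * t m ^ (k + 1)"
        using t[of m] by (simp add: norm_mult norm_power mult_right_mono)
      also have "\<dots> = 2 * M * 2 ^ n * t m * (2 * t m) ^ k"
        by (simp add: power_add power_mult_distrib mult_ac)
      also have "\<dots> \<le> 2 * M * 2 ^ n * t m * (1/2) ^ k"
        using t[of m] M by (intro mult_left_mono power_mono) auto
      finally show ?thesis .
    qed
    have "cmod (\<Sum>k. hcomp (k + 1 + n) f z * ?t ^ (k + 1)) \<le> (\<Sum>k. 2 * M * 2 ^ n * t m * (1/2) ^ k)"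
      using le by (intro norm_suminf_le) (auto intro!: summable_mult summable_geometric)
    also have "\<dots> = 4 * M * 2 ^ n * t m"
      by (subst suminf_mult) (auto simp: suminf_geometric summable_geometric)
    finally show ?thesis using sums_unique[OF S] by simp
  qed
  have tlim: "(\<lambda>m. 4 * M * 2 ^ n * t m) \<longlonglongrightarrow> 0"
  proof -
    have "t \<longlonglongrightarrow> 0" unfolding t_def by real_asymp
    from tendsto_mult_left[OF this, of "4 * M * 2 ^ n"] show ?thesis by simp
  qed
  have ul: "uniform_limit (ball 0 1) g (hcomp n f) sequentially"
  proof (rule uniform_limitI)
    fix e :: real assume "e > 0"
    from order_tendstoD(2)[OF tlim this]
    show "\<forall>\<^sub>F m in sequentially. \<forall>x\<in>ball 0 1. dist (g m x) (hcomp n f x) < e"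
    proof eventually_elim
      case (elim m)
      then show ?case using order_le_less_trans[OF err[of _ m]] by (simp add: dist_norm)
    qed
  qed
  have ball: "hcomp n f \<in> Hol (ball 0 1)"
  proof (rule Hol_uniform_limit[OF gH])
    fix z :: "complex ^ 'd" assume "z \<in> ball 0 1"
    then obtain r where r: "r > 0" "cball z r \<subseteq> ball 0 1"
      using open_contains_cball_eq[OF open_ball] by metis
    show "\<exists>r>0. cball z r \<subseteq> ball 0 1 \<and> uniform_limit (cball z r) g (hcomp n f) sequentially"
      by (intro exI[of _ r] conjI r uniform_limit_on_subset[OF ul r(2)])
  qed
  have "hcomp n f \<in> Hol (ball 0 r)" if r: "r > 0" for r
  proof -
    let ?h = "\<lambda>z. of_real r ^ n * hcomp n f (of_real (1 / r) *s z)"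
    have in_ball: "of_real (1 / r) *s z \<in> ball 0 1" if "z \<in> ball 0 r" for z :: "complex ^ 'd"
    proof -
      have "norm (complex_of_real (1 / r) *s z) = norm z / r"
        using r unfolding norm_vector_smult_complex norm_of_real by simp
      then show ?thesis using that r by simp
    qed
    have "?h \<in> Hol (ball 0 r)"
      by (rule Hol_cmult[OF Hol_scale[OF ball in_ball]])
    moreover have "?h = hcomp n f"
      using r by (simp add: fun_eq_iff hcomp_smult[OF f] power_divide)
    ultimately show ?thesis by simp
  qed
  then have "hcomp n f \<in> Hol (ball 0 (norm z + 1))" for z :: "complex ^ 'd"
    by (simp add: add_nonneg_pos)
  then have "\<exists>L. (hcomp n f has_derivative L) (at z) \<and> (\<forall>c v. L (c *s v) = c * L v)" for z :: "complex ^ 'd"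
    using HolE[of "hcomp n f" "ball 0 (norm z + 1)"] by (metis less_add_one mem_ball_0)
  then show ?case by (simp add: Hol_def)
qed

lemma hcomp_homogeneous: "f \<in> Hol (ball 0 1) \<Longrightarrow> hcomp n f \<in> homogeneous n"
  by (simp add: homogeneous_def hcomp_Hol_UNIV hcomp_smult)

lemma Hol_series:
  fixes p :: "nat \<Rightarrow> complex ^ 'd \<Rightarrow> complex"
  assumes p: "\<And>n. p n \<in> Hol (ball 0 1)"
    and B: "\<And>s. 0 < s \<Longrightarrow> s < 1 \<Longrightarrow> \<exists>B. summable B \<and> (\<forall>n z. norm z \<le> s \<longrightarrow> cmod (p n z) \<le> B n)"
  shows "(\<lambda>z. \<Sum>n. p n z) \<in> Hol (ball 0 1)"
    and "norm z < 1 \<Longrightarrow> (\<lambda>n. p n z) sums (\<Sum>n. p n z)"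
proof -
  show "(\<lambda>z. \<Sum>n. p n z) \<in> Hol (ball 0 1)"
  proof (rule Hol_uniform_limit)
    show "(\<lambda>z. \<Sum>i<n. p i z) \<in> Hol (ball 0 1)" for n using p by auto
    fix z :: "complex ^ 'd" assume "z \<in> ball 0 1"
    then have z: "norm z < 1" by simp
    obtain r where r: "r > 0" "norm z + r < 1"
      using dense[OF z] by (metis add.commute add_diff_cancel_left' diff_add_cancel diff_gt_0_iff_gt)
    then have r': "0 < norm z + r" by (rule_tac add_nonneg_pos) simp_all
    obtain B where B: "summable B" "\<And>n x. norm x \<le> norm z + r \<Longrightarrow> cmod (p n x) \<le> B n"
      using assms(2)[OF r' r(2)] by blast
    have sub: "norm x \<le> norm z + r" if "x \<in> cball z r" for x
      using that norm_triangle_sub[of x z] by (simp add: dist_norm norm_minus_commute)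
    have "uniform_limit (cball z r) (\<lambda>n x. \<Sum>i<n. p i x) (\<lambda>x. \<Sum>n. p n x) sequentially"
      by (rule Weierstrass_m_test[OF _ B(1)]) (use B(2) sub in auto)
    moreover have "cball z r \<subseteq> ball 0 1" using sub r by force
    ultimately show "\<exists>r>0. cball z r \<subseteq> ball 0 1 \<and>
        uniform_limit (cball z r) (\<lambda>n x. \<Sum>i<n. p i x) (\<lambda>x. \<Sum>n. p n x) sequentially"
      using r by blast
  qed
  show "(\<lambda>n. p n z) sums (\<Sum>n. p n z)" if z: "norm z < 1"
  proof -
    obtain s where s: "norm z < s" "s < 1" using dense[OF z] by blast
    then have "0 < s" using norm_ge_zero[of z] by (rule_tac order_le_less_trans)
    then obtain B where B: "summable B" "\<And>n. cmod (p n z) \<le> B n"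
      using assms(2)[of s] s by (metis less_imp_le)
    then have "summable (\<lambda>n. p n z)" by (intro summable_comparison_test'[OF B(1)]) auto
    then show ?thesis by (rule summable_sums)
  qed
qed

lemma hcomp_series:
  assumes p: "\<And>n. p n \<in> homogeneous n"
    and sums: "\<And>z. norm z < 1 \<Longrightarrow> (\<lambda>n. p n z) sums f z"
  shows "hcomp n f z = p n z"
proof (rule hcomp_eqI)
  show "0 < 1 / (norm z + 1)" by (simp add: add_nonneg_pos)
  fix t assume "cmod t < 1 / (norm z + 1)"
  then have "norm (t *s z) < 1"
    using norm_vector_smult_less_1[of t z] by (simp add: norm_vector_smult_complex)
  from sums[OF this] show "(\<lambda>n. p n z * t ^ n) sums f (t *s z)"
    using homogeneousD(2)[OF p] by (simp add: mult.commute)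
qed

section \<open>The radial derivative\<close>

text \<open>
  By complex linearity, \<open>R f z\<close> is the derivative of \<open>f\<close> at \<open>z\<close> in the direction \<open>z\<close>. This makes
  \<open>R\<close> a derivation that acts on the slice \<open>g t = f (t z)\<close> as \<open>t g' t\<close>.
\<close>

lemma radial_deriv_eq:
  assumes "(f has_derivative L) (at z)" "\<And>c v. L (c *s v) = c * L v"
  shows "radial_deriv f z = L z"
proof -
  have lin: "linear L" using assms(1) by (simp add: has_derivative_linear)
  have pd: "partial_deriv j f z = L (axis j 1)" for j
  proof -
    define w where "w = (\<chi> i. if i = j then 0 else z $ i)"
    have eq: "(\<chi> i. if i = j then t else z $ i) = w + t *s axis j 1" for t
      by (simp add: w_def vec_eq_iff axis_def)
    have "z = w + (z $ j) *s axis j 1" unfolding eq[symmetric] by (simp add: vec_eq_iff)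
    then have "((\<lambda>t. f (w + t *s axis j 1)) has_field_derivative L (axis j 1)) (at (z $ j))"
      using assms by (intro has_derivative_slice) simp_all
    then show ?thesis by (simp add: partial_deriv_def eq DERIV_imp_deriv)
  qed
  have "radial_deriv f z = (\<Sum>j\<in>UNIV. L (z $ j *s axis j 1))"
    by (simp add: radial_deriv_def pd assms(2))
  also have "\<dots> = L (\<Sum>j\<in>UNIV. z $ j *s axis j 1)" by (simp add: linear_sum[OF lin])
  finally show ?thesis by (simp add: basis_expansion)
qed

lemma radial_deriv_hcomp:
  assumes f: "f \<in> Hol (ball 0 1)"
  shows "hcomp n (radial_deriv f) z = of_nat n * hcomp n f z"
    and "norm z < 1 \<Longrightarrow> (\<lambda>n. of_nat n * hcomp n f z) sums radial_deriv f z"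
proof -
  obtain L where L: "\<And>z. z \<in> ball 0 1 \<Longrightarrow> (f has_derivative L z) (at z)"
    "\<And>z c v. z \<in> ball 0 1 \<Longrightarrow> L z (c *s v) = c * L z v" using HolE[OF f] by metis
  let ?g = "\<lambda>t. f (t *s z)"
  let ?F = "fps_X * fps_deriv (Abs_fps (\<lambda>n. hcomp n f z))"
  have F: "fps_nth ?F n = of_nat n * hcomp n f z" for n by (cases n) auto
  have exp: "(\<lambda>t. t * deriv ?g t) has_fps_expansion ?F"
    by (intro fps_expansion_intros slice_has_fps_expansion f)
  have eq: "t * deriv ?g t = radial_deriv f (t *s z)" if "cmod t * norm z < 1" for t
  proof -
    have tz: "t *s z \<in> ball 0 1" using that by (simp add: norm_vector_smult_complex)
    then have "((\<lambda>t. f (0 + t *s z)) has_field_derivative L (t *s z) z) (at t)"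
      using L by (intro has_derivative_slice) simp_all
    then show ?thesis using tz L radial_deriv_eq[of f "L (t *s z)" "t *s z"]
      by (simp add: DERIV_imp_deriv)
  qed
  have "(\<lambda>t. radial_deriv f (t *s z)) has_fps_expansion ?F"
  proof (rule iffD1[OF has_fps_expansion_cong exp])
    have "0 < 1 / (norm z + 1)" by (simp add: add_nonneg_pos)
    then have "\<forall>\<^sub>F t in nhds 0. t \<in> ball 0 (1 / (norm z + 1))"
      by (intro eventually_nhds_in_open) auto
    then show "\<forall>\<^sub>F t in nhds 0. t * deriv ?g t = radial_deriv f (t *s z)"
      by eventually_elim (use eq norm_vector_smult_less_1 in auto)
  qed simp
  from hcomp_eqI_fps[OF this] show "hcomp n (radial_deriv f) z = of_nat n * hcomp n f z"
    by (simp only: F)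
  show "(\<lambda>n. of_nat n * hcomp n f z) sums radial_deriv f z" if "norm z < 1"
  proof -
    have "cmod 1 * norm z < 1" using that by simp
    then obtain R where R: "cmod 1 < R" "\<And>u. cmod u < R \<Longrightarrow> cmod u * norm z < 1"
      using slice_disc[of 1 z] by blast
    have "?g holomorphic_on ball 0 R" by (rule holomorphic_on_slice[OF f]) (use R in auto)
    then have "(\<lambda>t. t * deriv ?g t) holomorphic_on ball 0 R"
      by (intro holomorphic_intros holomorphic_deriv) auto
    from holomorphic_power_series[OF this, of 1] R(1)
    have "(\<lambda>n. fps_nth ?F n) sums (1 * deriv ?g 1)"
      using fps_nth_fps_expansion[OF exp] by simp
    then show ?thesis using eq[of 1] that by (simp only: F) simp
  qed
qed

lemma radial_deriv_Hol:
  assumes f: "f \<in> Hol (ball 0 1)"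
  shows "radial_deriv f \<in> Hol (ball 0 1)"
proof -
  have "(\<lambda>z. \<Sum>n. of_nat n * hcomp n f z) \<in> Hol (ball 0 1)"
  proof (rule Hol_series(1))
    show "(\<lambda>z. of_nat n * hcomp n f z) \<in> Hol (ball 0 1)" for n
      using homogeneousD(3)[OF hcomp_homogeneous[OF f]] by auto
    fix s :: real assume s: "0 < s" "s < 1"
    define s' where "s' = (s + 1) / 2"
    have s': "s < s'" "0 < s'" "s' < 1" using s by (auto simp: s'_def)
    obtain M where M: "M > 0" "\<And>x. norm x \<le> s' \<Longrightarrow> cmod (f x) \<le> M"
      using Hol_bounded_cball[OF f s'(3)] by blast
    have "cmod (of_nat n * hcomp n f z) \<le> M * (of_nat (Suc n) * (s / s') ^ n)" if "norm z \<le> s" for n z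
    proof -
      have "cmod (hcomp n f z) \<le> M * (norm z / s') ^ n" by (rule hcomp_bound[OF f]) (use s' M in auto)
      also have "\<dots> \<le> M * (s / s') ^ n" using M s' that by (intro mult_left_mono power_mono divide_right_mono) auto
      finally have "of_nat n * cmod (hcomp n f z) \<le> of_nat (Suc n) * (M * (s / s') ^ n)"
        by (intro mult_mono) auto
      then show ?thesis by (simp add: norm_mult mult_ac)
    qed
    moreover have "summable (\<lambda>n. M * (of_nat (Suc n) * (s / s') ^ n))"
      using geometric_deriv_sums[of "s / s'"] s s' by (intro summable_mult) (auto simp: sums_iff)
    ultimately show "\<exists>B. summable B \<and> (\<forall>n z. norm z \<le> s \<longrightarrow> cmod (of_nat n * hcomp n f z) \<le> B n)"
      by blast
  qed
  moreover have "(\<Sum>n. of_nat n * hcomp n f z) = radial_deriv f z" if "z \<in> ball 0 1" for z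
    using radial_deriv_hcomp(2)[OF f, of z] that by (simp add: sums_iff)
  ultimately show ?thesis by (rule iffD1[OF Hol_cong[OF open_ball], rotated])
qed

lemma radial_deriv_cong:
  assumes "open S" "z \<in> S" "\<And>x. x \<in> S \<Longrightarrow> f x = g x" "f \<in> Hol S"
  shows "radial_deriv f z = radial_deriv g z"
proof -
  obtain L where L: "(f has_derivative L) (at z)" "\<And>c v. L (c *s v) = c * L v"
    using assms(2,4) by (auto simp: Hol_def)
  have "(g has_derivative L) (at z)"
    by (rule has_derivative_transform_within_open[OF L(1) assms(1,2)]) (rule assms(3))
  from radial_deriv_eq[OF L] radial_deriv_eq[OF this L(2)] show ?thesis by simp
qed

lemma radial_deriv_mult:
  assumes "f \<in> Hol S" "g \<in> Hol S" "z \<in> S"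
  shows "radial_deriv (\<lambda>z. f z * g z) z = f z * radial_deriv g z + radial_deriv f z * g z"
proof -
  obtain L where L: "(f has_derivative L) (at z)" "\<And>c v. L (c *s v) = c * L v"
    using assms HolE[OF assms(1)] by metis
  obtain L' where L': "(g has_derivative L') (at z)" "\<And>c v. L' (c *s v) = c * L' v"
    using assms HolE[OF assms(2)] by metis
  show ?thesis
    by (subst radial_deriv_eq[OF has_derivative_mult[OF L(1) L'(1)]])
       (simp_all add: radial_deriv_eq[OF L] radial_deriv_eq[OF L'] L(2) L'(2) algebra_simps)
qed

lemma radial_deriv_const: "radial_deriv (\<lambda>z. c) z = 0"
  by (simp add: radial_deriv_def partial_deriv_def)

lemma radial_deriv_power:
  assumes "f \<in> Hol S" "z \<in> S"
  shows "radial_deriv (\<lambda>z. f z ^ n) z = of_nat n * f z ^ (n - 1) * radial_deriv f z"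
proof (induction n)
  case (Suc n)
  have "radial_deriv (\<lambda>z. f z * f z ^ n) z = f z * radial_deriv (\<lambda>z. f z ^ n) z + radial_deriv f z * f z ^ n"
    by (rule radial_deriv_mult[OF assms(1) Hol_power[OF assms(1)] assms(2)])
  then show ?case unfolding Suc by (cases n) (simp_all add: algebra_simps)
qed (simp add: radial_deriv_const)

lemma radial_deriv_funpow:
  assumes "f \<in> Hol (ball 0 1)"
  shows "(radial_deriv ^^ N) f \<in> Hol (ball 0 1)"
    and "hcomp n ((radial_deriv ^^ N) f) z = of_nat n ^ N * hcomp n f z"
  using assms
proof (induction N)
  case (Suc N)
  { case 1 then show ?case using Suc by (simp add: radial_deriv_Hol) }
  { case 2 then show ?case using Suc by (simp add: radial_deriv_hcomp) }
qed auto

section \<open>Orthogonality of the components and the norm of the weighted space\<close>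

text \<open>
  For \<open>n \<noteq> m\<close> the substitution \<open>x \<mapsto> c x\<close> multiplies the inner product of \<open>g n\<close> and \<open>g m\<close> by
  \<open>c^n cnj (c^m)\<close>, which is \<open>-1\<close> for a suitable unimodular \<open>c\<close>; so the inner product vanishes.
  The measure is kept arbitrary because the lemma serves both the sphere and balls.
\<close>

lemma nn_integral_orthogonal_series:
  fixes g :: "nat \<Rightarrow> complex ^ 'd \<Rightarrow> complex"
  assumes fin: "finite_measure \<nu>" and sets [measurable_cong]: "sets \<nu> = sets borel"
    and inv: "\<And>c. cmod c = 1 \<Longrightarrow> distr \<nu> borel (\<lambda>x. c *s x) = \<nu>"
    and meas [measurable]: "\<And>n. g n \<in> borel_measurable borel"
    and hom: "\<And>n c x. cmod c = 1 \<Longrightarrow> g n (c *s x) = c ^ n * g n x"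
    and bound: "AE x in \<nu>. \<forall>n. cmod (g n x) \<le> B n" and B: "summable B" "\<And>n. 0 \<le> B n"
  shows "(\<integral>\<^sup>+x. ennreal ((cmod (\<Sum>n. g n x))\<^sup>2) \<partial>\<nu>) = (\<Sum>n. \<integral>\<^sup>+x. ennreal ((cmod (g n x))\<^sup>2) \<partial>\<nu>)"
proof -
  interpret finite_measure \<nu> by fact
  have [measurable]: "(\<lambda>x. c *s x) \<in> borel_measurable (borel :: (complex ^ 'd) measure)" for c :: complex
    by (intro borel_measurable_continuous_onI continuous_intros)
  have [measurable]: "(\<lambda>x. cnj (g m x)) \<in> borel_measurable borel" for m
    by (rule measurable_compose[OF meas borel_measurable_continuous_onI]) (intro continuous_intros)
  have int: "integrable \<nu> (\<lambda>x. g n x * cnj (g m x))" for n m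
  proof (rule integrable_const_bound[where B="B n * B m"])
    show "AE x in \<nu>. norm (g n x * cnj (g m x)) \<le> B n * B m"
      using bound by eventually_elim (auto simp: norm_mult intro!: mult_mono B)
  qed measurable
  have orth: "(\<integral>x. g n x * cnj (g m x) \<partial>\<nu>) = 0" if "n \<noteq> m" for n m
  proof -
    \<comment> \<open>The phase for which \<open>c^(n-m) = -1\<close>.\<close>
    define a where "a = pi / (real n - real m)"
    define c where "c = cis a"
    have "real n * a - real m * a = pi"
      using that by (simp add: a_def left_diff_distrib[symmetric] diff_divide_distrib[symmetric])
    then have c: "c ^ n * cnj (c ^ m) = -1"
      unfolding c_def Complex.DeMoivre cis_cnj cis_mult by simp
    have "(\<integral>x. g n x * cnj (g m x) \<partial>\<nu>) = (\<integral>x. g n x * cnj (g m x) \<partial>distr \<nu> borel (\<lambda>x. c *s x))"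
      by (simp add: inv c_def)
    also have "\<dots> = (\<integral>x. g n (c *s x) * cnj (g m (c *s x)) \<partial>\<nu>)"
      by (rule integral_distr) measurable
    also have "\<dots> = (\<integral>x. - (g n x * cnj (g m x)) \<partial>\<nu>)"
    proof (intro Bochner_Integration.integral_cong refl)
      fix x
      have "g n (c *s x) * cnj (g m (c *s x)) = (c ^ n * cnj (c ^ m)) * (g n x * cnj (g m x))"
        using hom[of c] by (simp add: c_def mult_ac)
      then show "g n (c *s x) * cnj (g m (c *s x)) = - (g n x * cnj (g m x))" unfolding c by simp
    qed
    also have "\<dots> = - (\<integral>x. g n x * cnj (g m x) \<partial>\<nu>)" by simp
    finally show ?thesis by simp
  qed
  have sq: "(\<integral>x. complex_of_real ((cmod (h x))\<^sup>2) \<partial>\<nu>) = of_real (\<integral>x. (cmod (h x))\<^sup>2 \<partial>\<nu>)" for h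
    by (rule integral_complex_of_real)
  have int_sq: "integrable \<nu> (\<lambda>x. (cmod (g n x))\<^sup>2)" for n
    using int[of n n] unfolding complex_norm_square[symmetric] complex_of_real_integrable_eq .
  have partial: "(\<integral>x. (cmod (\<Sum>n<K. g n x))\<^sup>2 \<partial>\<nu>) = (\<Sum>n<K. \<integral>x. (cmod (g n x))\<^sup>2 \<partial>\<nu>)" for K
  proof -
    have "complex_of_real (\<integral>x. (cmod (\<Sum>n<K. g n x))\<^sup>2 \<partial>\<nu>) = (\<integral>x. (\<Sum>n<K. \<Sum>m<K. g n x * cnj (g m x)) \<partial>\<nu>)"
      unfolding sq[symmetric] complex_norm_square cnj_sum sum_product ..
    also have "\<dots> = (\<Sum>n<K. \<Sum>m<K. \<integral>x. g n x * cnj (g m x) \<partial>\<nu>)"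
      by (simp add: int)
    also have "\<dots> = (\<Sum>n<K. \<Sum>m<K. if m = n then \<integral>x. g n x * cnj (g n x) \<partial>\<nu> else 0)"
      by (intro sum.cong refl) (auto simp: orth)
    also have "\<dots> = of_real (\<Sum>n<K. \<integral>x. (cmod (g n x))\<^sup>2 \<partial>\<nu>)"
      unfolding of_real_sum sq[symmetric] complex_norm_square by simp
    finally show ?thesis by (simp only: of_real_eq_iff)
  qed
  have "(\<lambda>K. \<integral>x. (cmod (\<Sum>n<K. g n x))\<^sup>2 \<partial>\<nu>) \<longlonglongrightarrow> (\<integral>x. (cmod (\<Sum>n. g n x))\<^sup>2 \<partial>\<nu>)"
  proof (rule integral_dominated_convergence[where w="\<lambda>_. (suminf B)\<^sup>2"])
    show "AE x in \<nu>. (\<lambda>K. (cmod (\<Sum>n<K. g n x))\<^sup>2) \<longlonglongrightarrow> (cmod (\<Sum>n. g n x))\<^sup>2"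
      using bound
    proof eventually_elim
      case (elim x)
      then have "summable (\<lambda>n. g n x)" by (intro summable_comparison_test'[OF B(1)]) auto
      then show ?case by (intro tendsto_intros summable_LIMSEQ)
    qed
    show "AE x in \<nu>. norm ((cmod (\<Sum>n<K. g n x))\<^sup>2) \<le> (suminf B)\<^sup>2" for K
      using bound
    proof eventually_elim
      case (elim x)
      have "cmod (\<Sum>n<K. g n x) \<le> (\<Sum>n<K. B n)" using elim by (intro sum_norm_le) auto
      also have "\<dots> \<le> suminf B" using B by (intro sum_le_suminf) auto
      finally show ?case by (simp add: power_mono)
    qed
  qed (auto intro: integrable_const)
  then have sums: "(\<lambda>n. \<integral>x. (cmod (g n x))\<^sup>2 \<partial>\<nu>) sums (\<integral>x. (cmod (\<Sum>n. g n x))\<^sup>2 \<partial>\<nu>)"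
    unfolding sums_def partial .
  have "integrable \<nu> (\<lambda>x. (cmod (\<Sum>n. g n x))\<^sup>2)"
  proof (rule integrable_const_bound[where B="(suminf B)\<^sup>2"])
    show "AE x in \<nu>. norm ((cmod (\<Sum>n. g n x))\<^sup>2) \<le> (suminf B)\<^sup>2"
      using bound
    proof eventually_elim
      case (elim x)
      then have "cmod (\<Sum>n. g n x) \<le> suminf B" by (intro norm_suminf_le B) auto
      then show ?case by (simp add: power_mono)
    qed
  qed measurable
  then have "(\<integral>\<^sup>+x. ennreal ((cmod (\<Sum>n. g n x))\<^sup>2) \<partial>\<nu>) = ennreal (\<integral>x. (cmod (\<Sum>n. g n x))\<^sup>2 \<partial>\<nu>)"
    by (rule nn_integral_eq_integral) auto
  also have "\<dots> = (\<Sum>n. ennreal (\<integral>x. (cmod (g n x))\<^sup>2 \<partial>\<nu>))"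
    by (rule suminf_ennreal_eq[OF _ sums, symmetric]) auto
  also have "\<dots> = (\<Sum>n. \<integral>\<^sup>+x. ennreal ((cmod (g n x))\<^sup>2) \<partial>\<nu>)"
    by (intro suminf_cong nn_integral_eq_integral[symmetric] int_sq) auto
  finally show ?thesis .
qed

definition sphere_sq :: "(complex ^ 'd \<Rightarrow> complex) \<Rightarrow> ennreal" where
  "sphere_sq p = (\<integral>\<^sup>+w. ennreal ((cmod (p w))\<^sup>2) \<partial>sphere_measure)"

text \<open>
  The squared norm of \<open>r \<mapsto> r^n\<close> in \<open>L\<^sup>2(\<mu>)\<close>. An atom of \<open>\<mu>\<close> at \<open>1\<close> is included; it accounts for
  the boundary term of the norm.
\<close>

definition moment :: "real measure \<Rightarrow> nat \<Rightarrow> ennreal" where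
  "moment \<mu> n = (\<integral>\<^sup>+r. ennreal (r ^ (2 * n)) \<partial>\<mu>)"

lemma homogeneous_measurable [measurable_dest]:
  "p \<in> homogeneous n \<Longrightarrow> p \<in> borel_measurable borel"
  by (intro borel_measurable_continuous_onI homogeneousD(4))

lemma sphere_measure_phase_invariant:
  "cmod c = 1 \<Longrightarrow> distr sphere_measure borel (\<lambda>x :: complex ^ 'd. c *s x) = sphere_measure"
  by (rule sphere_measure_rotation_invariant[OF orthogonal_transformation_vector_smult])

lemma sphere_sq_cmult:
  assumes [measurable]: "p \<in> borel_measurable borel"
  shows "sphere_sq (\<lambda>z. c * p z) = ennreal ((cmod c)\<^sup>2) * sphere_sq p"
  by (simp add: sphere_sq_def norm_mult power_mult_distrib ennreal_mult nn_integral_cmult)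

lemma sphere_integral_eq:
  fixes f :: "complex ^ 'd \<Rightarrow> complex"
  assumes f: "f \<in> Hol (ball 0 1)" and r: "0 \<le> r" "r < 1"
  shows "(\<integral>\<^sup>+w. ennreal ((cmod (f (r *\<^sub>R w)))\<^sup>2) \<partial>sphere_measure)
    = (\<Sum>n. ennreal (r ^ (2 * n)) * sphere_sq (hcomp n f))"
proof -
  interpret prob_space "sphere_measure :: (complex ^ 'd) measure" by (rule prob_space_sphere_measure)
  define g where "g n w = complex_of_real r ^ n * hcomp n f w" for n w
  have hm [measurable]: "hcomp n f \<in> borel_measurable borel" for n
    using homogeneous_measurable[OF hcomp_homogeneous[OF f]] .
  define s where "s = (r + 1) / 2"
  have s: "r < s" "0 < s" "s < 1" using r by (auto simp: s_def)
  obtain M where M: "M > 0" "\<And>x. norm x \<le> s \<Longrightarrow> cmod (f x) \<le> M"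
    using Hol_bounded_cball[OF f s(3)] by blast
  have gs: "g n w = hcomp n f (r *\<^sub>R w)" for n w
    by (simp add: g_def scaleR_eq_vector_smult hcomp_smult[OF f])
  have "(\<integral>\<^sup>+w. ennreal ((cmod (f (r *\<^sub>R w)))\<^sup>2) \<partial>sphere_measure)
      = (\<integral>\<^sup>+w. ennreal ((cmod (\<Sum>n. g n w))\<^sup>2) \<partial>sphere_measure)"
  proof (rule nn_integral_cong_AE)
    show "AE w in sphere_measure. ennreal ((cmod (f (r *\<^sub>R w)))\<^sup>2) = ennreal ((cmod (\<Sum>n. g n w))\<^sup>2)"
      using AE_sphere_measure
    proof eventually_elim
      case (elim w)
      then have "(\<lambda>n. g n w) sums f (r *\<^sub>R w)"
        unfolding gs using r by (intro hcomp_sums f) simp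
      then show ?case by (simp add: sums_iff)
    qed
  qed
  also have "\<dots> = (\<Sum>n. \<integral>\<^sup>+w. ennreal ((cmod (g n w))\<^sup>2) \<partial>sphere_measure)"
  proof (rule nn_integral_orthogonal_series)
    show "finite_measure (sphere_measure :: (complex ^ 'd) measure)" by (rule finite_measure_axioms)
    show "g n (c *s x) = c ^ n * g n x" for n c x by (simp add: g_def hcomp_smult[OF f])
    show "AE w in sphere_measure. \<forall>n. cmod (g n w) \<le> M * (r / s) ^ n"
      using AE_sphere_measure
    proof eventually_elim
      case (elim w)
      have "cmod (hcomp n f (r *\<^sub>R w)) \<le> M * (norm (r *\<^sub>R w) / s) ^ n" for n
        by (rule hcomp_bound[OF f]) (use s M in auto)
      then show ?case using elim r by (simp add: gs)
    qed
    show "summable (\<lambda>n. M * (r / s) ^ n)" using r s by (intro summable_mult summable_geometric) auto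
  qed (use r s M in \<open>auto simp: g_def sphere_measure_phase_invariant\<close>)
  also have "\<dots> = (\<Sum>n. ennreal (r ^ (2 * n)) * sphere_sq (hcomp n f))"
  proof (intro suminf_cong)
    fix n
    have "(\<integral>\<^sup>+w. ennreal ((cmod (g n w))\<^sup>2) \<partial>sphere_measure) = sphere_sq (\<lambda>w. complex_of_real r ^ n * hcomp n f w)"
      by (simp add: g_def sphere_sq_def)
    also have "\<dots> = ennreal (r ^ (2 * n)) * sphere_sq (hcomp n f)"
      using r by (subst sphere_sq_cmult[OF hm]) (simp add: norm_power power_mult[symmetric] mult.commute)
    finally show "(\<integral>\<^sup>+w. ennreal ((cmod (g n w))\<^sup>2) \<partial>sphere_measure) = ennreal (r ^ (2 * n)) * sphere_sq (hcomp n f)" .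
  qed
  finally show ?thesis .
qed

lemma sphere_measure_set_integral:
  "(\<integral>\<^sup>+w\<in>sphere 0 1. h w \<partial>sphere_measure) = (\<integral>\<^sup>+w. h w \<partial>sphere_measure)"
  using AE_sphere_measure by (intro nn_integral_cong_AE) (auto elim!: eventually_mono)

lemma hardy_norm_sq_eq:
  fixes f :: "complex ^ 'd \<Rightarrow> complex"
  assumes f: "f \<in> Hol (ball 0 1)"
  shows "hardy_norm_sq f = (\<Sum>n. sphere_sq (hcomp n f))"
proof -
  let ?A = "\<lambda>n. sphere_sq (hcomp n f)"
  have "hardy_norm_sq f = (SUP r\<in>{0<..<1}. \<Sum>n. ennreal (r ^ (2 * n)) * ?A n)"
    unfolding hardy_norm_sq_def sphere_measure_set_integral
    by (intro SUP_cong refl sphere_integral_eq[OF f]) auto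
  also have "\<dots> = (\<Sum>n. ?A n)"
  proof (rule antisym)
    show "(SUP r\<in>{0<..<1}. \<Sum>n. ennreal (r ^ (2 * n)) * ?A n) \<le> (\<Sum>n. ?A n)"
    proof (intro SUP_least suminf_le summableI)
      fix r :: real and n assume "r \<in> {0<..<1}"
      then have "ennreal (r ^ (2 * n)) \<le> ennreal 1" by (intro ennreal_leI power_le_one) auto
      then have "ennreal (r ^ (2 * n)) * ?A n \<le> 1 * ?A n" by (intro mult_right_mono) auto
      then show "ennreal (r ^ (2 * n)) * ?A n \<le> ?A n" by simp
    qed
    define t :: "nat \<Rightarrow> real" where "t k = 1 - 1 / (real k + 2)" for k
    have t: "0 < t k" "t k < 1" "t k \<le> t (Suc k)" for k by (auto simp: t_def field_simps)
    have inc: "incseq (\<lambda>k. ennreal (t k ^ (2 * n)))" for n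
      using t by (intro incseq_SucI ennreal_leI power_mono) (auto intro: less_imp_le)
    have "t \<longlonglongrightarrow> 1" unfolding t_def by real_asymp
    from tendsto_power[OF this] have "(\<lambda>k. ennreal (t k ^ (2 * n))) \<longlonglongrightarrow> 1" for n
      using tendsto_ennrealI[of "\<lambda>k. t k ^ (2 * n)" "1 ^ (2 * n)"] by simp
    then have sup: "(SUP k. ennreal (t k ^ (2 * n))) = 1" for n
      using LIMSEQ_SUP[OF inc] LIMSEQ_unique by blast
    have "(\<Sum>n. ?A n) = (\<Sum>n. SUP k. ennreal (t k ^ (2 * n)) * ?A n)"
      by (simp add: SUP_mult_right_ennreal[symmetric] sup)
    also have "\<dots> = (SUP k. \<Sum>n. ennreal (t k ^ (2 * n)) * ?A n)"
      using inc by (intro ennreal_suminf_SUP_eq) (auto simp: incseq_def intro!: mult_right_mono)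
    also have "\<dots> \<le> (SUP r\<in>{0<..<1}. \<Sum>n. ennreal (r ^ (2 * n)) * ?A n)"
      using t by (intro SUP_least) (auto intro!: SUP_upper2[of "t _"])
    finally show "(\<Sum>n. ?A n) \<le> (SUP r\<in>{0<..<1}. \<Sum>n. ennreal (r ^ (2 * n)) * ?A n)" .
  qed
  finally show ?thesis .
qed

lemma admissibleD:
  assumes "admissible \<mu>"
  shows "finite_measure \<mu>" "space \<mu> = {0..1}" "sets \<mu> = sets (restrict_space borel {0..1})"
    "0 < r \<Longrightarrow> r < 1 \<Longrightarrow> emeasure \<mu> {r<..1} > 0" "(\<lambda>r. r) \<in> \<mu> \<rightarrow>\<^sub>M borel"
    "A \<in> sets borel \<Longrightarrow> A \<subseteq> {0..1} \<Longrightarrow> A \<in> sets \<mu>"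
proof -
  show *: "finite_measure \<mu>" "sets \<mu> = sets (restrict_space borel {0..1})"
    "0 < r \<Longrightarrow> r < 1 \<Longrightarrow> emeasure \<mu> {r<..1} > 0"
    using assms by (auto simp: admissible_def)
  show "space \<mu> = {0..1}" using sets_eq_imp_space_eq[OF *(2)] by (simp add: space_restrict_space)
  show "(\<lambda>r. r) \<in> \<mu> \<rightarrow>\<^sub>M borel"
    using measurable_cong_sets[OF *(2) refl, of "borel :: real measure"]
      measurable_restrict_space1[OF measurable_ident, of borel "{0..1::real}"] by (simp add: id_def)
  show "A \<in> sets borel \<Longrightarrow> A \<subseteq> {0..1} \<Longrightarrow> A \<in> sets \<mu>"
    unfolding *(2) by (auto simp: sets_restrict_space image_iff intro!: bexI[of _ A])
qed

lemma Hol_norm_sq_measurable: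
  fixes f :: "complex ^ 'd \<Rightarrow> complex"
  assumes "f \<in> Hol (ball 0 1)"
  shows "(\<lambda>z. ennreal ((cmod (f z))\<^sup>2) * indicator (ball 0 1) z) \<in> borel_measurable borel"
proof -
  have [measurable]: "(\<lambda>z. indicator (ball 0 1) z *\<^sub>R f z) \<in> borel_measurable borel"
    by (rule borel_measurable_continuous_on_indicator[OF _ Hol_continuous_on[OF assms]]) simp
  have "(\<lambda>z. ennreal ((cmod (f z))\<^sup>2) * indicator (ball 0 1) z)
      = (\<lambda>z. ennreal ((cmod (indicator (ball 0 1) z *\<^sub>R f z))\<^sup>2))"
    by (auto simp: indicator_def)
  also have "\<dots> \<in> borel_measurable borel" by measurable
  finally show ?thesis .
qed

text \<open>
  Integration over the open ball yields the moments of \<open>\<mu>\<close> on \<open>{0..<1}\<close>, the Hardy norm those of the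
  atom at \<open>1\<close>; together they are the moments of \<open>\<mu>\<close>.
\<close>

lemma L2_norm_sq_eq:
  fixes f :: "complex ^ 'd \<Rightarrow> complex"
  assumes \<mu>: "admissible \<mu>" and f: "f \<in> Hol (ball 0 1)"
  shows "L2_norm_sq \<mu> f = (\<Sum>n. moment \<mu> n * sphere_sq (hcomp n f))"
proof -
  interpret S: prob_space "sphere_measure :: (complex ^ 'd) measure" by (rule prob_space_sphere_measure)
  note [measurable] = admissibleD(5)[OF \<mu>]
  have [measurable]: "{0..<1} \<in> sets \<mu>" "{1} \<in> sets \<mu>"
    by (intro admissibleD(6)[OF \<mu>]; force)+
  let ?A = "\<lambda>n. sphere_sq (hcomp n f)"
  define F where "F z = ennreal ((cmod (f z))\<^sup>2) * indicator (ball 0 1) z" for z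
  have Fm [measurable]: "F \<in> borel_measurable borel"
    unfolding F_def by (rule Hol_norm_sq_measurable[OF f])
  define a where "a n = (\<integral>\<^sup>+r. ennreal (r ^ (2 * n)) * indicator {0..<1} r \<partial>\<mu>)" for n
  have inner: "(\<integral>\<^sup>+w. F (r *\<^sub>R w) \<partial>sphere_measure) = (\<Sum>n. ennreal (r ^ (2 * n)) * indicator {0..<1} r * ?A n)"
    if "r \<in> space \<mu>" for r
  proof -
    have r: "0 \<le> r" "r \<le> 1" using that admissibleD(2)[OF \<mu>] by auto
    have "(\<integral>\<^sup>+w. F (r *\<^sub>R w) \<partial>sphere_measure)
      = (\<integral>\<^sup>+w. ennreal ((cmod (f (r *\<^sub>R w)))\<^sup>2) * indicator {0..<1} r \<partial>sphere_measure)"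
      using AE_sphere_measure
      by (intro nn_integral_cong_AE) (use r in \<open>auto elim!: eventually_mono simp: F_def indicator_def\<close>)
    also have "\<dots> = (\<Sum>n. ennreal (r ^ (2 * n)) * indicator {0..<1} r * ?A n)"
      using r by (cases "r = 1") (auto simp: sphere_integral_eq[OF f])
    finally show ?thesis .
  qed
  have "(\<integral>\<^sup>+z\<in>ball 0 1. ennreal ((cmod (f z))\<^sup>2) \<partial>radial_measure \<mu>) = (\<integral>\<^sup>+z. F z \<partial>radial_measure \<mu>)"
    by (simp add: F_def)
  also have "\<dots> = (\<integral>\<^sup>+x. F (case x of (r, w) \<Rightarrow> r *\<^sub>R w) \<partial>(\<mu> \<Otimes>\<^sub>M sphere_measure))"
    unfolding radial_measure_def
    by (rule nn_integral_distr[OF measurable_radial_product[OF \<mu>]]) simp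
  also have "\<dots> = (\<integral>\<^sup>+r. \<integral>\<^sup>+w. F (r *\<^sub>R w) \<partial>sphere_measure \<partial>\<mu>)"
    by (subst S.nn_integral_fst[symmetric]) simp_all
  also have "\<dots> = (\<integral>\<^sup>+r. (\<Sum>n. ennreal (r ^ (2 * n)) * indicator {0..<1} r * ?A n) \<partial>\<mu>)"
    by (intro nn_integral_cong inner)
  also have "\<dots> = (\<Sum>n. a n * ?A n)"
    by (subst nn_integral_suminf) (simp_all add: nn_integral_multc a_def)
  finally have 1: "(\<integral>\<^sup>+z\<in>ball 0 1. ennreal ((cmod (f z))\<^sup>2) \<partial>radial_measure \<mu>) = (\<Sum>n. a n * ?A n)" .
  have m: "moment \<mu> n = a n + emeasure \<mu> {1}" for n
  proof -
    have "moment \<mu> n = (\<integral>\<^sup>+r. ennreal (r ^ (2 * n)) * indicator {0..<1} r + indicator {1} r \<partial>\<mu>)"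
      unfolding moment_def
      by (intro nn_integral_cong) (auto simp: admissibleD(2)[OF \<mu>] indicator_def)
    then show ?thesis by (simp add: nn_integral_add a_def)
  qed
  show ?thesis
    unfolding L2_norm_sq_def 1 hardy_norm_sq_eq[OF f] m
    by (simp add: distrib_right suminf_add[symmetric])
qed

lemma moment_finite:
  assumes "admissible \<mu>" shows "moment \<mu> n < \<infinity>"
proof -
  interpret finite_measure \<mu> using admissibleD[OF assms] by simp
  have "moment \<mu> n \<le> (\<integral>\<^sup>+r. 1 \<partial>\<mu>)"
    unfolding moment_def
  proof (rule nn_integral_mono)
    fix r assume "r \<in> space \<mu>"
    then have "r ^ (2 * n) \<le> 1" using admissibleD(2)[OF assms] by (intro power_le_one) auto
    then show "ennreal (r ^ (2 * n)) \<le> 1" using ennreal_leI[of _ 1] by simp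
  qed
  also have "\<dots> < \<infinity>" by (simp add: less_top[symmetric])
  finally show ?thesis .
qed

lemma moment_lower_bound:
  assumes \<mu>: "admissible \<mu>" and s: "0 < s" "s < 1"
  shows "ennreal (s ^ (2 * n)) * emeasure \<mu> {s<..1} \<le> moment \<mu> n"
proof -
  have "{s<..1} \<in> sets \<mu>" using s by (intro admissibleD(6)[OF \<mu>]) auto
  then have "ennreal (s ^ (2 * n)) * emeasure \<mu> {s<..1} = (\<integral>\<^sup>+r. ennreal (s ^ (2 * n)) * indicator {s<..1} r \<partial>\<mu>)"
    by (simp add: nn_integral_cmult_indicator)
  also have "\<dots> \<le> moment \<mu> n"
    unfolding moment_def using s
    by (intro nn_integral_mono) (auto simp: indicator_def intro!: ennreal_leI power_mono)
  finally show ?thesis .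
qed

lemma moment_pos:
  assumes "admissible \<mu>" shows "moment \<mu> n > 0"
proof -
  have "0 < ennreal ((1/2) ^ (2 * n)) * emeasure \<mu> {1/2<..1}"
    using admissibleD(4)[OF assms, of "1/2"] by (simp add: ennreal_zero_less_mult_iff)
  also have "\<dots> \<le> moment \<mu> n" by (rule moment_lower_bound[OF assms]) auto
  finally show ?thesis .
qed

lemma moment_antimono:
  assumes "admissible \<mu>" "m \<le> n" shows "moment \<mu> n \<le> moment \<mu> m"
  unfolding moment_def using assms admissibleD(2)[OF assms(1)]
  by (intro nn_integral_mono ennreal_leI power_decreasing) auto

section \<open>Growth of homogeneous polynomials\<close>

lemma lborel_translation_invariant_integral:
  fixes c :: "'a :: euclidean_space"
  assumes [measurable]: "h \<in> borel_measurable borel"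
  shows "(\<integral>\<^sup>+x. h (c + x) \<partial>lborel) = (\<integral>\<^sup>+x. h x \<partial>lborel)"
proof -
  have "(\<integral>\<^sup>+x. h x \<partial>lborel) = (\<integral>\<^sup>+x. h x \<partial>distr lborel borel ((+) c))"
    by (simp add: lborel_distr_plus)
  also have "\<dots> = (\<integral>\<^sup>+x. h (c + x) \<partial>lborel)" by (rule nn_integral_distr) auto
  finally show ?thesis ..
qed

lemma uniform_ball_phase_invariant:
  fixes c :: complex and r :: real
  assumes c: "cmod c = 1"
  defines "\<nu> \<equiv> uniform_measure lborel (ball (0 :: complex ^ 'd) r)"
  shows "distr \<nu> borel (\<lambda>x. c *s x) = \<nu>"
proof (rule measure_eqI)
  have [measurable]: "(\<lambda>x. c *s x) \<in> borel_measurable (borel :: (complex ^ 'd) measure)"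
    by (intro borel_measurable_continuous_onI continuous_intros)
  fix A assume "A \<in> sets (distr \<nu> borel (\<lambda>x. c *s x))"
  then have [measurable]: "A \<in> sets borel" by simp
  have "emeasure lborel (ball 0 r \<inter> (\<lambda>x. c *s x) -` A) = emeasure (distr lborel borel (\<lambda>x. c *s x)) (ball 0 r \<inter> A)"
    by (subst emeasure_distr) (auto intro!: arg_cong2[where f=emeasure] simp: c norm_vector_smult_complex)
  then show "emeasure (distr \<nu> borel (\<lambda>x. c *s x)) A = emeasure \<nu> A"
    using measurable_sets[of "\<lambda>x. c *s x" borel borel A]
    by (simp add: \<nu>_def emeasure_distr lborel_orthogonal_transformation[OF orthogonal_transformation_vector_smult[OF c]])
qed (simp add: \<nu>_def)

text \<open>
  The component of degree \<open>0\<close> of \<open>F\<close> is the constant \<open>F 0\<close>, and by orthogonality its share of the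
  integral is at most the whole.
\<close>

lemma mean_value_inequality:
  fixes F :: "complex ^ 'd \<Rightarrow> complex"
  assumes F: "F \<in> Hol (ball 0 1)" and r: "0 < r" "r < 1"
  shows "ennreal ((cmod (F 0))\<^sup>2) \<le> (\<integral>\<^sup>+x. ennreal ((cmod (F x))\<^sup>2) \<partial>uniform_measure lborel (ball 0 r))"
proof -
  define \<nu> where "\<nu> = uniform_measure lborel (ball (0 :: complex ^ 'd) r)"
  have "emeasure lborel (ball (0 :: complex ^ 'd) r) \<noteq> 0"
    using r by (simp add: emeasure_ball less_imp_neq[OF unit_ball_vol_pos, symmetric])
  moreover have "emeasure lborel (ball (0 :: complex ^ 'd) r) \<noteq> \<infinity>"
    using emeasure_lborel_ball_finite[of "0 :: complex ^ 'd" r] by simp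
  ultimately interpret prob_space \<nu>
    unfolding \<nu>_def by (intro prob_space_uniform_measure)
  have inball: "AE x in \<nu>. norm x < r"
    unfolding \<nu>_def by (intro AE_uniform_measureI) auto
  define s where "s = (r + 1) / 2"
  have s: "r < s" "0 < s" "s < 1" using r by (auto simp: s_def)
  obtain M where M: "M > 0" "\<And>x. norm x \<le> s \<Longrightarrow> cmod (F x) \<le> M"
    using Hol_bounded_cball[OF F s(3)] by blast
  have "(\<integral>\<^sup>+x. ennreal ((cmod (F x))\<^sup>2) \<partial>\<nu>) = (\<integral>\<^sup>+x. ennreal ((cmod (\<Sum>n. hcomp n F x))\<^sup>2) \<partial>\<nu>)"
  proof (rule nn_integral_cong_AE)
    show "AE x in \<nu>. ennreal ((cmod (F x))\<^sup>2) = ennreal ((cmod (\<Sum>n. hcomp n F x))\<^sup>2)"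
      using inball
    proof eventually_elim
      case (elim x)
      then have "norm x < 1" using r by linarith
      from hcomp_sums[OF F this] show ?case by (simp add: sums_iff)
    qed
  qed
  also have "\<dots> = (\<Sum>n. \<integral>\<^sup>+x. ennreal ((cmod (hcomp n F x))\<^sup>2) \<partial>\<nu>)"
  proof (rule nn_integral_orthogonal_series)
    show "AE x in \<nu>. \<forall>n. cmod (hcomp n F x) \<le> M * (r / s) ^ n"
      using inball
    proof eventually_elim
      case (elim x)
      show ?case
      proof
        fix n
        have "cmod (hcomp n F x) \<le> M * (norm x / s) ^ n"
          by (rule hcomp_bound[OF F]) (use s M in auto)
        also have "\<dots> \<le> M * (r / s) ^ n"
          using M s elim by (intro mult_left_mono power_mono divide_right_mono) auto
        finally show "cmod (hcomp n F x) \<le> M * (r / s) ^ n" .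
      qed
    qed
    show "summable (\<lambda>n. M * (r / s) ^ n)" using r s by (intro summable_mult summable_geometric) auto
    show "distr \<nu> borel (\<lambda>x. c *s x) = \<nu>" if "cmod c = 1" for c
      unfolding \<nu>_def by (rule uniform_ball_phase_invariant[OF that])
    show "sets \<nu> = sets borel" by (simp add: \<nu>_def)
    show "hcomp n F \<in> borel_measurable borel" for n
      by (rule homogeneous_measurable[OF hcomp_homogeneous[OF F]])
  qed (use r s M in \<open>auto simp: hcomp_smult[OF F] finite_measure_axioms\<close>)
  also have "\<dots> \<ge> (\<Sum>n<1. \<integral>\<^sup>+x. ennreal ((cmod (hcomp n F x))\<^sup>2) \<partial>\<nu>)"
    by (rule sum_le_suminf) auto
  finally show ?thesis by (simp add: \<nu>_def[symmetric] emeasure_space_1)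
qed

text \<open>
  The constant depends on \<open>r\<close> only, not on the degree; this is what makes series of homogeneous
  polynomials converge in the whole ball. The value at \<open>z\<close> is controlled by the mean over a ball
  around \<open>z\<close> inside the unit ball, and in the unit ball \<open>|p x|\<close> is at most \<open>|p (sgn x)|\<close>, whose mean
  square is by definition the integral over the sphere.
\<close>

lemma homogeneous_sup_bound:
  fixes r :: real
  assumes r: "0 < r" "r < 1"
  obtains C :: ennreal where "C < \<infinity>"
    "\<And>n (p :: complex ^ 'd \<Rightarrow> complex) z. p \<in> homogeneous n \<Longrightarrow> norm z \<le> r \<Longrightarrow> ennreal ((cmod (p z))\<^sup>2) \<le> C * sphere_sq p"
proof
  let ?V = "\<lambda>r. emeasure lborel (ball (0 :: complex ^ 'd) r)"
  have pos: "?V t \<noteq> 0" and fin: "?V t \<noteq> \<infinity>" if "t > 0" for t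
    using that emeasure_lborel_ball_finite[of "0 :: complex ^ 'd" t]
    by (simp_all add: emeasure_ball less_imp_neq[OF unit_ball_vol_pos, symmetric])
  have VV: "?V 1 / ?V 1 = 1"
    using pos[of 1] fin[of 1] by (intro ennreal_divide_self) (simp_all add: less_top[symmetric])
  have V: "?V (1 - r) \<noteq> 0" "?V 1 \<noteq> \<infinity>" using pos[of "1 - r"] fin[of 1] r by simp_all
  then have "?V 1 / ?V (1 - r) \<noteq> \<infinity>" unfolding infinity_ennreal_def ennreal_divide_eq_top_iff by metis
  then show "?V 1 / ?V (1 - r) < \<infinity>" unfolding infinity_ennreal_def less_top .
  fix n and p :: "complex ^ 'd \<Rightarrow> complex" and z :: "complex ^ 'd"
  assume p: "p \<in> homogeneous n" and z: "norm z \<le> r"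
  have [measurable]: "p \<in> borel_measurable borel" by (rule homogeneous_measurable[OF p])
  have [measurable]: "ball 0 1 \<in> sets (borel :: (complex ^ 'd) measure)" by simp
  let ?f = "\<lambda>x. ennreal ((cmod (p x))\<^sup>2)"
  have "(\<lambda>x. p (z + x)) \<in> Hol (ball 0 1)"
    by (rule Hol_translate[OF homogeneousD(1)[OF p] UNIV_I])
  moreover have "0 < 1 - r" "1 - r < 1" using r by simp_all
  ultimately have "?f (z + 0) \<le> (\<integral>\<^sup>+x. ?f (z + x) \<partial>uniform_measure lborel (ball 0 (1 - r)))"
    by (rule mean_value_inequality)
  then have "?f z \<le> (\<integral>\<^sup>+x. ?f (z + x) \<partial>uniform_measure lborel (ball 0 (1 - r)))"
    unfolding add_0_right .
  also have "\<dots> = (\<integral>\<^sup>+x. ?f (z + x) * indicator (ball 0 (1 - r)) x \<partial>lborel) / ?V (1 - r)"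
    by (rule nn_integral_uniform_measure) simp_all
  also have "(\<integral>\<^sup>+x. ?f (z + x) * indicator (ball 0 (1 - r)) x \<partial>lborel)
      \<le> (\<integral>\<^sup>+x. ?f (z + x) * indicator (ball 0 1) (z + x) \<partial>lborel)"
  proof (intro nn_integral_mono mult_left_mono)
    fix x :: "complex ^ 'd"
    have "norm (z + x) < 1" if "norm x < 1 - r"
      using order_le_less_trans[OF norm_triangle_ineq add_le_less_mono[OF z that]] by simp
    then show "indicator (ball 0 (1 - r)) x \<le> (indicator (ball 0 1) (z + x) :: ennreal)"
      by (auto simp: indicator_def)
  qed simp
  also have "\<dots> = (\<integral>\<^sup>+x. ?f x * indicator (ball 0 1) x \<partial>lborel)"
    by (rule lborel_translation_invariant_integral) measurable
  also have "\<dots> \<le> (\<integral>\<^sup>+x. ?f (sgn x) * indicator (ball 0 1) x \<partial>lborel)"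
  proof (rule nn_integral_mono)
    fix x :: "complex ^ 'd"
    show "?f x * indicator (ball 0 1) x \<le> ?f (sgn x) * indicator (ball 0 1) x"
    proof (cases "norm x < 1")
      case True
      have "x = complex_of_real (norm x) *s sgn x"
        by (cases "x = 0") (simp_all add: scaleR_eq_vector_smult[symmetric] sgn_div_norm)
      then have "p x = complex_of_real (norm x) ^ n * p (sgn x)"
        using homogeneousD(2)[OF p] by metis
      then have "cmod (p x) = norm x ^ n * cmod (p (sgn x))"
        by (simp add: norm_mult norm_power)
      also have "\<dots> \<le> 1 * cmod (p (sgn x))"
        using True by (intro mult_right_mono power_le_one) auto
      finally show ?thesis using True by (auto intro!: ennreal_leI power_mono)
    qed simp
  qed
  also have "\<dots> = (\<integral>\<^sup>+x. ?f (sgn x) \<partial>uniform_measure lborel (ball 0 1)) * ?V 1"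
    by (subst nn_integral_uniform_measure)
       (simp_all add: ennreal_divide_times VV)
  also have "(\<integral>\<^sup>+x. ?f (sgn x) \<partial>uniform_measure lborel (ball 0 1)) = sphere_sq p"
    unfolding sphere_sq_def sphere_measure_def by (subst nn_integral_distr) simp_all
  finally have "?f z \<le> sphere_sq p * ?V 1 / ?V (1 - r)"
    by (auto simp: divide_right_mono_ennreal)
  then show "?f z \<le> ?V 1 / ?V (1 - r) * sphere_sq p"
    by (simp add: ennreal_times_divide mult.commute)
qed

section \<open>Besov spaces as spaces of graded sequences\<close>

text \<open>
  The factor is \<open>n+1\<close> and not \<open>n\<close>, the eigenvalue of \<open>R\<close>, so that no component has weight \<open>0\<close>.
\<close>

definition weight :: "nat \<Rightarrow> real measure \<Rightarrow> nat \<Rightarrow> ennreal" where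
  "weight N \<mu> n = ennreal (real (Suc n) ^ (2 * N)) * moment \<mu> n"

definition energy :: "nat \<Rightarrow> real measure \<Rightarrow> (nat \<Rightarrow> complex ^ 'd \<Rightarrow> complex) \<Rightarrow> ennreal" where
  "energy N \<mu> p = (\<Sum>n. weight N \<mu> n * sphere_sq (p n))"

definition graded :: "(nat \<Rightarrow> complex ^ 'd \<Rightarrow> complex) \<Rightarrow> bool" where
  "graded p \<longleftrightarrow> (\<forall>n. p n \<in> homogeneous n)"

lemma sphere_sq_finite:
  assumes "p \<in> homogeneous n" shows "sphere_sq (p :: complex ^ 'd \<Rightarrow> complex) < \<infinity>"
proof -
  interpret prob_space "sphere_measure :: (complex ^ 'd) measure" by (rule prob_space_sphere_measure)
  have "compact (p ` sphere 0 1)"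
    by (intro compact_continuous_image homogeneousD(4)[OF assms]) simp
  from compact_imp_bounded[OF this] obtain M where "\<forall>x\<in>p ` sphere 0 1. cmod x \<le> M"
    unfolding bounded_iff by (rule exE)
  then have M: "\<And>w. w \<in> sphere 0 1 \<Longrightarrow> cmod (p w) \<le> M" by simp
  have "sphere_sq p \<le> (\<integral>\<^sup>+w. ennreal (M\<^sup>2) \<partial>(sphere_measure :: (complex ^ 'd) measure))"
    unfolding sphere_sq_def using AE_sphere_measure
    by (intro nn_integral_mono_AE) (auto elim!: eventually_mono intro!: ennreal_leI power_mono M)
  also have "\<dots> < \<infinity>" using emeasure_space_1 by simp
  finally show ?thesis .
qed

lemma sphere_sq_zero [simp]: "sphere_sq (\<lambda>z. 0) = 0"
  by (simp add: sphere_sq_def)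

lemma weight_finite: "admissible \<mu> \<Longrightarrow> weight N \<mu> n < \<infinity>"
  using moment_finite[of \<mu> n] by (simp add: weight_def ennreal_mult_less_top)

lemma weight_pos: "admissible \<mu> \<Longrightarrow> weight N \<mu> n > 0"
  using moment_pos[of \<mu> n] by (simp add: weight_def ennreal_zero_less_mult_iff)

text \<open>
  The exact norm has the weights \<open>n^(2N) m\<^sub>n\<close>. For \<open>n \<ge> 1\<close> they are comparable to
  \<open>(n+1)^(2N) m\<^sub>n\<close>, and the component of degree \<open>0\<close> contributes a finite amount in any case.
\<close>

lemma Besov_iff_energy:
  assumes \<mu>: "admissible \<mu>"
  shows "f \<in> Besov N \<mu> \<longleftrightarrow> f \<in> Hol (ball 0 1) \<and> energy N \<mu> (\<lambda>n. hcomp n f) < \<infinity>"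
proof (cases "f \<in> Hol (ball 0 1)")
  case f: True
  let ?A = "\<lambda>n. sphere_sq (hcomp n f)"
  have eq: "L2_norm_sq \<mu> ((radial_deriv ^^ N) f) = (\<Sum>n. ennreal (real n ^ (2 * N)) * moment \<mu> n * ?A n)" (is "?L = ?R")
  proof -
    have "hcomp n ((radial_deriv ^^ N) f) = (\<lambda>z. of_nat n ^ N * hcomp n f z)" for n
      using radial_deriv_funpow(2)[OF f] by (intro ext)
    moreover have "sphere_sq (\<lambda>z. of_nat n ^ N * hcomp n f z) = ennreal (real n ^ (2 * N)) * ?A n" for n
      by (subst sphere_sq_cmult[OF homogeneous_measurable[OF hcomp_homogeneous[OF f]]])
         (simp add: norm_power power_mult[symmetric] mult.commute)
    ultimately show ?thesis
      by (simp add: L2_norm_sq_eq[OF \<mu> radial_deriv_funpow(1)[OF f]] mult_ac)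
  qed
  have "?R \<le> energy N \<mu> (\<lambda>n. hcomp n f)"
    unfolding energy_def weight_def
    by (intro suminf_le summableI mult_right_mono ennreal_leI power_mono) auto
  moreover have "energy N \<mu> (\<lambda>n. hcomp n f) \<le> (\<Sum>n. ennreal (4 ^ N) * (ennreal (real n ^ (2 * N)) * moment \<mu> n * ?A n)
      + (if n = 0 then moment \<mu> 0 * ?A 0 else 0))"
    unfolding energy_def
  proof (intro suminf_le summableI)
    fix n
    show "weight N \<mu> n * ?A n \<le> ennreal (4 ^ N) * (ennreal (real n ^ (2 * N)) * moment \<mu> n * ?A n)
      + (if n = 0 then moment \<mu> 0 * ?A 0 else 0)"
    proof (cases "n = 0")
      case True
      then show ?thesis by (simp add: weight_def)
    next
      case False
      then have "real (Suc n) \<le> 2 * real n" by simp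
      then have "real (Suc n) ^ (2 * N) \<le> (2 * real n) ^ (2 * N)" by (intro power_mono) auto
      also have "\<dots> = 4 ^ N * real n ^ (2 * N)" by (simp add: power_mult_distrib power_mult)
      finally have "ennreal (real (Suc n) ^ (2 * N)) \<le> ennreal (4 ^ N) * ennreal (real n ^ (2 * N))"
        by (simp add: ennreal_mult[symmetric] ennreal_leI)
      from mult_right_mono[OF this, of "moment \<mu> n * ?A n"] show ?thesis
        using False by (simp add: weight_def mult_ac)
    qed
  qed
  moreover have "\<dots> = ennreal (4 ^ N) * ?R + moment \<mu> 0 * ?A 0"
  proof -
    have "(\<Sum>n. if n = 0 then moment \<mu> 0 * ?A 0 else 0) = moment \<mu> 0 * ?A 0"
      using sums_single[of 0 "\<lambda>_. moment \<mu> 0 * ?A 0"] by (simp add: sums_iff)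
    then show ?thesis by (subst suminf_add[symmetric]) simp_all
  qed
  moreover have "moment \<mu> 0 * ?A 0 < \<infinity>"
    using moment_finite[OF \<mu>] sphere_sq_finite[OF hcomp_homogeneous[OF f]]
    by (simp add: ennreal_mult_less_top)
  ultimately have "?R < \<infinity> \<longleftrightarrow> energy N \<mu> (\<lambda>n. hcomp n f) < \<infinity>"
    by (auto simp: ennreal_mult_less_top elim: order_le_less_trans)
  then show ?thesis using f by (simp add: Besov_def eq)
qed (simp add: Besov_def)

text \<open>
  Admissibility enters here: mass of \<open>\<mu>\<close> close to \<open>1\<close> keeps the moments above \<open>c r^(2n)\<close> for
  every \<open>r < 1\<close>. Finite energy then makes the components grow more slowly than any \<open>r^(-n)\<close>, so
  their sum converges locally uniformly.
\<close>

lemma graded_sum_Besov: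
  fixes p :: "nat \<Rightarrow> complex ^ 'd \<Rightarrow> complex"
  assumes \<mu>: "admissible \<mu>" and p: "graded p" and fin: "energy N \<mu> p < \<infinity>"
  obtains f where "f \<in> Besov N \<mu>" "\<And>n. hcomp n f = p n"
proof -
  have ph: "p n \<in> homogeneous n" for n using p by (simp add: graded_def)
  have bnd: "\<exists>B. summable B \<and> (\<forall>n z. norm z \<le> s \<longrightarrow> cmod (p n z) \<le> B n)" if s: "0 < s" "s < 1" for s
  proof -
    \<comment> \<open>\<open>s/r\<^sup>2 < 1\<close> will be the ratio of the geometric majorant: one factor \<open>1/r\<close> comes from the bound on the ball of radius \<open>r\<close>, the other from the moments.\<close>
    define r where "r = sqrt ((1 + s) / 2)"
    have r: "0 < r" "r < 1" "s < r\<^sup>2" using s by (auto simp: r_def)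
    obtain C :: ennreal where C: "C < \<infinity>"
      "\<And>n (p :: complex ^ 'd \<Rightarrow> complex) z. p \<in> homogeneous n \<Longrightarrow> norm z \<le> r \<Longrightarrow> ennreal ((cmod (p z))\<^sup>2) \<le> C * sphere_sq p"
      using homogeneous_sup_bound[OF r(1,2)] by metis
    interpret finite_measure \<mu> using admissibleD[OF \<mu>] by simp
    define m where "m = measure \<mu> {r<..1}"
    have em: "emeasure \<mu> {r<..1} = ennreal m" by (simp add: m_def emeasure_eq_measure)
    have m: "m > 0" using admissibleD(4)[OF \<mu> r(1,2)] by (simp add: em)
    define K where "K = enn2real (C * energy N \<mu> p) / m"
    have K: "0 \<le> K" using m by (simp add: K_def)
    have "cmod (p n z) \<le> sqrt K * (s / r\<^sup>2) ^ n" if z: "norm z \<le> s" for n z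
    proof -
      have "ennreal (r ^ (2 * n)) * ennreal m \<le> weight N \<mu> n"
      proof -
        have "ennreal (r ^ (2 * n)) * ennreal m \<le> 1 * moment \<mu> n"
          using moment_lower_bound[OF \<mu> r(1,2)] by (simp add: em)
        also have "\<dots> \<le> weight N \<mu> n"
          unfolding weight_def using one_le_power[of "real (Suc n)" "2 * N"]
          by (intro mult_right_mono) (auto simp: ennreal_1[symmetric] intro!: ennreal_leI simp del: ennreal_1)
        finally show ?thesis .
      qed
      then have "(ennreal (r ^ (2 * n)) * ennreal m) * sphere_sq (p n) \<le> weight N \<mu> n * sphere_sq (p n)"
        by (rule mult_right_mono) simp
      also have "\<dots> = (\<Sum>k\<in>{n}. weight N \<mu> k * sphere_sq (p k))" by simp
      also have "\<dots> \<le> energy N \<mu> p" unfolding energy_def by (rule sum_le_suminf) auto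
      finally have A: "(ennreal (r ^ (2 * n)) * ennreal m) * sphere_sq (p n) \<le> energy N \<mu> p" .
      have "norm (complex_of_real (r / s) *s z) \<le> r"
      proof -
        have "norm (complex_of_real (r / s) *s z) = r / s * norm z"
          unfolding norm_vector_smult_complex norm_of_real using r s by simp
        also have "\<dots> \<le> r / s * s" using r s by (intro mult_left_mono z) simp
        finally show ?thesis using s by simp
      qed
      from C(2)[OF ph this]
      have "ennreal ((cmod (p n (complex_of_real (r / s) *s z)))\<^sup>2) \<le> C * sphere_sq (p n)" .
      then have "(ennreal (r ^ (2 * n)) * ennreal m) * ennreal ((cmod (p n (complex_of_real (r / s) *s z)))\<^sup>2)
          \<le> (ennreal (r ^ (2 * n)) * ennreal m) * (C * sphere_sq (p n))"
        by (rule mult_left_mono) simp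
      also have "\<dots> = C * ((ennreal (r ^ (2 * n)) * ennreal m) * sphere_sq (p n))" by (simp add: mult_ac)
      also have "\<dots> \<le> C * energy N \<mu> p" by (rule mult_left_mono[OF A]) simp
      finally have "ennreal (r ^ (2 * n) * m * (cmod (p n (complex_of_real (r / s) *s z)))\<^sup>2) \<le> C * energy N \<mu> p"
        using r m by (simp add: ennreal_mult)
      then have "r ^ (2 * n) * m * (cmod (p n (complex_of_real (r / s) *s z)))\<^sup>2 \<le> enn2real (C * energy N \<mu> p)"
        using C(1) fin r m enn2real_mono[of "ennreal (r ^ (2 * n) * m * (cmod (p n (complex_of_real (r / s) *s z)))\<^sup>2)"]
        by (simp add: ennreal_mult_less_top del: ennreal_mult)
      moreover have "cmod (p n (complex_of_real (r / s) *s z)) = (r / s) ^ n * cmod (p n z)"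
        using s r by (simp add: homogeneousD(2)[OF ph] norm_mult norm_power norm_divide)
      ultimately have "r ^ (2 * n) * ((r / s) ^ n * cmod (p n z))\<^sup>2 \<le> K"
        using m by (simp add: K_def field_simps)
      moreover have "r ^ (2 * n) * ((r / s) ^ n * cmod (p n z))\<^sup>2 = ((r\<^sup>2 / s) ^ n * cmod (p n z))\<^sup>2"
        by (simp add: power_mult_distrib power_divide power_mult power2_eq_square mult_ac)
      ultimately have "(r\<^sup>2 / s) ^ n * cmod (p n z) \<le> sqrt K" by (intro real_le_rsqrt) simp
      then show ?thesis using s r by (simp add: field_simps power_divide)
    qed
    moreover have "summable (\<lambda>n. sqrt K * (s / r\<^sup>2) ^ n)"
      using s r by (intro summable_mult summable_geometric) auto
    ultimately show ?thesis by blast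
  qed
  define f where "f z = (\<Sum>n. p n z)" for z
  have f: "f \<in> Hol (ball 0 1)" and sums: "\<And>z. norm z < 1 \<Longrightarrow> (\<lambda>n. p n z) sums f z"
    using Hol_series[OF homogeneousD(3)[OF ph] bnd] unfolding f_def by auto
  have "hcomp n f = p n" for n
    using hcomp_series[OF ph sums] by (intro ext)
  then show ?thesis using that[of f] f fin by (simp add: Besov_iff_energy[OF \<mu>])
qed
text \<open>
  Multiplication of functions on the level of components.
\<close>

definition conv :: "(nat \<Rightarrow> complex ^ 'd \<Rightarrow> complex) \<Rightarrow> (nat \<Rightarrow> complex ^ 'd \<Rightarrow> complex) \<Rightarrow> nat \<Rightarrow> complex ^ 'd \<Rightarrow> complex" where
  "conv \<Phi> p n = (\<lambda>z. \<Sum>i\<le>n. \<Phi> i z * p (n - i) z)"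

definition trunc :: "nat \<Rightarrow> (nat \<Rightarrow> complex ^ 'd \<Rightarrow> complex) \<Rightarrow> nat \<Rightarrow> complex ^ 'd \<Rightarrow> complex" where
  "trunc K p n = (if n < K then p n else (\<lambda>z. 0))"

definition single :: "nat \<Rightarrow> (complex ^ 'd \<Rightarrow> complex) \<Rightarrow> nat \<Rightarrow> complex ^ 'd \<Rightarrow> complex" where
  "single l q n = (if n = l then q else (\<lambda>z. 0))"

lemma graded_conv: "graded \<Phi> \<Longrightarrow> graded p \<Longrightarrow> graded (conv \<Phi> p)"
  unfolding graded_def conv_def
  by (intro allI homogeneous_sum) (metis homogeneous_mult atMost_iff le_add_diff_inverse)

lemma graded_trunc: "graded p \<Longrightarrow> graded (trunc K p)"
  by (simp add: graded_def trunc_def homogeneous_zero)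

lemma graded_single: "q \<in> homogeneous l \<Longrightarrow> graded (single l q)"
  by (simp add: graded_def single_def homogeneous_zero)

lemma graded_add: "graded p \<Longrightarrow> graded q \<Longrightarrow> graded (\<lambda>n z. p n z + q n z)"
  by (simp add: graded_def homogeneous_add)

lemma graded_cmult: "graded p \<Longrightarrow> graded (\<lambda>n z. c n * p n z)"
  by (simp add: graded_def homogeneous_cmult)

lemma graded_measurable: "graded p \<Longrightarrow> p n \<in> borel_measurable borel"
  by (auto simp: graded_def intro: homogeneous_measurable)

lemma conv_add: "conv \<Phi> (\<lambda>n z. p n z + q n z) = (\<lambda>n z. conv \<Phi> p n z + conv \<Phi> q n z)"
  by (simp add: fun_eq_iff conv_def distrib_left sum.distrib)

lemma conv_cmult: "conv \<Phi> (\<lambda>n z. c * p n z) = (\<lambda>n z. c * conv \<Phi> p n z)"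
  by (simp add: fun_eq_iff conv_def sum_distrib_left mult_ac)

lemma trunc_conv_cong:
  assumes "\<And>n. n < K \<Longrightarrow> p n = q n"
  shows "trunc K (conv \<Phi> p) = trunc K (conv \<Phi> q)"
  using assms by (auto simp: fun_eq_iff trunc_def conv_def intro!: sum.cong)

lemma trunc_add: "trunc K (\<lambda>n z. p n z + q n z) = (\<lambda>n z. trunc K p n z + trunc K q n z)"
  by (auto simp: trunc_def)

lemma sphere_sq_add_le:
  assumes [measurable]: "p \<in> borel_measurable borel" "q \<in> borel_measurable borel"
  shows "sphere_sq (\<lambda>z. p z + q z) \<le> 2 * sphere_sq p + 2 * sphere_sq q"
proof -
  have "ennreal ((cmod (p w + q w))\<^sup>2) \<le> 2 * ennreal ((cmod (p w))\<^sup>2) + 2 * ennreal ((cmod (q w))\<^sup>2)" for w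
  proof -
    have "(cmod (p w + q w))\<^sup>2 \<le> (cmod (p w) + cmod (q w))\<^sup>2"
      by (intro power_mono norm_triangle_ineq) auto
    also have "\<dots> \<le> 2 * (cmod (p w))\<^sup>2 + 2 * (cmod (q w))\<^sup>2"
      using sum_squares_bound[of "cmod (p w)" "cmod (q w)"] by (simp add: power2_sum)
    finally have "ennreal ((cmod (p w + q w))\<^sup>2) \<le> ennreal (2 * (cmod (p w))\<^sup>2 + 2 * (cmod (q w))\<^sup>2)"
      by (rule ennreal_leI)
    then show ?thesis by (simp add: ennreal_mult)
  qed
  then have "sphere_sq (\<lambda>z. p z + q z) \<le> (\<integral>\<^sup>+w. 2 * ennreal ((cmod (p w))\<^sup>2) + 2 * ennreal ((cmod (q w))\<^sup>2) \<partial>sphere_measure)"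
    unfolding sphere_sq_def by (intro nn_integral_mono)
  also have "\<dots> = 2 * sphere_sq p + 2 * sphere_sq q"
    by (simp add: sphere_sq_def nn_integral_add nn_integral_cmult)
  finally show ?thesis .
qed

lemma energy_add_le:
  assumes "graded p" "graded q"
  shows "energy N \<mu> (\<lambda>n z. p n z + q n z) \<le> 2 * energy N \<mu> p + 2 * energy N \<mu> q"
proof -
  have "energy N \<mu> (\<lambda>n z. p n z + q n z)
     \<le> (\<Sum>n. 2 * (weight N \<mu> n * sphere_sq (p n)) + 2 * (weight N \<mu> n * sphere_sq (q n)))"
    unfolding energy_def
  proof (intro suminf_le summableI)
    fix n
    have "weight N \<mu> n * sphere_sq (\<lambda>z. p n z + q n z) \<le> weight N \<mu> n * (2 * sphere_sq (p n) + 2 * sphere_sq (q n))"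
      using assms by (intro mult_left_mono sphere_sq_add_le graded_measurable) auto
    then show "weight N \<mu> n * sphere_sq (\<lambda>z. p n z + q n z)
       \<le> 2 * (weight N \<mu> n * sphere_sq (p n)) + 2 * (weight N \<mu> n * sphere_sq (q n))"
      by (simp add: distrib_left mult_ac)
  qed
  also have "\<dots> = 2 * energy N \<mu> p + 2 * energy N \<mu> q"
    by (subst suminf_add[symmetric]) (simp_all add: energy_def)
  finally show ?thesis .
qed

lemma energy_cmult:
  assumes "graded p"
  shows "energy N \<mu> (\<lambda>n z. c * p n z) = ennreal ((cmod c)\<^sup>2) * energy N \<mu> p"
  using assms by (simp add: energy_def sphere_sq_cmult[OF graded_measurable] mult.left_commute[of _ "ennreal _"])

lemma energy_mono:
  assumes "\<And>n. q n = p n \<or> q n = (\<lambda>z. 0)"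
  shows "energy N \<mu> q \<le> energy N \<mu> p"
  unfolding energy_def using assms
  by (intro suminf_le summableI mult_left_mono) (metis order_refl sphere_sq_zero zero_le, simp)

lemma energy_trunc_le: "energy N \<mu> (trunc K p) \<le> energy N \<mu> p"
  by (rule energy_mono) (auto simp: trunc_def)

lemma energy_trunc: "energy N \<mu> (trunc K p) = (\<Sum>n<K. weight N \<mu> n * sphere_sq (p n))"
proof -
  have "energy N \<mu> (trunc K p) = (\<Sum>n<K. weight N \<mu> n * sphere_sq (trunc K p n))"
    unfolding energy_def by (rule suminf_finite) (auto simp: trunc_def)
  then show ?thesis by (simp add: trunc_def)
qed

lemma energy_eq_SUP: "energy N \<mu> p = (SUP K. energy N \<mu> (trunc K p))"
  unfolding energy_trunc by (simp add: energy_def suminf_eq_SUP)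

lemma energy_single: "energy N \<mu> (single l q) = weight N \<mu> l * sphere_sq q"
proof -
  have "energy N \<mu> (single l q) = (\<Sum>n\<in>{l}. weight N \<mu> n * sphere_sq (single l q n))"
    unfolding energy_def by (rule suminf_finite) (auto simp: single_def)
  then show ?thesis by (simp add: single_def)
qed

lemma conv_single:
  "conv \<Phi> (single l q) n = (if l \<le> n then (\<lambda>z. \<Phi> (n - l) z * q z) else (\<lambda>z. 0))"
proof (cases "l \<le> n")
  case True
  have "conv \<Phi> (single l q) n z = (\<Sum>i\<le>n. if i = n - l then \<Phi> (n - l) z * q z else 0)" for z
    unfolding conv_def using True by (intro sum.cong) (auto simp: single_def)
  then show ?thesis using True by (simp add: fun_eq_iff)
next
  case False
  then show ?thesis by (auto simp: fun_eq_iff conv_def single_def intro!: sum.neutral)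
qed

lemma weight_add_le:
  assumes "admissible \<mu>"
  shows "weight N \<mu> (k + l) \<le> ennreal (real (Suc l) ^ (2 * N)) * weight N \<mu> k"
proof -
  have "real (Suc (k + l)) \<le> real (Suc l) * real (Suc k)"
    by (simp flip: of_nat_mult of_nat_add of_nat_Suc)
  then have "real (Suc (k + l)) ^ (2 * N) \<le> (real (Suc l) * real (Suc k)) ^ (2 * N)"
    by (intro power_mono) auto
  then have "ennreal (real (Suc (k + l)) ^ (2 * N)) \<le> ennreal (real (Suc l) ^ (2 * N)) * ennreal (real (Suc k) ^ (2 * N))"
    by (simp add: ennreal_mult[symmetric] power_mult_distrib ennreal_leI)
  then show ?thesis
    unfolding weight_def mult.assoc[symmetric] using moment_antimono[OF assms, of k "k + l"]
    by (intro mult_mono) auto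
qed

lemma graded_hcomp: "f \<in> Hol (ball 0 1) \<Longrightarrow> graded (\<lambda>n. hcomp n f)"
  by (simp add: graded_def hcomp_homogeneous)

lemma hcomp_mult_conv:
  assumes "f \<in> Hol (ball 0 1)" "g \<in> Hol (ball 0 1)"
  shows "(\<lambda>n. hcomp n (\<lambda>z. f z * g z)) = conv (\<lambda>n. hcomp n f) (\<lambda>n. hcomp n g)"
  by (simp add: fun_eq_iff conv_def hcomp_mult[OF assms])

lemma Besov_Hol: "f \<in> Besov N \<mu> \<Longrightarrow> f \<in> Hol (ball 0 1)"
  by (simp add: Besov_def)

lemma Besov_cong:
  assumes \<mu>: "admissible \<mu>" and f: "f \<in> Besov N \<mu>" and eq: "\<And>z. z \<in> ball 0 1 \<Longrightarrow> f z = g z"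
  shows "g \<in> Besov N \<mu>"
proof -
  have "g \<in> Hol (ball 0 1)" using iffD1[OF Hol_cong[OF open_ball eq] Besov_Hol[OF f]] .
  moreover have "hcomp n f = hcomp n g" for n by (rule hcomp_cong[OF Besov_Hol[OF f] eq])
  ultimately show ?thesis using f by (simp add: Besov_iff_energy[OF \<mu>])
qed

lemma Besov_add:
  assumes \<mu>: "admissible \<mu>" and f: "f \<in> Besov N \<mu>" and g: "g \<in> Besov N \<mu>"
  shows "(\<lambda>z. f z + g z) \<in> Besov N \<mu>"
proof -
  note fg = Besov_Hol[OF f] Besov_Hol[OF g]
  have "(\<lambda>n. hcomp n (\<lambda>z. f z + g z)) = (\<lambda>n z. hcomp n f z + hcomp n g z)"
    by (simp add: fun_eq_iff hcomp_add[OF fg])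
  moreover have "energy N \<mu> (\<lambda>n z. hcomp n f z + hcomp n g z) < \<infinity>"
    using f g by (intro order_le_less_trans[OF energy_add_le[OF graded_hcomp graded_hcomp]] fg)
      (simp add: Besov_iff_energy[OF \<mu>] ennreal_mult_less_top)
  ultimately show ?thesis using fg by (simp add: Besov_iff_energy[OF \<mu>] Hol_add)
qed

lemma Besov_cmult:
  assumes \<mu>: "admissible \<mu>" and f: "f \<in> Besov N \<mu>"
  shows "(\<lambda>z. c * f z) \<in> Besov N \<mu>"
proof -
  note fH = Besov_Hol[OF f]
  have "(\<lambda>n. hcomp n (\<lambda>z. c * f z)) = (\<lambda>n z. c * hcomp n f z)"
    by (simp add: fun_eq_iff hcomp_cmult[OF fH])
  then show ?thesis
    using f by (simp add: Besov_iff_energy[OF \<mu>] Hol_cmult energy_cmult graded_hcomp ennreal_mult_less_top)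
qed

lemma Besov_Suc_iff:
  "f \<in> Besov (Suc m) \<mu> \<longleftrightarrow> f \<in> Hol (ball 0 1) \<and> radial_deriv f \<in> Besov m \<mu>"
  by (auto simp: Besov_def radial_deriv_Hol funpow_Suc_right simp del: funpow.simps)

lemma one_in_Besov:
  assumes \<mu>: "admissible \<mu>"
  shows "(\<lambda>z :: complex ^ 'd. 1) \<in> Besov N \<mu>"
proof -
  have hom: "(\<lambda>z :: complex ^ 'd. 1 :: complex) \<in> homogeneous 0" by (auto simp: homogeneous_def)
  have "(\<lambda>n. hcomp n (\<lambda>z :: complex ^ 'd. 1)) = single 0 (\<lambda>z. 1)"
    by (simp add: fun_eq_iff hcomp_one single_def)
  then show ?thesis
    using weight_finite[OF \<mu>] sphere_sq_finite[OF hom]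
    by (simp add: Besov_iff_energy[OF \<mu>] energy_single ennreal_mult_less_top)
qed

lemma Mult_Hol:
  assumes \<mu>: "admissible \<mu>" and \<phi>: "\<phi> \<in> Mult N \<mu>"
  shows "\<phi> \<in> Hol (ball 0 1)"
proof -
  have "(\<lambda>z. \<phi> z * 1) \<in> Besov N \<mu>" using \<phi> one_in_Besov[OF \<mu>] unfolding Mult_def by fast
  then show ?thesis using Besov_Hol by simp
qed

section \<open>Multipliers are bounded operators\<close>

context
  fixes \<mu> :: "real measure" and N :: nat and \<Phi> :: "nat \<Rightarrow> complex ^ 'd \<Rightarrow> complex"
  assumes adm: "admissible \<mu>" and graded_\<Phi>: "graded \<Phi>"
    and finite_energy_conv: "\<And>p. graded p \<Longrightarrow> energy N \<mu> p < \<infinity> \<Longrightarrow> energy N \<mu> (conv \<Phi> p) < \<infinity>"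
begin

lemma energy_symbol_finite: "energy N \<mu> \<Phi> < \<infinity>"
proof -
  have one: "(\<lambda>z :: complex ^ 'd. 1 :: complex) \<in> homogeneous 0" by (auto simp: homogeneous_def)
  have "energy N \<mu> (single 0 (\<lambda>z. 1 :: complex) :: nat \<Rightarrow> complex ^ 'd \<Rightarrow> complex) < \<infinity>"
    unfolding energy_single using weight_finite[OF adm] sphere_sq_finite[OF one]
    by (simp add: ennreal_mult_less_top)
  from finite_energy_conv[OF graded_single[OF one] this] show ?thesis
    by (simp add: conv_single[abs_def])
qed

text \<open>
  A homogeneous polynomial is bounded on the sphere by its \<open>L\<^sup>2\<close> norm, and a shift by \<open>l\<close> degrees
  changes the weights by at most a constant factor. So multiplication by \<open>q\<close> maps the symbol \<open>\<Phi>\<close>,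
  which has finite energy as the product of \<open>\<Phi>\<close> with the constant \<open>1\<close>, to something of
  comparable energy.
\<close>

lemma conv_single_bounded:
  "\<exists>C<\<infinity>. \<forall>q\<in>homogeneous l. energy N \<mu> (conv \<Phi> (single l q)) \<le> C * energy N \<mu> (single l q)"
proof -
  obtain B :: ennreal where B: "B < \<infinity>"
    "\<And>n (p :: complex ^ 'd \<Rightarrow> complex) z. p \<in> homogeneous n \<Longrightarrow> norm z \<le> 1/2 \<Longrightarrow> ennreal ((cmod (p z))\<^sup>2) \<le> B * sphere_sq p"
    using homogeneous_sup_bound[of "1/2"] by auto
  obtain w where w: "weight N \<mu> l = ennreal w" "w > 0"
    using weight_pos[OF adm, of N l] weight_finite[OF adm, of N l]
    by (cases "weight N \<mu> l" rule: ennreal_cases) auto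
  define D where "D = ennreal (real (Suc l) ^ (2 * N)) * (ennreal (4 ^ l) * B * energy N \<mu> \<Phi>)"
  have D: "D < \<infinity>"
    using B(1) energy_symbol_finite by (simp add: D_def ennreal_mult_less_top)
  have "energy N \<mu> (conv \<Phi> (single l q)) \<le> (D * ennreal (1 / w)) * energy N \<mu> (single l q)"
    if q: "q \<in> homogeneous l" for q
  proof -
    have [measurable]: "q \<in> borel_measurable borel" "\<And>k. \<Phi> k \<in> borel_measurable borel"
      using homogeneous_measurable[OF q] graded_measurable[OF graded_\<Phi>] by auto
    have sup: "ennreal ((cmod (q z))\<^sup>2) \<le> ennreal (4 ^ l) * (B * sphere_sq q)" if "norm z = 1" for z
    proof -
      have "q (2 *s ((1/2) *s z)) = 2 ^ l * q ((1/2) *s z)" by (rule homogeneousD(2)[OF q])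
      then have "cmod (q z) = 2 ^ l * cmod (q ((1/2) *s z))" by (simp add: norm_mult norm_power)
      then have "(cmod (q z))\<^sup>2 = 4 ^ l * (cmod (q ((1/2) *s z)))\<^sup>2"
        by (simp add: power_mult_distrib power2_eq_square[of "2 ^ l"] power_mult_distrib[symmetric])
      moreover have "ennreal ((cmod (q ((1/2) *s z)))\<^sup>2) \<le> B * sphere_sq q"
        using that by (intro B(2)[OF q]) (simp add: norm_vector_smult_complex)
      ultimately show ?thesis
        by (simp add: ennreal_mult mult_left_mono)
    qed
    have A: "sphere_sq (\<lambda>z. \<Phi> k z * q z) \<le> (ennreal (4 ^ l) * (B * sphere_sq q)) * sphere_sq (\<Phi> k)" for k
    proof -
      have "sphere_sq (\<lambda>z. \<Phi> k z * q z)
        \<le> (\<integral>\<^sup>+z. (ennreal (4 ^ l) * (B * sphere_sq q)) * ennreal ((cmod (\<Phi> k z))\<^sup>2) \<partial>sphere_measure)"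
        unfolding sphere_sq_def[of "\<lambda>z. \<Phi> k z * q z"]
      proof (rule nn_integral_mono_AE)
        show "AE z in sphere_measure. ennreal ((cmod (\<Phi> k z * q z))\<^sup>2)
            \<le> (ennreal (4 ^ l) * (B * sphere_sq q)) * ennreal ((cmod (\<Phi> k z))\<^sup>2)"
          using AE_sphere_measure
        proof eventually_elim
          case (elim z)
          then have "ennreal ((cmod (q z))\<^sup>2) * ennreal ((cmod (\<Phi> k z))\<^sup>2)
            \<le> (ennreal (4 ^ l) * (B * sphere_sq q)) * ennreal ((cmod (\<Phi> k z))\<^sup>2)"
            by (intro mult_right_mono sup) auto
          then show ?case by (simp add: norm_mult power_mult_distrib ennreal_mult mult.commute)
        qed
      qed
      also have "\<dots> = (ennreal (4 ^ l) * (B * sphere_sq q)) * sphere_sq (\<Phi> k)"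
        unfolding sphere_sq_def[of "\<Phi> k"] by (rule nn_integral_cmult) measurable
      finally show ?thesis .
    qed
    have "energy N \<mu> (conv \<Phi> (single l q)) = (\<Sum>k. weight N \<mu> (k + l) * sphere_sq (conv \<Phi> (single l q) (k + l)))
        + (\<Sum>k<l. weight N \<mu> k * sphere_sq (conv \<Phi> (single l q) k))"
      unfolding energy_def by (rule suminf_offset) simp
    also have "\<dots> = (\<Sum>k. weight N \<mu> (k + l) * sphere_sq (\<lambda>z. \<Phi> k z * q z))"
      by (simp add: conv_single)
    also have "\<dots> \<le> (\<Sum>k. (ennreal (real (Suc l) ^ (2 * N)) * (ennreal (4 ^ l) * (B * sphere_sq q))) * (weight N \<mu> k * sphere_sq (\<Phi> k)))"
    proof (intro suminf_le summableI)
      fix k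
      have "weight N \<mu> (k + l) * sphere_sq (\<lambda>z. \<Phi> k z * q z)
         \<le> (ennreal (real (Suc l) ^ (2 * N)) * weight N \<mu> k) * ((ennreal (4 ^ l) * (B * sphere_sq q)) * sphere_sq (\<Phi> k))"
        by (intro mult_mono weight_add_le adm A) auto
      then show "weight N \<mu> (k + l) * sphere_sq (\<lambda>z. \<Phi> k z * q z)
         \<le> (ennreal (real (Suc l) ^ (2 * N)) * (ennreal (4 ^ l) * (B * sphere_sq q))) * (weight N \<mu> k * sphere_sq (\<Phi> k))"
        by (simp only: mult_ac)
    qed
    also have "\<dots> = (ennreal (real (Suc l) ^ (2 * N)) * (ennreal (4 ^ l) * (B * sphere_sq q))) * energy N \<mu> \<Phi>"
      unfolding ennreal_suminf_cmult energy_def ..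
    also have "\<dots> = D * sphere_sq q"
      by (simp only: D_def mult_ac)
    also have "\<dots> = (D * ennreal (1 / w)) * energy N \<mu> (single l q)"
    proof -
      have "ennreal (1 / w) * ennreal w = 1" using w by (simp flip: ennreal_mult)
      then show ?thesis unfolding energy_single w(1) by (metis mult.assoc mult.right_neutral)
    qed
    finally show ?thesis .
  qed
  moreover have "D * ennreal (1 / w) < \<infinity>" using D by (simp add: ennreal_mult_less_top)
  ultimately show ?thesis by blast
qed

lemma energy_term_le: "weight N \<mu> l * sphere_sq (p l) \<le> energy N \<mu> p"
  using sum_le_suminf[of "\<lambda>n. weight N \<mu> n * sphere_sq (p n)" "{l}"] by (simp add: energy_def)

lemma conv_trunc_bounded:
  "\<exists>C<\<infinity>. \<forall>p. graded p \<longrightarrow> energy N \<mu> (conv \<Phi> (trunc L p)) \<le> C * energy N \<mu> p"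
proof (induction L)
  case 0
  have "conv \<Phi> (trunc 0 p) = (\<lambda>n z. 0)" for p by (simp add: fun_eq_iff conv_def trunc_def)
  then show ?case by (intro exI[of _ 0]) (simp add: energy_def)
next
  case (Suc L)
  then obtain C where C: "C < \<infinity>" "\<And>p. graded p \<Longrightarrow> energy N \<mu> (conv \<Phi> (trunc L p)) \<le> C * energy N \<mu> p" by blast
  obtain C' where C': "C' < \<infinity>" "\<And>q. q \<in> homogeneous L \<Longrightarrow> energy N \<mu> (conv \<Phi> (single L q)) \<le> C' * energy N \<mu> (single L q)"
    using conv_single_bounded by blast
  have "energy N \<mu> (conv \<Phi> (trunc (Suc L) p)) \<le> (2 * C + 2 * C') * energy N \<mu> p" if p: "graded p" for p
  proof -
    have pL: "p L \<in> homogeneous L" using p by (simp add: graded_def)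
    have "trunc (Suc L) p = (\<lambda>n z. trunc L p n z + single L (p L) n z)"
      by (auto simp: fun_eq_iff trunc_def single_def)
    then have "energy N \<mu> (conv \<Phi> (trunc (Suc L) p))
        \<le> 2 * energy N \<mu> (conv \<Phi> (trunc L p)) + 2 * energy N \<mu> (conv \<Phi> (single L (p L)))"
      using energy_add_le[OF graded_conv[OF graded_\<Phi> graded_trunc[OF p]] graded_conv[OF graded_\<Phi> graded_single[OF pL]]]
      by (simp add: conv_add)
    also have "\<dots> \<le> 2 * (C * energy N \<mu> p) + 2 * (C' * energy N \<mu> p)"
    proof (intro add_mono mult_left_mono)
      show "energy N \<mu> (conv \<Phi> (single L (p L))) \<le> C' * energy N \<mu> p"
        by (rule order_trans[OF C'(2)[OF pL]]) (auto simp: energy_single intro: mult_left_mono energy_term_le)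
    qed (use C(2) p in auto)
    finally show ?thesis by (simp only: distrib_right mult.assoc)
  qed
  moreover have "2 * C + 2 * C' < \<infinity>" using C(1) C'(1) by (simp add: ennreal_mult_less_top)
  ultimately show ?case by blast
qed

text \<open>
  Since the operator is bounded on low degrees, unboundedness shows on sequences that start at
  degree \<open>L\<close>. One of them, scaled to small energy and cut off at a high degree \<open>L'\<close>, is added to
  \<open>s\<close>. Degrees below \<open>L'\<close> of the product depend only on degrees below \<open>L'\<close> of the factor, so later
  additions do not destroy the large energy of the image.
\<close>

lemma gliding_hump_step:
  assumes unbounded: "\<forall>C<\<infinity>. \<exists>p. graded p \<and> C * energy N \<mu> p < energy N \<mu> (conv \<Phi> p)"
    and s: "graded s" "\<forall>n\<ge>L. s n = (\<lambda>z. 0)" "energy N \<mu> s < 1"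
    and Y: "0 \<le> (Y :: real)"
  shows "\<exists>L' s'. L < L' \<and> graded s' \<and> (\<forall>n\<ge>L'. s' n = (\<lambda>z. 0)) \<and> (\<forall>n<L. s' n = s n)
    \<and> energy N \<mu> s' < 1 \<and> ennreal Y \<le> energy N \<mu> (trunc L' (conv \<Phi> s'))"
proof -
  note gc = graded_conv[OF graded_\<Phi>]
  obtain e where e: "energy N \<mu> s = ennreal e" "0 \<le> e" "e < 1"
    using s(3) by (cases "energy N \<mu> s" rule: ennreal_cases) (auto simp: ennreal_less_one_iff)
  define \<delta> where "\<delta> = (1 - e) / 2"
  have \<delta>: "\<delta> > 0" "e + \<delta> < 1" using e by (auto simp: \<delta>_def field_simps)
  have "energy N \<mu> (conv \<Phi> s) < \<infinity>" using s e by (intro finite_energy_conv) auto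
  then obtain x where x: "energy N \<mu> (conv \<Phi> s) = ennreal x" "0 \<le> x"
    by (cases "energy N \<mu> (conv \<Phi> s)" rule: ennreal_cases) auto
  \<comment> \<open>The energy that the image of the hump has to exceed: \<open>2 Y\<close>, and \<open>2 x\<close> for what the image of \<open>s\<close> may cancel.\<close>
  define y where "y = 2 * Y + 2 * x + 1"
  have y: "y > 0" "2 * Y + 2 * x < y" using Y x by (auto simp: y_def)
  obtain C where C: "C < \<infinity>" "\<And>p. graded p \<Longrightarrow> energy N \<mu> (conv \<Phi> (trunc L p)) \<le> C * energy N \<mu> p"
    using conv_trunc_bounded[of L] by blast
  obtain c where c: "C = ennreal c" "0 \<le> c" using C(1) by (cases C rule: ennreal_cases) auto
  \<comment> \<open>The term \<open>2 c\<close> pays for the low degrees; \<open>y / \<delta>\<close> is the gain needed above degree \<open>L\<close>.\<close>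
  define k where "k = 2 * c + 2 * (y / \<delta>)"
  have k: "k > 0" using c y \<delta> by (simp add: k_def add_nonneg_pos)
  obtain p0 where p0: "graded p0" "ennreal k * energy N \<mu> p0 < energy N \<mu> (conv \<Phi> p0)"
    using unbounded[rule_format, of "ennreal k"] by auto
  have "energy N \<mu> p0 < \<infinity>"
    using p0(2) k by (cases "energy N \<mu> p0" rule: ennreal_cases) (auto simp: ennreal_mult_top)
  then obtain a where a: "energy N \<mu> p0 = ennreal a" "0 \<le> a"
    by (cases "energy N \<mu> p0" rule: ennreal_cases) auto
  define p1 where "p1 n = (if n < L then (\<lambda>z. 0) else p0 n)" for n
  have p1: "graded p1" using p0(1) by (simp add: graded_def p1_def homogeneous_zero)
  have E1: "energy N \<mu> p1 \<le> ennreal a"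
    unfolding a(1)[symmetric] by (rule energy_mono) (auto simp: p1_def)
  then have "energy N \<mu> (conv \<Phi> p1) < \<infinity>"
    by (intro finite_energy_conv[OF p1]) (auto elim: order_le_less_trans)
  then obtain b where b: "energy N \<mu> (conv \<Phi> p1) = ennreal b" "0 \<le> b"
    by (cases "energy N \<mu> (conv \<Phi> p1)" rule: ennreal_cases) auto
  have "p0 = (\<lambda>n z. trunc L p0 n z + p1 n z)" by (auto simp: fun_eq_iff trunc_def p1_def)
  then have "conv \<Phi> p0 = conv \<Phi> (\<lambda>n z. trunc L p0 n z + p1 n z)" by (rule arg_cong)
  also have "\<dots> = (\<lambda>n z. conv \<Phi> (trunc L p0) n z + conv \<Phi> p1 n z)" by (rule conv_add)
  finally have "energy N \<mu> (conv \<Phi> p0) = energy N \<mu> \<dots>" by (rule arg_cong)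
  also have "\<dots> \<le> 2 * energy N \<mu> (conv \<Phi> (trunc L p0)) + 2 * energy N \<mu> (conv \<Phi> p1)"
    by (intro energy_add_le gc graded_trunc p0 p1)
  also have "\<dots> \<le> 2 * (ennreal c * ennreal a) + 2 * ennreal b"
    using C(2)[OF p0(1)] by (intro add_mono mult_left_mono) (auto simp: a b c)
  also have "\<dots> = ennreal (2 * (c * a) + 2 * b)"
    using a b c by (simp add: ennreal_mult)
  finally have "ennreal k * ennreal a < ennreal (2 * (c * a) + 2 * b)"
    using p0(2) a by (auto elim: order_less_le_trans)
  then have "ennreal (k * a) < ennreal (2 * (c * a) + 2 * b)"
    using a(2) k by (simp only: ennreal_mult less_imp_le)
  then have "k * a < 2 * (c * a) + 2 * b"
    using a(2) k by (simp only: ennreal_less_iff mult_nonneg_nonneg less_imp_le)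
  then have "2 * (y / \<delta> * a) < 2 * b"
    by (simp only: k_def distrib_right mult.assoc add_less_cancel_left)
  then have ab: "y / \<delta> * a < b" by (simp only: mult_less_cancel_left_pos zero_less_numeral)
  moreover have "0 \<le> y / \<delta> * a" using y \<delta> a by simp
  ultimately have b0: "b > 0" by linarith
  have ya: "y / b * a < \<delta>" using ab b0 \<delta> by (simp add: field_simps)
  define p where "p n z = complex_of_real (sqrt (y / b)) * p1 n z" for n z
  have sq: "(cmod (complex_of_real (sqrt (y / b))))\<^sup>2 = y / b" using y b0 by simp
  have p: "graded p" unfolding p_def by (rule graded_cmult[OF p1])
  have Ep: "energy N \<mu> p \<le> ennreal \<delta>"
  proof -
    have "energy N \<mu> p = ennreal (y / b) * energy N \<mu> p1"
      unfolding p_def[abs_def] energy_cmult[OF p1] sq ..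
    also have "\<dots> \<le> ennreal (y / b) * ennreal a" by (intro mult_left_mono E1) simp
    also have "\<dots> \<le> ennreal \<delta>" using ya y b0 a by (simp add: ennreal_mult[symmetric] ennreal_leI)
    finally show ?thesis .
  qed
  have Tp: "energy N \<mu> (conv \<Phi> p) = ennreal y"
  proof -
    have "energy N \<mu> (conv \<Phi> p) = ennreal (y / b) * ennreal b"
      unfolding p_def[abs_def] conv_cmult energy_cmult[OF gc[OF p1]] sq b(1) ..
    then show ?thesis using y b0 by (simp add: ennreal_mult[symmetric])
  qed
  have "ennreal (2 * Y + 2 * x) < (SUP K. energy N \<mu> (trunc K (conv \<Phi> p)))"
    unfolding energy_eq_SUP[symmetric] Tp using y by (intro ennreal_lessI)
  then obtain K where K: "ennreal (2 * Y + 2 * x) < energy N \<mu> (trunc K (conv \<Phi> p))"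
    by (auto simp: less_SUP_iff)
  define L' where "L' = max K (Suc L)"
  define s' where "s' n z = s n z + trunc L' p n z" for n z
  have gs': "graded s'" unfolding s'_def by (intro graded_add s graded_trunc p)
  have pz: "p n = (\<lambda>z. 0)" if "n < L" for n using that by (simp add: fun_eq_iff p_def p1_def)
  have s'_low: "s' n = s n" if "n < L" for n
    using pz[OF that] by (auto simp: fun_eq_iff s'_def trunc_def)
  have s'_mid: "s' n = trunc L' p n" if "L \<le> n" for n
    using s(2)[rule_format, OF that] by (auto simp: fun_eq_iff s'_def)
  have "energy N \<mu> s' \<le> (\<Sum>n. weight N \<mu> n * sphere_sq (s n) + weight N \<mu> n * sphere_sq (p n))"
    unfolding energy_def
  proof (intro suminf_le summableI)
    fix n
    show "weight N \<mu> n * sphere_sq (s' n) \<le> weight N \<mu> n * sphere_sq (s n) + weight N \<mu> n * sphere_sq (p n)"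
      by (cases "n < L") (auto simp: s'_low s'_mid trunc_def)
  qed
  also have "\<dots> = energy N \<mu> s + energy N \<mu> p"
    unfolding energy_def by (rule suminf_add[symmetric]) auto
  also have "\<dots> \<le> ennreal e + ennreal \<delta>" using Ep e by (simp add: add_left_mono)
  also have "\<dots> < 1" using e \<delta> by (simp flip: ennreal_plus add: ennreal_less_one_iff)
  finally have Es': "energy N \<mu> s' < 1" .
  have "ennreal (2 * Y + 2 * x) \<le> energy N \<mu> (trunc L' (conv \<Phi> p))"
    using K by (rule order_trans[OF less_imp_le]) (auto simp: energy_trunc L'_def intro!: sum_mono2)
  also have "trunc L' (conv \<Phi> p) = trunc L' (conv \<Phi> (\<lambda>n z. s' n z + (-1) * s n z))"
    by (rule trunc_conv_cong) (auto simp: s'_def trunc_def)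
  also have "\<dots> = (\<lambda>n z. trunc L' (conv \<Phi> s') n z + trunc L' (conv \<Phi> (\<lambda>n z. (-1) * s n z)) n z)"
    by (simp only: conv_add trunc_add)
  also have "energy N \<mu> \<dots> \<le> 2 * energy N \<mu> (trunc L' (conv \<Phi> s')) + 2 * energy N \<mu> (trunc L' (conv \<Phi> (\<lambda>n z. (-1) * s n z)))"
    by (intro energy_add_le graded_trunc gc gs' graded_cmult[OF s(1)])
  also have "energy N \<mu> (trunc L' (conv \<Phi> (\<lambda>n z. (-1) * s n z))) \<le> energy N \<mu> (conv \<Phi> (\<lambda>n z. (-1) * s n z))"
    by (rule energy_trunc_le)
  also have "\<dots> = ennreal x"
    unfolding conv_cmult energy_cmult[OF gc[OF s(1)]] x(1) by simp
  finally have "ennreal (2 * Y + 2 * x) \<le> 2 * energy N \<mu> (trunc L' (conv \<Phi> s')) + 2 * ennreal x"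
    by (simp add: mult_left_mono add_left_mono)
  then have "ennreal Y \<le> energy N \<mu> (trunc L' (conv \<Phi> s'))"
  proof (cases "energy N \<mu> (trunc L' (conv \<Phi> s'))" rule: ennreal_cases)
    case (real t)
    assume *: "ennreal (2 * Y + 2 * x) \<le> 2 * energy N \<mu> (trunc L' (conv \<Phi> s')) + 2 * ennreal x"
    have "2 * ennreal t + 2 * ennreal x = ennreal (2 * t + 2 * x)" using real x by (simp add: ennreal_mult)
    with * real(2) have "ennreal (2 * Y + 2 * x) \<le> ennreal (2 * t + 2 * x)" by (simp only:)
    moreover have "0 \<le> 2 * t + 2 * x" using real x by simp
    ultimately have "2 * Y + 2 * x \<le> 2 * t + 2 * x" by (simp only: ennreal_le_iff)
    then show ?thesis using real by (simp add: ennreal_leI)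
  qed simp
  moreover have "\<forall>n\<ge>L'. s' n = (\<lambda>z. 0)" using s(2) by (auto simp: fun_eq_iff s'_def trunc_def L'_def)
  ultimately show ?thesis
    using gs' Es' s'_low by (intro exI[of _ L'] exI[of _ s']) (auto simp: L'_def)
qed

text \<open>
  The closed graph theorem for triangular operators, proved by a gliding hump: if no bound
  existed, the humps of \<open>gliding_hump_step\<close> could be put together to a sequence of finite energy
  whose image has infinite energy.
\<close>

lemma conv_bounded:
  "\<exists>C<\<infinity>. \<forall>p. graded p \<longrightarrow> energy N \<mu> (conv \<Phi> p) \<le> C * energy N \<mu> p"
proof (rule ccontr)
  assume "\<not> ?thesis"
  then have unbounded: "\<forall>C<\<infinity>. \<exists>p. graded p \<and> C * energy N \<mu> p < energy N \<mu> (conv \<Phi> p)"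
    by (auto simp: not_le)
  let ?P = "\<lambda>x :: nat \<times> (nat \<Rightarrow> complex ^ 'd \<Rightarrow> complex).
    graded (snd x) \<and> (\<forall>n\<ge>fst x. snd x n = (\<lambda>z. 0)) \<and> energy N \<mu> (snd x) < 1"
  let ?Q = "\<lambda>i (x :: nat \<times> (nat \<Rightarrow> complex ^ 'd \<Rightarrow> complex)) y. fst x < fst y \<and>
    (\<forall>n<fst x. snd y n = snd x n) \<and> ennreal (real i) \<le> energy N \<mu> (trunc (fst y) (conv \<Phi> (snd y)))"
  have "\<exists>f. \<forall>i. ?P (f i) \<and> ?Q i (f i) (f (Suc i))"
  proof (rule dependent_nat_choice)
    show "\<exists>x. ?P x" by (intro exI[of _ "(0, \<lambda>n z. 0)"]) (simp add: graded_def homogeneous_zero energy_def)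
    fix x :: "nat \<times> (nat \<Rightarrow> complex ^ 'd \<Rightarrow> complex)" and i
    assume "?P x"
    then have "graded (snd x)" "\<forall>n\<ge>fst x. snd x n = (\<lambda>z. 0)" "energy N \<mu> (snd x) < 1"
      by auto
    from gliding_hump_step[OF unbounded this of_nat_0_le_iff, of i]
    obtain L' s' where "?P (L', s') \<and> ?Q i x (L', s')" by auto
    then show "\<exists>y. ?P y \<and> ?Q i x y" by (rule exI)
  qed
  then obtain F where F: "\<And>i. ?P (F i)" "\<And>i. ?Q i (F i) (F (Suc i))" by blast
  define L where "L i = fst (F i)" for i
  define s where "s i = snd (F i)" for i
  have s: "graded (s i)" "energy N \<mu> (s i) < 1" for i
    using F(1)[of i] by (auto simp: s_def L_def)
  have step: "L i < L (Suc i)" "\<And>n. n < L i \<Longrightarrow> s (Suc i) n = s i n"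
      "ennreal (real i) \<le> energy N \<mu> (trunc (L (Suc i)) (conv \<Phi> (s (Suc i))))" for i
    using F(2)[of i] by (auto simp: s_def L_def)
  have Lmono: "strict_mono L" using step(1) by (simp add: strict_mono_Suc_iff)
  have Li: "i \<le> L i" for i by (rule strict_mono_imp_increasing[OF Lmono])
  have agree: "s j n = s i n" if "i \<le> j" "n < L i" for i j n
    using that(1)
  proof (induction rule: dec_induct)
    case (step j)
    have "n < L j" using that(2) strict_mono_less_eq[OF Lmono, of i j] step.hyps by simp
    then show ?case using \<open>\<And>n i. n < L i \<Longrightarrow> s (Suc i) n = s i n\<close> step.IH by simp
  qed simp
  \<comment> \<open>Every \<open>s i\<close> with \<open>L i > n\<close> has the same component of degree \<open>n\<close>.\<close>
  define f where "f n = s (Suc n) n" for n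
  have f: "f n = s i n" if "n < L i" for n i
    using agree[of i "Suc n" n] agree[of "Suc n" i n] that Li[of "Suc n"] by (cases "i \<le> Suc n") (auto simp: f_def)
  have gf: "graded f" using s(1) by (simp add: graded_def f_def)
  have "energy N \<mu> f \<le> 1"
    unfolding energy_eq_SUP[of N \<mu> f]
  proof (rule SUP_least)
    fix K
    have "energy N \<mu> (trunc K f) = energy N \<mu> (trunc K (s K))"
      unfolding energy_trunc by (intro sum.cong) (use f[of _ K] Li[of K] in auto)
    also have "\<dots> \<le> 1" using energy_trunc_le[of N \<mu> K "s K"] s(2)[of K] by simp
    finally show "energy N \<mu> (trunc K f) \<le> 1" .
  qed
  then have "energy N \<mu> (conv \<Phi> f) < \<infinity>"
    by (intro finite_energy_conv[OF gf]) (auto elim: order_le_less_trans)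
  then obtain t where t: "energy N \<mu> (conv \<Phi> f) = ennreal t" "0 \<le> t"
    by (cases "energy N \<mu> (conv \<Phi> f)" rule: ennreal_cases) auto
  obtain i where i: "t < real i" using reals_Archimedean2 by blast
  have "ennreal (real i) \<le> energy N \<mu> (trunc (L (Suc i)) (conv \<Phi> (s (Suc i))))" by (rule step(3))
  also have "trunc (L (Suc i)) (conv \<Phi> (s (Suc i))) = trunc (L (Suc i)) (conv \<Phi> f)"
    by (rule trunc_conv_cong) (simp add: f)
  also have "energy N \<mu> \<dots> \<le> ennreal t" using energy_trunc_le t by metis
  finally show False using i t by (simp add: ennreal_le_iff)
qed

end

section \<open>Multipliers act on the spaces of lower order\<close>

lemma suminf_ennreal_commute:
  fixes f :: "nat \<Rightarrow> nat \<Rightarrow> ennreal"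
  shows "(\<Sum>i. \<Sum>j. f i j) = (\<Sum>j. \<Sum>i. f i j)"
proof -
  have "(\<Sum>i. \<Sum>j. f i j) = (\<Sum>i. \<integral>\<^sup>+j. f i j \<partial>count_space UNIV)"
    by (simp only: nn_integral_count_space_nat)
  also have "\<dots> = (\<integral>\<^sup>+j. (\<Sum>i. f i j) \<partial>count_space UNIV)"
    by (rule nn_integral_suminf[symmetric]) simp
  finally show ?thesis by (simp only: nn_integral_count_space_nat)
qed

lemma sum_odd_Suc: "(\<Sum>j\<le>n. 2 * real j + 1) = (real n + 1)\<^sup>2"
  by (induction n) (auto simp: power2_eq_square algebra_simps)

text \<open>
  The Cauchy-Schwarz inequality for the weights \<open>2j+1\<close>, whose sum is \<open>(n+1)\<^sup>2\<close>.
\<close>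

lemma norm_sum_odd_squared_le:
  fixes x :: "nat \<Rightarrow> complex"
  shows "(cmod (\<Sum>j\<le>n. of_real (2 * real j + 1) * x j))\<^sup>2
    \<le> (real n + 1)\<^sup>2 * (\<Sum>j\<le>n. (2 * real j + 1) * (cmod (x j))\<^sup>2)"
proof -
  have "cmod (\<Sum>j\<le>n. of_real (2 * real j + 1) * x j) \<le> (\<Sum>j\<le>n. sqrt (2 * real j + 1) * (sqrt (2 * real j + 1) * cmod (x j)))"
    by (rule sum_norm_le) (simp add: norm_mult mult.assoc[symmetric] del: of_real_add of_real_mult)
  then have "(cmod (\<Sum>j\<le>n. of_real (2 * real j + 1) * x j))\<^sup>2
     \<le> (\<Sum>j\<le>n. sqrt (2 * real j + 1) * (sqrt (2 * real j + 1) * cmod (x j)))\<^sup>2"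
    by (intro power_mono) auto
  also have "\<dots> \<le> (\<Sum>j\<le>n. (sqrt (2 * real j + 1))\<^sup>2) * (\<Sum>j\<le>n. (sqrt (2 * real j + 1) * cmod (x j))\<^sup>2)"
    by (rule Cauchy_Schwarz_ineq_sum)
  also have "\<dots> = (real n + 1)\<^sup>2 * (\<Sum>j\<le>n. (2 * real j + 1) * (cmod (x j))\<^sup>2)"
    by (simp add: sum_odd_Suc power_mult_distrib)
  finally show ?thesis .
qed

text \<open>
  With \<open>P j\<close> the part of \<open>p\<^sub>n/(n+1)\<^sup>2\<close> in degrees \<open>n \<ge> j\<close>, the component of degree \<open>n\<close> of
  \<open>\<Phi> p\<close> is the sum over \<open>j \<le> n\<close> of \<open>2j+1\<close> times that of \<open>\<Phi> P j\<close>. The Cauchy-Schwarz inequality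
  costs the factor \<open>(n+1)\<^sup>2\<close>, which is the quotient of the weights of orders \<open>N+1\<close> and \<open>N\<close>; then
  the bound of order \<open>N+1\<close> is applied to each \<open>P j\<close>, and summation over \<open>j\<close> gives back \<open>p\<close>.
\<close>

lemma conv_bounded_lower_order:
  fixes \<Phi> p :: "nat \<Rightarrow> complex ^ 'd \<Rightarrow> complex"
  assumes \<Phi>: "graded \<Phi>"
    and bounded: "\<And>p. graded p \<Longrightarrow> energy (Suc N) \<mu> (conv \<Phi> p) \<le> C * energy (Suc N) \<mu> p"
    and p: "graded p"
  shows "energy N \<mu> (conv \<Phi> p) \<le> C * energy N \<mu> p"
proof -
  define P where "P j n = (\<lambda>z. (if j \<le> n then 1 / (of_nat (Suc n))\<^sup>2 else 0) * p n z)" for j n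
  have gP: "graded (P j)" for j
    unfolding P_def by (rule graded_cmult[OF p])
  have [measurable]: "p n \<in> borel_measurable borel" "conv \<Phi> (P j) n \<in> borel_measurable borel" for n j
    using graded_measurable[OF p] graded_measurable[OF graded_conv[OF \<Phi> gP]] by auto
  have decomp: "p m z = (\<Sum>j\<le>n. of_real (2 * real j + 1) * P j m z)" if "m \<le> n" for m n z
  proof -
    have "(\<Sum>j\<le>n. of_real (2 * real j + 1) * P j m z) = (\<Sum>j\<le>m. of_real (2 * real j + 1) * (p m z / (of_nat (Suc m))\<^sup>2))"
      using that by (intro sum.mono_neutral_cong_right) (auto simp: P_def)
    also have "\<dots> = of_real (\<Sum>j\<le>m. 2 * real j + 1) * (p m z / (of_nat (Suc m))\<^sup>2)"
      by (simp only: of_real_sum sum_distrib_right)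
    also have "\<dots> = p m z"
      unfolding sum_odd_Suc by (simp add: field_simps del: of_nat_Suc) (simp add: add.commute)
    finally show ?thesis ..
  qed
  have conv_decomp: "conv \<Phi> p n z = (\<Sum>j\<le>n. of_real (2 * real j + 1) * conv \<Phi> (P j) n z)" for n z
  proof -
    have "conv \<Phi> p n z = (\<Sum>i\<le>n. \<Sum>j\<le>n. of_real (2 * real j + 1) * (\<Phi> i z * P j (n - i) z))"
      unfolding conv_def by (intro sum.cong refl, subst decomp[of _ n]) (auto simp: sum_distrib_left mult_ac)
    also have "\<dots> = (\<Sum>j\<le>n. \<Sum>i\<le>n. of_real (2 * real j + 1) * (\<Phi> i z * P j (n - i) z))"
      by (rule sum.swap)
    finally show ?thesis by (simp add: conv_def sum_distrib_left)
  qed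
  have A: "sphere_sq (conv \<Phi> p n) \<le> ennreal ((real n + 1)\<^sup>2) * (\<Sum>j\<le>n. ennreal (2 * real j + 1) * sphere_sq (conv \<Phi> (P j) n))" for n
  proof -
    have "sphere_sq (conv \<Phi> p n) \<le> (\<integral>\<^sup>+z. ennreal ((real n + 1)\<^sup>2) * (\<Sum>j\<le>n. ennreal (2 * real j + 1) * ennreal ((cmod (conv \<Phi> (P j) n z))\<^sup>2)) \<partial>sphere_measure)"
      unfolding sphere_sq_def
    proof (rule nn_integral_mono)
      fix z
      have "ennreal ((cmod (conv \<Phi> p n z))\<^sup>2) \<le> ennreal ((real n + 1)\<^sup>2 * (\<Sum>j\<le>n. (2 * real j + 1) * (cmod (conv \<Phi> (P j) n z))\<^sup>2))"
        unfolding conv_decomp by (intro ennreal_leI norm_sum_odd_squared_le)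
      also have "\<dots> = ennreal ((real n + 1)\<^sup>2) * (\<Sum>j\<le>n. ennreal ((2 * real j + 1) * (cmod (conv \<Phi> (P j) n z))\<^sup>2))"
        by (subst sum_ennreal) (auto simp: ennreal_mult sum_nonneg)
      finally show "ennreal ((cmod (conv \<Phi> p n z))\<^sup>2) \<le> ennreal ((real n + 1)\<^sup>2) * (\<Sum>j\<le>n. ennreal (2 * real j + 1) * ennreal ((cmod (conv \<Phi> (P j) n z))\<^sup>2))"
        by (simp add: ennreal_mult)
    qed
    also have "\<dots> = ennreal ((real n + 1)\<^sup>2) * (\<Sum>j\<le>n. ennreal (2 * real j + 1) * sphere_sq (conv \<Phi> (P j) n))"
      by (simp add: nn_integral_cmult nn_integral_sum sphere_sq_def)
    finally show ?thesis .
  qed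
  let ?W = "\<lambda>n. weight (Suc N) \<mu> n"
  have W: "?W n = weight N \<mu> n * ennreal ((real n + 1)\<^sup>2)" for n
    by (simp add: weight_def ennreal_mult power2_eq_square mult_ac add.commute)
  have "energy N \<mu> (conv \<Phi> p) \<le> (\<Sum>n. \<Sum>j. if j \<le> n then ?W n * (ennreal (2 * real j + 1) * sphere_sq (conv \<Phi> (P j) n)) else 0)"
    unfolding energy_def
  proof (intro suminf_le summableI)
    fix n
    have "weight N \<mu> n * sphere_sq (conv \<Phi> p n) \<le> weight N \<mu> n * (ennreal ((real n + 1)\<^sup>2) * (\<Sum>j\<le>n. ennreal (2 * real j + 1) * sphere_sq (conv \<Phi> (P j) n)))"
      by (intro mult_left_mono A) simp
    also have "\<dots> = (\<Sum>j\<le>n. ?W n * (ennreal (2 * real j + 1) * sphere_sq (conv \<Phi> (P j) n)))"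
      by (simp add: W sum_distrib_left mult.assoc)
    also have "\<dots> = (\<Sum>j. if j \<le> n then ?W n * (ennreal (2 * real j + 1) * sphere_sq (conv \<Phi> (P j) n)) else 0)"
      by (subst suminf_finite[of "{..n}"]) auto
    finally show "weight N \<mu> n * sphere_sq (conv \<Phi> p n) \<le> (\<Sum>j. if j \<le> n then ?W n * (ennreal (2 * real j + 1) * sphere_sq (conv \<Phi> (P j) n)) else 0)" .
  qed
  also have "\<dots> \<le> (\<Sum>n. \<Sum>j. ennreal (2 * real j + 1) * (?W n * sphere_sq (conv \<Phi> (P j) n)))"
    by (intro suminf_le summableI) (auto simp: mult_ac)
  also have "\<dots> = (\<Sum>j. ennreal (2 * real j + 1) * energy (Suc N) \<mu> (conv \<Phi> (P j)))"
    by (subst suminf_ennreal_commute) (simp add: energy_def)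
  also have "\<dots> \<le> (\<Sum>j. ennreal (2 * real j + 1) * (C * energy (Suc N) \<mu> (P j)))"
    by (intro suminf_le summableI mult_left_mono bounded gP) auto
  also have "\<dots> = C * (\<Sum>j. \<Sum>n. ennreal (2 * real j + 1) * (?W n * sphere_sq (P j n)))"
    by (simp only: energy_def mult.left_commute[of _ C] ennreal_suminf_cmult)
  also have "(\<Sum>j. \<Sum>n. ennreal (2 * real j + 1) * (?W n * sphere_sq (P j n))) = (\<Sum>n. \<Sum>j. ennreal (2 * real j + 1) * (?W n * sphere_sq (P j n)))"
    by (rule suminf_ennreal_commute)
  also have "\<dots> = energy N \<mu> p"
    unfolding energy_def
  proof (rule suminf_cong)
    fix n
    have PA: "sphere_sq (P j n) = (if j \<le> n then ennreal (1 / (real n + 1) ^ 4) * sphere_sq (p n) else 0)" for j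
    proof (cases "j \<le> n")
      case True
      have "sphere_sq (P j n) = ennreal ((cmod (1 / (of_nat (Suc n))\<^sup>2))\<^sup>2) * sphere_sq (p n)"
        unfolding P_def using True by (simp only: if_True sphere_sq_cmult[OF graded_measurable[OF p]])
      also have "(cmod (1 / (of_nat (Suc n))\<^sup>2))\<^sup>2 = 1 / (real n + 1) ^ 4"
        by (simp only: norm_divide norm_power norm_of_nat norm_one) (simp add: power_divide add.commute)
      finally show ?thesis using True by simp
    qed (simp add: P_def)
    have "(\<Sum>j. ennreal (2 * real j + 1) * (?W n * sphere_sq (P j n)))
      = (\<Sum>j\<le>n. ennreal (2 * real j + 1) * (?W n * (ennreal (1 / (real n + 1) ^ 4) * sphere_sq (p n))))"
      by (subst suminf_finite[of "{..n}"]) (auto simp: PA)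
    also have "\<dots> = ennreal (\<Sum>j\<le>n. 2 * real j + 1) * (?W n * (ennreal (1 / (real n + 1) ^ 4) * sphere_sq (p n)))"
      by (subst sum_ennreal[symmetric]) (auto simp: sum_distrib_right)
    also have "\<dots> = (ennreal ((real n + 1)\<^sup>2) * ennreal ((real n + 1)\<^sup>2) * ennreal (1 / (real n + 1) ^ 4)) * (weight N \<mu> n * sphere_sq (p n))"
      unfolding sum_odd_Suc W by (simp only: mult_ac)
    also have "ennreal ((real n + 1)\<^sup>2) * ennreal ((real n + 1)\<^sup>2) * ennreal (1 / (real n + 1) ^ 4) = 1"
    proof -
      have "(real n + 1)\<^sup>2 * (real n + 1)\<^sup>2 * (1 / (real n + 1) ^ 4) = 1"
        using add_nonneg_pos[of "real n" 1] by (simp add: power_add[symmetric] del: power_add)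
      then show ?thesis by (simp flip: ennreal_mult)
    qed
    finally show "(\<Sum>j. ennreal (2 * real j + 1) * (?W n * sphere_sq (P j n))) = weight N \<mu> n * sphere_sq (p n)" by simp
  qed
  finally show ?thesis .
qed
text \<open>
  Boundedness in order \<open>N\<close> is extracted from the mere inclusion, carried down to order \<open>m\<close> with
  the same constant, and turned back into an inclusion.
\<close>

lemma Mult_antimono:
  fixes \<phi> :: "complex ^ 'd \<Rightarrow> complex"
  assumes \<mu>: "admissible \<mu>" and \<phi>: "\<phi> \<in> Mult N \<mu>" and mN: "m \<le> N"
  shows "\<phi> \<in> Mult m \<mu>"
proof -
  note \<phi>H = Mult_Hol[OF \<mu> \<phi>]
  define \<Phi> where "\<Phi> = (\<lambda>n. hcomp n \<phi>)"
  have g\<Phi>: "graded \<Phi>" unfolding \<Phi>_def by (rule graded_hcomp[OF \<phi>H])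
  have fin: "energy N \<mu> (conv \<Phi> p) < \<infinity>" if p: "graded p" and e: "energy N \<mu> p < \<infinity>" for p
  proof -
    obtain f where f: "f \<in> Besov N \<mu>" "\<And>n. hcomp n f = p n"
      using graded_sum_Besov[OF \<mu> p e] by metis
    have "(\<lambda>z. \<phi> z * f z) \<in> Besov N \<mu>" using \<phi> f(1) by (simp add: Mult_def)
    then show ?thesis
      by (simp add: Besov_iff_energy[OF \<mu>] hcomp_mult_conv[OF \<phi>H Besov_Hol[OF f(1)]] \<Phi>_def f(2))
  qed
  obtain C where C: "C < \<infinity>" "\<forall>p. graded p \<longrightarrow> energy N \<mu> (conv \<Phi> p) \<le> C * energy N \<mu> p"
    using conv_bounded[OF \<mu> g\<Phi> fin] by auto
  have bounded: "\<forall>p. graded p \<longrightarrow> energy m \<mu> (conv \<Phi> p) \<le> C * energy m \<mu> p"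
    using mN
  proof (induction rule: inc_induct)
    case base
    show ?case by (rule C(2))
  next
    case (step k)
    then show ?case using conv_bounded_lower_order[OF g\<Phi>, of k \<mu> C] by simp
  qed
  show ?thesis
    unfolding Mult_def
  proof (intro CollectI ballI)
    fix f :: "complex ^ 'd \<Rightarrow> complex"
    assume f: "f \<in> Besov m \<mu>"
    have "energy m \<mu> (conv \<Phi> (\<lambda>n. hcomp n f)) \<le> C * energy m \<mu> (\<lambda>n. hcomp n f)"
      using bounded graded_hcomp[OF Besov_Hol[OF f]] by simp
    also have "\<dots> < \<infinity>" using f C(1) by (simp add: Besov_iff_energy[OF \<mu>] ennreal_mult_less_top)
    finally show "(\<lambda>z. \<phi> z * f z) \<in> Besov m \<mu>"
      using \<phi>H Besov_Hol[OF f]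
      by (simp add: Besov_iff_energy[OF \<mu>] hcomp_mult_conv \<Phi>_def Hol_mult)
  qed
qed

section \<open>Powers of a bounded quotient\<close>

text \<open>
  \<open>(R \<phi>) u = R (\<phi> u) - \<phi> R u\<close>, where the first term uses that \<open>\<phi>\<close> is a multiplier of order \<open>m+1\<close>
  and the second that it is one of order \<open>m\<close>.
\<close>

lemma Mult_radial_deriv:
  assumes \<mu>: "admissible \<mu>" and \<phi>: "\<phi> \<in> Mult N \<mu>" and mN: "Suc m \<le> N" and u: "u \<in> Besov (Suc m) \<mu>"
  shows "(\<lambda>z. radial_deriv \<phi> z * u z) \<in> Besov m \<mu>"
proof (rule Besov_cong[OF \<mu>])
  have "(\<lambda>z. \<phi> z * u z) \<in> Besov (Suc m) \<mu>"
    using Mult_antimono[OF \<mu> \<phi> mN] u by (simp add: Mult_def)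
  then have 1: "radial_deriv (\<lambda>z. \<phi> z * u z) \<in> Besov m \<mu>" by (simp add: Besov_Suc_iff)
  have "(\<lambda>z. \<phi> z * radial_deriv u z) \<in> Besov m \<mu>"
    using Mult_antimono[OF \<mu> \<phi>, of m] mN u by (simp add: Mult_def Besov_Suc_iff)
  from Besov_add[OF \<mu> 1 Besov_cmult[OF \<mu> this, of "-1"]]
  show "(\<lambda>z. radial_deriv (\<lambda>z. \<phi> z * u z) z + (-1) * (\<phi> z * radial_deriv u z)) \<in> Besov m \<mu>" .
  show "radial_deriv (\<lambda>z. \<phi> z * u z) z + (-1) * (\<phi> z * radial_deriv u z) = radial_deriv \<phi> z * u z"
    if "z \<in> ball 0 1" for z
    using radial_deriv_mult[OF Mult_Hol[OF \<mu> \<phi>] Besov_Hol[OF u] that] by simp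
qed

lemma Besov_0_mult_bounded:
  fixes g u :: "complex ^ 'd \<Rightarrow> complex"
  assumes \<mu>: "admissible \<mu>" and g: "g \<in> Hinf" and u: "u \<in> Besov 0 \<mu>"
  shows "(\<lambda>z. g z * u z) \<in> Besov 0 \<mu>"
proof -
  have gH: "g \<in> Hol (ball 0 1)" and bd: "bounded (g ` ball 0 1)" using g by (simp_all add: Hinf_def)
  from bd obtain M where "\<forall>x\<in>g ` ball 0 1. cmod x \<le> M"
    unfolding bounded_iff by (elim exE)
  then have M: "\<And>z. norm z < 1 \<Longrightarrow> cmod (g z) \<le> M" by simp
  have le: "ennreal ((cmod (g z * u z))\<^sup>2) \<le> ennreal (M\<^sup>2) * ennreal ((cmod (u z))\<^sup>2)" if "norm z < 1" for z
  proof -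
    have "(cmod (g z * u z))\<^sup>2 \<le> M\<^sup>2 * (cmod (u z))\<^sup>2"
      unfolding norm_mult power_mult_distrib by (intro mult_right_mono power_mono M that) auto
    then have "ennreal ((cmod (g z * u z))\<^sup>2) \<le> ennreal (M\<^sup>2 * (cmod (u z))\<^sup>2)" by (rule ennreal_leI)
    then show ?thesis by (simp add: ennreal_mult)
  qed
  note um = Hol_norm_sq_measurable[OF Besov_Hol[OF u]]
  have 1: "(\<integral>\<^sup>+z\<in>ball 0 1. ennreal ((cmod (g z * u z))\<^sup>2) \<partial>radial_measure \<mu>)
      \<le> ennreal (M\<^sup>2) * (\<integral>\<^sup>+z\<in>ball 0 1. ennreal ((cmod (u z))\<^sup>2) \<partial>radial_measure \<mu>)"
  proof -
    have "ennreal (M\<^sup>2) * (\<integral>\<^sup>+z\<in>ball 0 1. ennreal ((cmod (u z))\<^sup>2) \<partial>radial_measure \<mu>)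
      = (\<integral>\<^sup>+z. ennreal (M\<^sup>2) * (ennreal ((cmod (u z))\<^sup>2) * indicator (ball 0 1) z) \<partial>radial_measure \<mu>)"
      using um by (intro nn_integral_cmult[symmetric]) (simp add: radial_measure_def)
    then show ?thesis
      by (simp only:) (intro nn_integral_mono, auto simp: indicator_def le)
  qed
  have 2: "hardy_norm_sq (\<lambda>z. g z * u z) \<le> ennreal (M\<^sup>2) * hardy_norm_sq u"
    unfolding hardy_norm_sq_def
  proof (rule SUP_least)
    fix r :: real assume r: "r \<in> {0<..<1}"
    have [measurable]: "(\<lambda>w. ennreal ((cmod (u (r *\<^sub>R w)))\<^sup>2) * indicator (ball 0 1) (r *\<^sub>R w)) \<in> borel_measurable borel"
      by (rule measurable_compose[OF _ um]) simp
    have [measurable]: "sphere 0 1 \<in> sets (borel :: (complex ^ 'd) measure)" by simp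
    have "(\<lambda>w. ennreal ((cmod (u (r *\<^sub>R w)))\<^sup>2) * indicator (sphere 0 1) w)
        = (\<lambda>w. ennreal ((cmod (u (r *\<^sub>R w)))\<^sup>2) * indicator (ball 0 1) (r *\<^sub>R w) * indicator (sphere 0 1) w)"
      using r by (auto simp: fun_eq_iff indicator_def)
    also have "\<dots> \<in> borel_measurable sphere_measure" by measurable
    finally have "(\<integral>\<^sup>+w. ennreal (M\<^sup>2) * (ennreal ((cmod (u (r *\<^sub>R w)))\<^sup>2) * indicator (sphere 0 1) w) \<partial>sphere_measure)
        = ennreal (M\<^sup>2) * (\<integral>\<^sup>+w\<in>sphere 0 1. ennreal ((cmod (u (r *\<^sub>R w)))\<^sup>2) \<partial>sphere_measure)"
      by (rule nn_integral_cmult)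
    moreover have "(\<integral>\<^sup>+w\<in>sphere 0 1. ennreal ((cmod (g (r *\<^sub>R w) * u (r *\<^sub>R w)))\<^sup>2) \<partial>sphere_measure)
        \<le> (\<integral>\<^sup>+w. ennreal (M\<^sup>2) * (ennreal ((cmod (u (r *\<^sub>R w)))\<^sup>2) * indicator (sphere 0 1) w) \<partial>sphere_measure)"
      using r by (intro nn_integral_mono) (auto simp: indicator_def intro!: le)
    moreover have "(\<integral>\<^sup>+w\<in>sphere 0 1. ennreal ((cmod (u (r *\<^sub>R w)))\<^sup>2) \<partial>sphere_measure)
        \<le> (SUP r\<in>{0<..<1}. \<integral>\<^sup>+w\<in>sphere 0 1. ennreal ((cmod (u (r *\<^sub>R w)))\<^sup>2) \<partial>sphere_measure)"
      by (rule SUP_upper[OF r])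
    ultimately show "(\<integral>\<^sup>+w\<in>sphere 0 1. ennreal ((cmod (g (r *\<^sub>R w) * u (r *\<^sub>R w)))\<^sup>2) \<partial>sphere_measure)
        \<le> ennreal (M\<^sup>2) * (SUP r\<in>{0<..<1}. \<integral>\<^sup>+w\<in>sphere 0 1. ennreal ((cmod (u (r *\<^sub>R w)))\<^sup>2) \<partial>sphere_measure)"
      by (metis (no_types, lifting) mult_left_mono order_trans zero_le)
  qed
  have "L2_norm_sq \<mu> (\<lambda>z. g z * u z) \<le> ennreal (M\<^sup>2) * L2_norm_sq \<mu> u"
    unfolding L2_norm_sq_def distrib_left
    using add_mono[OF 1 mult_left_mono[OF 2, of "emeasure \<mu> {1}"]] by (simp add: mult.left_commute)
  also have "\<dots> < \<infinity>" using u by (simp add: Besov_def ennreal_mult_less_top)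
  finally show ?thesis using gH Besov_Hol[OF u] by (simp add: Besov_def Hol_mult)
qed

lemma Hinf_power:
  assumes "h \<in> Hinf" shows "(\<lambda>z. h z ^ a) \<in> Hinf"
proof -
  have bd: "bounded (h ` ball 0 1)" and "h \<in> Hol (ball 0 1)" using assms by (simp_all add: Hinf_def)
  from bd obtain M where "\<forall>x\<in>h ` ball 0 1. cmod x \<le> M"
    unfolding bounded_iff by (elim exE)
  then have M: "\<And>z. z \<in> ball 0 1 \<Longrightarrow> cmod (h z) \<le> M" by simp
  have "bounded ((\<lambda>z. h z ^ a) ` ball 0 1)"
    unfolding bounded_iff by (intro exI[of _ "M ^ a"]) (auto simp: norm_power intro!: power_mono M)
  then show ?thesis using \<open>h \<in> Hol (ball 0 1)\<close> by (simp add: Hinf_def Hol_power)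
qed

text \<open>
  The exponent \<open>a\<close> of \<open>h\<close> is free because differentiation lowers it in one term and not in the
  others. With \<open>\<psi> R h = R \<phi> - h R \<psi>\<close>,
  \<open>R (h^a \<psi>^(m+1) u) = h^(a-1) \<psi>^m (a R \<phi> u) + h^a \<psi>^m ((m+1-a) R \<psi> u + \<psi> R u)\<close>,
  and both brackets are in the space of order \<open>m\<close>, to which the induction hypothesis applies.
  For \<open>a = 0\<close> the first term vanishes, so the truncated exponent \<open>a - 1\<close> is harmless.
\<close>

lemma Besov_quotient_power:
  fixes \<phi> \<psi> h :: "complex ^ 'd \<Rightarrow> complex"
  assumes \<mu>: "admissible \<mu>" and \<phi>: "\<phi> \<in> Mult N \<mu>" and \<psi>: "\<psi> \<in> Mult N \<mu>"
    and h: "h \<in> Hinf" and eq: "\<And>z. z \<in> ball 0 1 \<Longrightarrow> \<phi> z = h z * \<psi> z"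
    and "m \<le> N" "u \<in> Besov m \<mu>"
  shows "(\<lambda>z. h z ^ a * (\<psi> z ^ m * u z)) \<in> Besov m \<mu>"
  using \<open>m \<le> N\<close> \<open>u \<in> Besov m \<mu>\<close>
proof (induction m arbitrary: a u)
  case 0
  then show ?case using Besov_0_mult_bounded[OF \<mu> Hinf_power[OF h]] by simp
next
  case (Suc m)
  have hH: "h \<in> Hol (ball 0 1)" using h by (simp add: Hinf_def)
  note \<phi>H = Mult_Hol[OF \<mu> \<phi>] and \<psi>H = Mult_Hol[OF \<mu> \<psi>] and uH = Besov_Hol[OF Suc.prems(2)]
  define v where "v z = of_nat a * (radial_deriv \<phi> z * u z)" for z
  define w where "w z = (of_nat (Suc m) - of_nat a) * (radial_deriv \<psi> z * u z) + \<psi> z * radial_deriv u z" for z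
  have v: "v \<in> Besov m \<mu>"
    unfolding v_def[abs_def] by (intro Besov_cmult[OF \<mu>] Mult_radial_deriv[OF \<mu> \<phi>] Suc.prems)
  have w: "w \<in> Besov m \<mu>"
  proof -
    have "(\<lambda>z. \<psi> z * radial_deriv u z) \<in> Besov m \<mu>"
      using Mult_antimono[OF \<mu> \<psi>, of m] Suc.prems by (simp add: Mult_def Besov_Suc_iff)
    then show ?thesis
      unfolding w_def[abs_def] by (intro Besov_add[OF \<mu>] Besov_cmult[OF \<mu>] Mult_radial_deriv[OF \<mu> \<psi>] Suc.prems)
  qed
  have "m \<le> N" using Suc.prems(1) by simp
  from Besov_add[OF \<mu> Suc.IH[OF this v, of "a - 1"] Suc.IH[OF this w, of a]]
  have sum: "(\<lambda>z. h z ^ (a - 1) * (\<psi> z ^ m * v z) + h z ^ a * (\<psi> z ^ m * w z)) \<in> Besov m \<mu>" .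
  let ?F = "\<lambda>z. h z ^ a * (\<psi> z ^ Suc m * u z)"
  have FH: "?F \<in> Hol (ball 0 1)" by (intro Hol_mult Hol_power hH \<psi>H uH)
  have "radial_deriv ?F \<in> Besov m \<mu>"
  proof (rule Besov_cong[OF \<mu> sum])
    fix z :: "complex ^ 'd" assume z: "z \<in> ball 0 1"
    have d\<phi>: "radial_deriv \<phi> z = h z * radial_deriv \<psi> z + radial_deriv h z * \<psi> z"
      using radial_deriv_cong[OF open_ball z eq \<phi>H] radial_deriv_mult[OF hH \<psi>H z] by simp
    have dF: "radial_deriv ?F z = h z ^ a * (\<psi> z ^ Suc m * radial_deriv u z + (of_nat (Suc m) * \<psi> z ^ m * radial_deriv \<psi> z) * u z)
        + (of_nat a * h z ^ (a - 1) * radial_deriv h z) * (\<psi> z ^ Suc m * u z)"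
      using radial_deriv_mult[OF Hol_power[OF hH] Hol_mult[OF Hol_power[OF \<psi>H] uH] z, of a "Suc m"]
        radial_deriv_mult[OF Hol_power[OF \<psi>H] uH z, of "Suc m"]
        radial_deriv_power[OF hH z, of a] radial_deriv_power[OF \<psi>H z, of "Suc m"]
      by (simp only: diff_Suc_1)
    show "h z ^ (a - 1) * (\<psi> z ^ m * v z) + h z ^ a * (\<psi> z ^ m * w z) = radial_deriv ?F z"
    proof (cases a)
      case 0
      then show ?thesis unfolding dF v_def w_def by (simp add: algebra_simps)
    next
      case (Suc b)
      then show ?thesis unfolding dF v_def w_def d\<phi> by (simp add: algebra_simps)
    qed
  qed
  then show ?case using FH by (simp only: Besov_Suc_iff)
qed

theorem theorem3p2:
  fixes N :: nat
    and \<mu> :: "real measure"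
    and \<phi> \<psi> :: "complex ^ 'd \<Rightarrow> complex"
  assumes "N \<ge> 1"
    and "admissible \<mu>"
    and "\<phi> \<in> Mult N \<mu>"
    and "\<psi> \<in> Mult N \<mu>"
    and "quotient_in \<phi> \<psi> Hinf"
  shows "quotient_in (\<lambda>z. \<phi> z ^ (N + 1)) \<psi> (Mult N \<mu>)"
proof -
  note \<mu> = assms(2)
  obtain h where h: "h \<in> Hinf" and hH: "h \<in> Hol (ball 0 1)" and eq: "\<And>z. z \<in> ball 0 1 \<Longrightarrow> \<phi> z = h z * \<psi> z"
    and nz: "\<exists>z\<in>ball 0 1. \<psi> z \<noteq> 0"
    using assms(5) unfolding quotient_in_def by auto
  define k where "k z = h z * \<phi> z ^ N" for z
  have kH: "k \<in> Hol (ball 0 1)"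
    unfolding k_def[abs_def] by (intro Hol_mult Hol_power hH Mult_Hol[OF \<mu> assms(3)])
  have "k \<in> Mult N \<mu>"
    unfolding Mult_def
  proof (intro CollectI ballI)
    fix f :: "complex ^ 'd \<Rightarrow> complex"
    assume f: "f \<in> Besov N \<mu>"
    show "(\<lambda>z. k z * f z) \<in> Besov N \<mu>"
    proof (rule Besov_cong[OF \<mu> Besov_quotient_power[OF \<mu> assms(3,4) h eq order_refl f]])
      fix z :: "complex ^ 'd" assume "z \<in> ball 0 1"
      then show "h z ^ Suc N * (\<psi> z ^ N * f z) = k z * f z"
        by (simp add: k_def eq power_mult_distrib)
    qed
  qed
  moreover have "\<phi> z ^ (N + 1) = k z * \<psi> z" if "z \<in> ball 0 1" for z
    using eq[OF that] by (simp add: k_def)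
  ultimately show ?thesis
    unfolding quotient_in_def using kH nz by blast
qed

end
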